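(* Let $f$ be a Lattès-type map with orbifold type $(2,2,2,2)$. Let $A\colon\mathbb R^2\to\mathbb R^2$ be its corresponding linear map and let $\wp\colon\mathbb R^2\to S^2$ be the Weierstrass function with the lattice $2\mathbb Z^2$, so that $f\circ\wp=\wp\circ\mathcal A$ for an affine map $\mathcal A\colon\mathbb R^2\to\mathbb R^2$ whose linear part is $A$. Let $\mathcal C$ be the Jordan curve that is the image of the boundary of the unit square $[0,1]\times[0,1]$ under $\wp$. Then for all $n>0$ $$\frac{1}{\|A^{-n}\|_\infty}\le D_n(f,\mathcal C)\le \frac{1}{\|A^{-n}\|_\infty}+1 .$$
   Context: $\|v\|_\infty=\max\{|x_1|,|x_2|\}$ for $v=(x_1,x_2)\in\mathbb R^2$, and for a linear map $B$ of $\mathbb R^2$, $\|B\|_\infty=\max\{\|Bv\|_\infty:\|v\|_\infty=1\}$. $S^2$ is an oriented topological $2$-sphere. A branched covering map $f\colon S^2\to S^2$ is a continuous map that near each point $p$ has the form $z\mapsto z^{d}$, $d=\deg_f(p)\ge1$, in suitable orientation-preserving local coordinates centered at $p$ and $f(p)$; $p$ is critical if $\deg_f(p)\ge2$. $\mathrm{post}(f)=\bigcup_{n\ge1}\{f^n(c): c\text{ critical point of }f\}$. Lattès-type maps: let $\mathcal L\subset\mathbb R^2$ be a rank-$2$ lattice and $T=\mathbb R^2/\mathcal L$. A torus endomorphism $\bar A\colon T\to T$ is a map induced by an orientation-preserving affine map of $\mathbb R^2$ sending points that differ by an element of $\mathcal L$ to points that differ by an element of $\mathcal L$; it is a torus automorphism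 if bijective. Its eigenvalues are those of the linear part of the affine map. A branched cover $\Theta\colon T\to S^2$ is induced by a rigid action of a group $G$ on $T$ if every $g\in G$ acts as a torus automorphism and $\Theta(t)=\Theta(t')$ if and only if $t=g(t')$ for some $g\in G$. A map $f\colon S^2\to S^2$ is a Lattès-type map if $f\circ\Theta=\Theta\circ\bar A$ for some torus endomorphism $\bar A$ of some $T$ all of whose eigenvalues have absolute value $>1$ and some branched covering map $\Theta\colon T\to S^2$ induced by a rigid action of a finite cyclic group. Every Lattès-type map $f$ is a branched covering map of degree at least $2$ with $\mathrm{post}(f)$ finite. Orbifold type: let $\nu_f\colon S^2\to\mathbb N\cup\{\infty\}$ be the smallest function (for pointwise divisibility) such that $\nu_f(p)\deg_f(p)$ divides $\nu_f(f(p))$ for all $p\in S^2$. If $\mathrm{post}(f)=\{p_1,\dots,p_m\}$, the orbifold type of $f$ is $(\nu_f(p_1),\dots,\nu_f(p_m))$. Normalization: a Lattès-type map over any lattice is Lattès-type over $2\mathbb Z^2$, so one takes $\mathcal L=2\mathbb Z^2$; for orbifold type $(2,2,2,2)$ the composition of the quotient map $\mathbb R^2\to\mathbb R^2/2\mathbb Z^2$ with $\Theta$ is identified with the Weierstrass function $\wp\colon\mathbb R^2=\mathbb C\to\widehat{\mathbb C}\cong S^2$ of the lattice $2\mathbb Z^2=2\mathbb Z+2i\mathbb Z$ (so $\wp(z)=\wp(w)$ if and only if $z\equiv\pm w \bmod 2\mathbb Z^2$). The linear map corresponding to $f$ is the linear part $A$ of the affine lift $\mathcal A$ of $\bar A$.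 The curve $\mathcal C$ contains $\mathrm{post}(f)$, which has four points. $D_n$: the $n$-tiles are the closures of the connected components of $S^2\setminus f^{-n}(\mathcal C)$; the $0$-edges are the closed arcs into which $\mathrm{post}(f)$ divides $\mathcal C$. $D_n(f,\mathcal C)$ is the minimal number $N$ of $n$-tiles $X_1,\dots,X_N$ such that $\bigcup_j X_j$ is connected and meets two disjoint $0$-edges. *)

theory Defs
  imports
    "HOL-Complex_Analysis.Complex_Analysis"
    "HOL-Algebra.Group_Action"
    "HOL-Algebra.Elementary_Groups"
    "HOL-Library.Extended_Nat"
begin

section \<open>Oriented surfaces and branched coverings\<close>

text \<open>
  A chart is a pair of its domain and its coordinate map. A surface is a topology, and an
  orientation is an atlas whose coordinate changes preserve orientation.
\<close>

type_synonym 'a chart = "'a set \<times> ('a \<Rightarrow> complex)"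

definition is_chart :: "'a topology \<Rightarrow> 'a chart \<Rightarrow> bool" where
  "is_chart X c \<longleftrightarrow> (case c of (U, \<phi>) \<Rightarrow>
     openin X U \<and> open (\<phi> ` U) \<and>
     homeomorphic_map (subtopology X U) (top_of_set (\<phi> ` U)) \<phi>)"

text \<open>
  For continuous injective \<open>\<phi>\<close> on the open set \<open>W\<close>: small positively oriented circles are mapped to
  closed curves that wind once, in the positive direction, around the image of the centre.
\<close>

definition orientation_preserving_on :: "complex set \<Rightarrow> (complex \<Rightarrow> complex) \<Rightarrow> bool" where
  "orientation_preserving_on W \<phi> \<longleftrightarrow>
     (\<forall>z r. 0 < r \<and> cball z r \<subseteq> W \<longrightarrow> winding_number (\<phi> \<circ> circlepath z r) (\<phi> z) = 1)"

definition compatible_charts :: "'a chart \<Rightarrow> 'a chart \<Rightarrow> bool" where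
  "compatible_charts c c' \<longleftrightarrow> (case (c, c') of ((U, \<phi>), (V, \<psi>)) \<Rightarrow>
     orientation_preserving_on (\<phi> ` (U \<inter> V)) (\<psi> \<circ> inv_into U \<phi>))"

definition oriented_atlas :: "'a topology \<Rightarrow> 'a chart set \<Rightarrow> bool" where
  "oriented_atlas X \<O> \<longleftrightarrow>
     (\<forall>c\<in>\<O>. is_chart X c) \<and> (\<Union>c\<in>\<O>. fst c) = topspace X \<and>
     (\<forall>c\<in>\<O>. \<forall>c'\<in>\<O>. compatible_charts c c')"

definition positive_chart :: "'a topology \<Rightarrow> 'a chart set \<Rightarrow> 'a chart \<Rightarrow> bool" where
  "positive_chart X \<O> c \<longleftrightarrow> is_chart X c \<and> (\<forall>c'\<in>\<O>. compatible_charts c c')"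

definition oriented_sphere :: "'a topology \<Rightarrow> 'a chart set \<Rightarrow> bool" where
  "oriented_sphere X \<O> \<longleftrightarrow>
     X homeomorphic_space top_of_set (sphere (0 :: real ^ 3) 1) \<and> oriented_atlas X \<O>"

definition has_local_form ::
  "'a topology \<Rightarrow> 'a chart set \<Rightarrow> 'b topology \<Rightarrow> 'b chart set \<Rightarrow> ('a \<Rightarrow> 'b) \<Rightarrow> 'a \<Rightarrow> nat \<Rightarrow> bool" where
  "has_local_form X \<O>\<^sub>X Y \<O>\<^sub>Y f p d \<longleftrightarrow>
     (\<exists>U \<phi> V \<psi>. positive_chart X \<O>\<^sub>X (U, \<phi>) \<and> positive_chart Y \<O>\<^sub>Y (V, \<psi>) \<and>
        p \<in> U \<and> \<phi> p = 0 \<and> f p \<in> V \<and> \<psi> (f p) = 0 \<and>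
        f ` U \<subseteq> V \<and> (\<forall>x\<in>U. \<psi> (f x) = \<phi> x ^ d))"

definition branched_covering ::
  "'a topology \<Rightarrow> 'a chart set \<Rightarrow> 'b topology \<Rightarrow> 'b chart set \<Rightarrow> ('a \<Rightarrow> 'b) \<Rightarrow> bool" where
  "branched_covering X \<O>\<^sub>X Y \<O>\<^sub>Y f \<longleftrightarrow>
     continuous_map X Y f \<and>
     (\<forall>p\<in>topspace X. \<exists>d\<ge>1. has_local_form X \<O>\<^sub>X Y \<O>\<^sub>Y f p d)"

definition local_degree :: "'a topology \<Rightarrow> 'a chart set \<Rightarrow> ('a \<Rightarrow> 'a) \<Rightarrow> 'a \<Rightarrow> nat" where
  "local_degree X \<O> f p = (THE d. d \<ge> 1 \<and> has_local_form X \<O> X \<O> f p d)"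

definition critical_points :: "'a topology \<Rightarrow> 'a chart set \<Rightarrow> ('a \<Rightarrow> 'a) \<Rightarrow> 'a set" where
  "critical_points X \<O> f = {p \<in> topspace X. local_degree X \<O> f p \<ge> 2}"

definition post :: "'a topology \<Rightarrow> 'a chart set \<Rightarrow> ('a \<Rightarrow> 'a) \<Rightarrow> 'a set" where
  "post X \<O> f = (\<Union>n\<in>{1..}. (f ^^ n) ` critical_points X \<O> f)"

section \<open>Orbifold type\<close>

text \<open>
  The values of \<open>\<nu>\<close> range over the positive integers and \<open>\<infinity>\<close>. In \<^typ>\<open>enat\<close> every positive element
  divides \<open>\<infinity>\<close>, whereas \<open>\<infinity>\<close> divides no positive integer.
\<close>

definition orbifold_weight ::
  "'a topology \<Rightarrow> 'a chart set \<Rightarrow> ('a \<Rightarrow> 'a) \<Rightarrow> ('a \<Rightarrow> enat) \<Rightarrow> bool" where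
  "orbifold_weight X \<O> f \<nu> \<longleftrightarrow>
     (\<forall>p\<in>topspace X. \<nu> p \<noteq> 0 \<and> \<nu> p * enat (local_degree X \<O> f p) dvd \<nu> (f p))"

definition ramification_function ::
  "'a topology \<Rightarrow> 'a chart set \<Rightarrow> ('a \<Rightarrow> 'a) \<Rightarrow> ('a \<Rightarrow> enat) \<Rightarrow> bool" where
  "ramification_function X \<O> f \<nu> \<longleftrightarrow>
     orbifold_weight X \<O> f \<nu> \<and>
     (\<forall>\<mu>. orbifold_weight X \<O> f \<mu> \<longrightarrow> (\<forall>p\<in>topspace X. \<nu> p dvd \<mu> p))"

text \<open>
  The type is a tuple that depends on the enumeration of the postcritical points; \<open>\<tau>\<close> is a type
  if it arises from some enumeration without repetitions.
\<close>

definition has_orbifold_type ::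
  "'a topology \<Rightarrow> 'a chart set \<Rightarrow> ('a \<Rightarrow> 'a) \<Rightarrow> enat list \<Rightarrow> bool" where
  "has_orbifold_type X \<O> f \<tau> \<longleftrightarrow>
     (\<exists>\<nu> ps. ramification_function X \<O> f \<nu> \<and>
        distinct ps \<and> set ps = post X \<O> f \<and> map \<nu> ps = \<tau>)"

section \<open>Affine maps of the plane\<close>

definition linear_part :: "(real ^ 2 \<Rightarrow> real ^ 2) \<Rightarrow> real ^ 2 \<Rightarrow> real ^ 2" where
  "linear_part \<A> = (\<lambda>v. \<A> v - \<A> 0)"

definition orientation_preserving_affine :: "(real ^ 2 \<Rightarrow> real ^ 2) \<Rightarrow> bool" where
  "orientation_preserving_affine \<A> \<longleftrightarrow>
     linear (linear_part \<A>) \<and> det (matrix (linear_part \<A>)) > 0"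

definition complex_eigenvalues :: "(real ^ 2 \<Rightarrow> real ^ 2) \<Rightarrow> complex set" where
  "complex_eigenvalues B =
     {\<mu>. \<exists>w :: complex ^ 2. w \<noteq> 0 \<and> map_matrix complex_of_real (matrix B) *v w = \<mu> *s w}"

text \<open>
  \<^const>\<open>infnorm\<close> is the maximum norm. For linear \<open>B\<close> the supremum is attained, since the unit sphere
  of \<^const>\<open>infnorm\<close> is compact.
\<close>

definition infnorm_op :: "(real ^ 2 \<Rightarrow> real ^ 2) \<Rightarrow> real" where
  "infnorm_op B = (SUP v\<in>{v. infnorm v = 1}. infnorm (B v))"

definition plane_to_complex :: "real ^ 2 \<Rightarrow> complex" where
  "plane_to_complex v = Complex (v $ 1) (v $ 2)"

section \<open>Tori and Lattes-type maps\<close>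

definition rank2_lattice :: "(real ^ 2) set \<Rightarrow> bool" where
  "rank2_lattice L \<longleftrightarrow>
     (\<exists>u v. u \<noteq> v \<and> independent {u, v} \<and>
        L = {of_int m *\<^sub>R u + of_int n *\<^sub>R v | m n :: int. True})"

definition two_Z2 :: "(real ^ 2) set" where
  "two_Z2 = {v. \<forall>i. \<exists>k :: int. v $ i = 2 * of_int k}"

text \<open>The points of the torus are the cosets of \<open>L\<close>, and it carries the quotient topology.\<close>

definition torus_proj :: "(real ^ 2) set \<Rightarrow> real ^ 2 \<Rightarrow> (real ^ 2) set" where
  "torus_proj L v = {w. w - v \<in> L}"

definition torus :: "(real ^ 2) set \<Rightarrow> (real ^ 2) set topology" where
  "torus L = topology (\<lambda>\<U>. \<U> \<subseteq> range (torus_proj L) \<and> open (torus_proj L -` \<U>))"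

lemma openin_torus:
  "openin (torus L) \<U> \<longleftrightarrow> \<U> \<subseteq> range (torus_proj L) \<and> open (torus_proj L -` \<U>)"
proof -
  have "istopology (\<lambda>\<U>. \<U> \<subseteq> range (torus_proj L) \<and> open (torus_proj L -` \<U>))"
    unfolding istopology_def
  proof (intro conjI allI impI)
    fix \<K> assume "\<forall>K\<in>\<K>. K \<subseteq> range (torus_proj L) \<and> open (torus_proj L -` K)"
    then show "\<Union>\<K> \<subseteq> range (torus_proj L)" "open (torus_proj L -` \<Union>\<K>)"
      by (blast, simp add: vimage_Union open_UN)
  qed (blast, simp add: open_Int)
  then show ?thesis
    by (simp add: torus_def)
qed

lemma topspace_torus: "topspace (torus L) = range (torus_proj L)"
proof
  show "topspace (torus L) \<subseteq> range (torus_proj L)"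
    unfolding topspace_def openin_torus by blast
  have "openin (torus L) (range (torus_proj L))"
    by (simp add: openin_torus vimage_def)
  then show "range (torus_proj L) \<subseteq> topspace (torus L)"
    by (rule openin_subset)
qed

lemma quotient_map_torus: "quotient_map euclidean (torus L) (torus_proj L)"
  unfolding quotient_map_def topspace_torus
  by (simp add: openin_torus vimage_def)

text \<open>The orientation of the torus is induced from the plane by local sections of the projection.\<close>

definition torus_atlas :: "(real ^ 2) set \<Rightarrow> (real ^ 2) set chart set" where
  "torus_atlas L =
     {(torus_proj L ` W, plane_to_complex \<circ> inv_into W (torus_proj L)) | W.
        open W \<and> inj_on (torus_proj L) W}"

definition torus_endomorphism_lift ::
  "(real ^ 2) set \<Rightarrow> (real ^ 2 \<Rightarrow> real ^ 2) \<Rightarrow> ((real ^ 2) set \<Rightarrow> (real ^ 2) set) \<Rightarrow> bool" where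
  "torus_endomorphism_lift L \<A> g \<longleftrightarrow>
     orientation_preserving_affine \<A> \<and>
     (\<forall>x y. x - y \<in> L \<longrightarrow> \<A> x - \<A> y \<in> L) \<and>
     (\<forall>x. g (torus_proj L x) = torus_proj L (\<A> x))"

definition torus_automorphism ::
  "(real ^ 2) set \<Rightarrow> ((real ^ 2) set \<Rightarrow> (real ^ 2) set) \<Rightarrow> bool" where
  "torus_automorphism L g \<longleftrightarrow>
     (\<exists>\<A>. torus_endomorphism_lift L \<A> g) \<and>
     bij_betw g (topspace (torus L)) (topspace (torus L))"

text \<open>
  Every finite cyclic group is isomorphic to one whose elements are integers, so the restriction
  to groups of type \<^typ>\<open>int monoid\<close> loses no generality.
\<close>

definition induced_by_rigid_cyclic_action ::
  "(real ^ 2) set \<Rightarrow> ((real ^ 2) set \<Rightarrow> 'a) \<Rightarrow> bool" where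
  "induced_by_rigid_cyclic_action L \<Theta> \<longleftrightarrow>
     (\<exists>(G :: int monoid) \<alpha>.
        cyclic_group G \<and> finite (carrier G) \<and> group_action G (topspace (torus L)) \<alpha> \<and>
        (\<forall>g\<in>carrier G. torus_automorphism L (\<alpha> g)) \<and>
        (\<forall>t\<in>topspace (torus L). \<forall>t'\<in>topspace (torus L).
           \<Theta> t = \<Theta> t' \<longleftrightarrow> (\<exists>g\<in>carrier G. t = \<alpha> g t')))"

text \<open>\<open>\<A>\<close> is the affine lift of the torus endomorphism to which \<open>f\<close> is semiconjugate via \<open>\<Theta>\<close>.\<close>

definition lattes_presentation ::
  "'a topology \<Rightarrow> 'a chart set \<Rightarrow> ('a \<Rightarrow> 'a) \<Rightarrow>
   (real ^ 2) set \<Rightarrow> (real ^ 2 \<Rightarrow> real ^ 2) \<Rightarrow> ((real ^ 2) set \<Rightarrow> 'a) \<Rightarrow> bool" where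
  "lattes_presentation X \<O> f L \<A> \<Theta> \<longleftrightarrow>
     rank2_lattice L \<and>
     (\<forall>\<mu>\<in>complex_eigenvalues (linear_part \<A>). cmod \<mu> > 1) \<and>
     branched_covering (torus L) (torus_atlas L) X \<O> \<Theta> \<and>
     induced_by_rigid_cyclic_action L \<Theta> \<and>
     (\<exists>g. torus_endomorphism_lift L \<A> g \<and> (\<forall>t\<in>topspace (torus L). f (\<Theta> t) = \<Theta> (g t)))"

definition lattes_type_map :: "'a topology \<Rightarrow> 'a chart set \<Rightarrow> ('a \<Rightarrow> 'a) \<Rightarrow> bool" where
  "lattes_type_map X \<O> f \<longleftrightarrow> (\<exists>L \<A> \<Theta>. lattes_presentation X \<O> f L \<A> \<Theta>)"

section \<open>The Weierstrass function\<close>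

text \<open>\<^const>\<open>None\<close> is the point at infinity of the Riemann sphere.\<close>

definition riemann_sphere :: "complex option topology" where
  "riemann_sphere = Alexandroff_compactification euclidean"

definition weierstrass_p :: "complex set \<Rightarrow> complex \<Rightarrow> complex option" where
  "weierstrass_p \<Lambda> z =
     (if z \<in> \<Lambda> then None
      else Some (1 / z\<^sup>2 + (\<Sum>\<^sub>\<infinity>\<omega>\<in>\<Lambda> - {0}. 1 / (z - \<omega>)\<^sup>2 - 1 / \<omega>\<^sup>2)))"

definition wp :: "real ^ 2 \<Rightarrow> complex option" where
  "wp v = weierstrass_p (plane_to_complex ` two_Z2) (plane_to_complex v)"

section \<open>Tiles, edges and the number \<open>D\<^sub>n\<close>\<close>

definition tiles :: "'a topology \<Rightarrow> ('a \<Rightarrow> 'a) \<Rightarrow> 'a set \<Rightarrow> nat \<Rightarrow> 'a set set" where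
  "tiles X f C n =
     (\<lambda>K. X closure_of K) `
       connected_components_of (subtopology X (topspace X - {x \<in> topspace X. (f ^^ n) x \<in> C}))"

text \<open>
  The closed arcs into which the postcritical points divide the curve are the closures of the
  components of their complement in the curve.
\<close>

definition zero_edges :: "'a topology \<Rightarrow> 'a chart set \<Rightarrow> ('a \<Rightarrow> 'a) \<Rightarrow> 'a set \<Rightarrow> 'a set set" where
  "zero_edges X \<O> f C =
     (\<lambda>K. X closure_of K) ` connected_components_of (subtopology X (C - post X \<O> f))"

definition joins_opposite_sides ::
  "'a topology \<Rightarrow> 'a chart set \<Rightarrow> ('a \<Rightarrow> 'a) \<Rightarrow> 'a set \<Rightarrow> 'a set \<Rightarrow> bool" where
  "joins_opposite_sides X \<O> f C K \<longleftrightarrow>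
     (\<exists>E\<in>zero_edges X \<O> f C. \<exists>E'\<in>zero_edges X \<O> f C.
        E \<inter> E' = {} \<and> K \<inter> E \<noteq> {} \<and> K \<inter> E' \<noteq> {})"

definition D_num ::
  "'a topology \<Rightarrow> 'a chart set \<Rightarrow> ('a \<Rightarrow> 'a) \<Rightarrow> 'a set \<Rightarrow> nat \<Rightarrow> nat" where
  "D_num X \<O> f C n =
     (LEAST N. \<exists>T :: nat \<Rightarrow> 'a set.
        (\<forall>j\<in>{1..N}. T j \<in> tiles X f C n) \<and>
        connectedin X (\<Union>j\<in>{1..N}. T j) \<and>
        joins_opposite_sides X \<O> f C (\<Union>j\<in>{1..N}. T j))"

end

theory Submission
  imports Defs
begin

text \<open>
  The Weierstrass function makes the sphere a pillow: the quotient of the plane by the group generated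
  by the translations in \<open>2\<int>\<^sup>2\<close> and \<open>x \<mapsto> -x\<close>. The \<open>n\<close>-tiles are the images of the unit squares
  with integer vertices under \<open>\<A>\<^sup>-\<^sup>n\<close>, followed by \<open>\<P>\<close>, and the 0-edges are the images of the
  four sides of the unit square.

  Lower bound: the distance of the \<open>i\<close>-th coordinate to \<open>2\<int>\<close> descends to a continuous function on the
  sphere that is 0 and 1 on the two opposite 0-edges in question. A connected set joining them is mapped
  onto \<open>[0, 1]\<close>, while a tile is mapped to a set of diameter at most \<open>\<parallel>A\<^sup>-\<^sup>n\<parallel>\<close>.

  Upper bound: the norm of \<open>A\<^sup>-\<^sup>n\<close> is attained by a coordinate of \<open>A\<^sup>-\<^sup>n v\<close> for some
  \<open>v = (\<plusminus>1, \<plusminus>1)\<close>. Squares strung along the diagonal \<open>v\<close> give tiles joined at their vertices, each of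
  which advances that coordinate by \<open>\<parallel>A\<^sup>-\<^sup>n\<parallel>\<close>.
\<close>

text \<open>The fibres of \<open>wp\<close> are not read off from its series. Its factorisation
  through the torus gives periodicity, the rigid cyclic action gives a group of integer matrices,
  and the symmetries of the square lattice leave only 1 and -1 in that group.

  The postcritical set is shaped by the definition of \<open>local_degree\<close> through
  \<open>THE\<close>, whose value is unspecified where no local form exists. Injectivity of f near a
  point therefore does not yet make the point noncritical: an orientation-preserving local form has
  to be produced. The winding number arguments do this at isolated exceptional points, by
  transporting the orientation from their neighbours.

  The translation part of the lift is integral because f takes one value at the common image of x
  and -x. This makes 0 a vertex of the tiling and the image of \<open>Z2\<close> forward invariant,
  hence a set that contains the postcritical points.

  The lower bound is an estimate of length: N sets of diameter at most d cover [0, 1] only if N d is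
  at least 1. The summand 1 in the upper bound is the cost of rounding 1 / d up to an integer number
  of squares.\<close>

no_notation fps_nth (infixl "$" 75)

section \<open>The lattice and the torus\<close>

lemma vec2_eq_iff: "x = y \<longleftrightarrow> x $ 1 = y $ 1 \<and> x $ 2 = y $ 2" for x y :: "'b ^ 2"
  by (simp add: vec_eq_iff forall_2)

lemma two_Z2_iff: "v \<in> two_Z2 \<longleftrightarrow> (\<exists>k l :: int. v $ 1 = 2 * of_int k \<and> v $ 2 = 2 * of_int l)"
  by (auto simp: two_Z2_def forall_2)

lemma two_Z2_component: "v \<in> two_Z2 \<longleftrightarrow> (\<forall>i. v $ i / 2 \<in> \<int>)"
proof -
  have "(\<exists>k :: int. t = 2 * of_int k) \<longleftrightarrow> t / 2 \<in> \<int>" for t :: real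
    by (auto simp: Ints_def field_simps)
  then show ?thesis
    by (simp add: two_Z2_def)
qed

lemma two_Z2_0: "0 \<in> two_Z2"
  by (simp add: two_Z2_component)

lemma two_Z2_add: "x \<in> two_Z2 \<Longrightarrow> y \<in> two_Z2 \<Longrightarrow> x + y \<in> two_Z2"
  by (simp add: two_Z2_component add_divide_distrib)

lemma two_Z2_minus: "x \<in> two_Z2 \<Longrightarrow> - x \<in> two_Z2"
  by (simp add: two_Z2_component)

lemma two_Z2_diff: "x \<in> two_Z2 \<Longrightarrow> y \<in> two_Z2 \<Longrightarrow> x - y \<in> two_Z2"
  by (simp add: two_Z2_component diff_divide_distrib)

lemma torus_proj_eq_iff: "torus_proj two_Z2 x = torus_proj two_Z2 y \<longleftrightarrow> x - y \<in> two_Z2"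
proof
  assume "torus_proj two_Z2 x = torus_proj two_Z2 y"
  moreover have "x \<in> torus_proj two_Z2 x"
    by (simp add: torus_proj_def two_Z2_0)
  ultimately show "x - y \<in> two_Z2"
    by (auto simp: torus_proj_def)
next
  assume *: "x - y \<in> two_Z2"
  show "torus_proj two_Z2 x = torus_proj two_Z2 y"
    unfolding torus_proj_def using two_Z2_add[OF _ *] two_Z2_diff[OF _ *] by fastforce
qed

lemma closed_two_Z2: "closed two_Z2"
proof -
  have "two_Z2 = (\<Inter>i. (\<lambda>v. v $ i / 2) -` \<int>)"
    by (auto simp: two_Z2_component)
  moreover have "closed ((\<lambda>v :: real ^ 2. v $ i / 2) -` \<int>)" for i
    by (intro closed_vimage continuous_intros closed_Ints) simp
  then have "closed (\<Inter>i. (\<lambda>v :: real ^ 2. v $ i / 2) -` \<int>)"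
    by (intro closed_INT ballI)
  ultimately show ?thesis
    by (simp only:)
qed

lemma open_map_torus_proj: "open_map euclidean (torus two_Z2) (torus_proj two_Z2)"
  unfolding open_map_def openin_torus
proof (intro allI impI conjI)
  fix U :: "(real ^ 2) set" assume U: "openin euclidean U"
  have "torus_proj two_Z2 -` torus_proj two_Z2 ` U = (\<Union>l\<in>two_Z2. (+) l ` U)"
  proof
    show "torus_proj two_Z2 -` torus_proj two_Z2 ` U \<subseteq> (\<Union>l\<in>two_Z2. (+) l ` U)"
    proof
      fix x assume "x \<in> torus_proj two_Z2 -` torus_proj two_Z2 ` U"
      then obtain u where "u \<in> U" "x - u \<in> two_Z2"
        by (auto simp: torus_proj_eq_iff)
      then show "x \<in> (\<Union>l\<in>two_Z2. (+) l ` U)"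
        by (intro UN_I[of "x - u"]) auto
    qed
    show "(\<Union>l\<in>two_Z2. (+) l ` U) \<subseteq> torus_proj two_Z2 -` torus_proj two_Z2 ` U"
    proof clarsimp
      fix l u assume "l \<in> two_Z2" "u \<in> U"
      then have "torus_proj two_Z2 (l + u) = torus_proj two_Z2 u"
        by (simp add: torus_proj_eq_iff)
      then show "torus_proj two_Z2 (l + u) \<in> torus_proj two_Z2 ` U"
        using \<open>u \<in> U\<close> by simp
    qed
  qed
  then show "open (torus_proj two_Z2 -` torus_proj two_Z2 ` U)"
    using U by (auto intro: open_translation)
qed auto

section \<open>Fibres of the Weierstrass function\<close>

text \<open>The series is homogeneous of degree -2 and multiplication by \<open>a\<close> permutes
  the lattice. Reindexing and extracting the factor are valid for \<open>infsum\<close> whether or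
  not the family is summable.\<close>

lemma weierstrass_p_mult:
  assumes a: "a \<noteq> 0" "(*) a ` \<Lambda> = \<Lambda>"
  shows "weierstrass_p \<Lambda> (a * z) = map_option ((*) (1 / a\<^sup>2)) (weierstrass_p \<Lambda> z)"
proof -
  have inj: "inj ((*) a)"
    using a by (auto intro: injI)
  then have mem: "a * z \<in> \<Lambda> \<longleftrightarrow> z \<in> \<Lambda>" for z
    by (metis a(2) inj_image_mem_iff)
  have "bij_betw ((*) a) (\<Lambda> - {0}) (\<Lambda> - {0})"
    using inj a by (auto simp: bij_betw_def inj_on_def image_set_diff)
  then have "(\<Sum>\<^sub>\<infinity>\<omega>\<in>\<Lambda> - {0}. 1 / (a * z - \<omega>)\<^sup>2 - 1 / \<omega>\<^sup>2)
      = (\<Sum>\<^sub>\<infinity>\<omega>\<in>\<Lambda> - {0}. 1 / (a * z - a * \<omega>)\<^sup>2 - 1 / (a * \<omega>)\<^sup>2)"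
    by (rule infsum_reindex_bij_betw[symmetric])
  also have "\<dots> = (\<Sum>\<^sub>\<infinity>\<omega>\<in>\<Lambda> - {0}. 1 / a\<^sup>2 * (1 / (z - \<omega>)\<^sup>2 - 1 / \<omega>\<^sup>2))"
  proof (rule infsum_cong)
    fix \<omega>
    have *: "a * z - a * \<omega> = a * (z - \<omega>)"
      by (simp add: right_diff_distrib)
    show "1 / (a * z - a * \<omega>)\<^sup>2 - 1 / (a * \<omega>)\<^sup>2 = 1 / a\<^sup>2 * (1 / (z - \<omega>)\<^sup>2 - 1 / \<omega>\<^sup>2)"
      unfolding * power_mult_distrib by (simp only: right_diff_distrib times_divide_times_eq mult_1)
  qed
  also have "\<dots> = 1 / a\<^sup>2 * (\<Sum>\<^sub>\<infinity>\<omega>\<in>\<Lambda> - {0}. 1 / (z - \<omega>)\<^sup>2 - 1 / \<omega>\<^sup>2)"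
    by (rule infsum_cmult_right')
  finally show ?thesis
    by (simp add: weierstrass_p_def mem power_mult_distrib distrib_left)
qed

lemma weierstrass_p_cnj:
  assumes "cnj ` \<Lambda> = \<Lambda>"
  shows "weierstrass_p \<Lambda> (cnj z) = map_option cnj (weierstrass_p \<Lambda> z)"
proof -
  have inj: "inj cnj"
    by (auto intro: injI)
  then have mem: "cnj z \<in> \<Lambda> \<longleftrightarrow> z \<in> \<Lambda>" for z
    by (metis assms inj_image_mem_iff)
  have "bij_betw cnj (\<Lambda> - {0}) (\<Lambda> - {0})"
    using inj assms by (auto simp: bij_betw_def inj_on_def image_set_diff)
  then have "(\<Sum>\<^sub>\<infinity>\<omega>\<in>\<Lambda> - {0}. 1 / (cnj z - \<omega>)\<^sup>2 - 1 / \<omega>\<^sup>2)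
      = (\<Sum>\<^sub>\<infinity>\<omega>\<in>\<Lambda> - {0}. 1 / (cnj z - cnj \<omega>)\<^sup>2 - 1 / (cnj \<omega>)\<^sup>2)"
    by (rule infsum_reindex_bij_betw[symmetric])
  also have "\<dots> = (\<Sum>\<^sub>\<infinity>\<omega>\<in>\<Lambda> - {0}. cnj (1 / (z - \<omega>)\<^sup>2 - 1 / \<omega>\<^sup>2))"
    by simp
  also have "\<dots> = cnj (\<Sum>\<^sub>\<infinity>\<omega>\<in>\<Lambda> - {0}. 1 / (z - \<omega>)\<^sup>2 - 1 / \<omega>\<^sup>2)"
    by (rule infsum_cnj)
  finally show ?thesis
    by (simp add: weierstrass_p_def mem)
qed

section \<open>Integer matrices acting on the plane, and generic points\<close>

definition int_linear :: "int \<Rightarrow> int \<Rightarrow> int \<Rightarrow> int \<Rightarrow> real ^ 2 \<Rightarrow> real ^ 2" where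
  "int_linear a b c d x =
     vector [of_int a * x $ 1 + of_int b * x $ 2, of_int c * x $ 1 + of_int d * x $ 2]"

lemma int_linear_nth [simp]:
  "int_linear a b c d x $ 1 = of_int a * x $ 1 + of_int b * x $ 2"
  "int_linear a b c d x $ 2 = of_int c * x $ 1 + of_int d * x $ 2"
  by (simp_all add: int_linear_def)

lemma int_linear_compose:
  "int_linear a b c d (int_linear a' b' c' d' x) =
   int_linear (a * a' + b * c') (a * b' + b * d') (c * a' + d * c') (c * b' + d * d') x"
  by (simp add: vec2_eq_iff algebra_simps)

lemma int_linear_id: "int_linear 1 0 0 1 x = x"
  by (simp add: vec2_eq_iff)

lemma int_linear_two_Z2:
  assumes "x \<in> two_Z2"
  shows "int_linear a b c d x \<in> two_Z2"
proof -
  obtain k l :: int where "x $ 1 = 2 * of_int k" "x $ 2 = 2 * of_int l"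
    using assms by (auto simp: two_Z2_iff)
  then show ?thesis
    unfolding two_Z2_iff
    by (intro exI[of _ "a * k + b * l"] exI[of _ "c * k + d * l"]) (simp add: algebra_simps)
qed

text \<open>Twice a unit vector lies in the lattice, so its image has even coordinates; halving them
  gives integer columns.\<close>

lemma linear_two_Z2_imp_int_linear:
  assumes "linear B" and "\<And>x. x \<in> two_Z2 \<Longrightarrow> B x \<in> two_Z2"
  obtains a b c d where "B = int_linear a b c d" "det (matrix B) = of_int (a * d - b * c)"
proof -
  have int: "\<exists>k :: int. B (axis j 1) $ i = of_int k" for i j
  proof -
    have "2 *\<^sub>R axis j 1 \<in> two_Z2"
      unfolding two_Z2_component by (auto simp: axis_def)
    then have "B (2 *\<^sub>R axis j 1) \<in> two_Z2"
      by (rule assms(2))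
    then show ?thesis
      using assms(1) by (auto simp: two_Z2_def linear_cmul)
  qed
  obtain a b c d :: int where *: "B (axis 1 1) $ 1 = of_int a" "B (axis 2 1) $ 1 = of_int b"
      "B (axis 1 1) $ 2 = of_int c" "B (axis 2 1) $ 2 = of_int d"
    using int by meson
  have mat: "matrix B $ i $ j = B (axis j 1) $ i" for i j
    by (simp add: matrix_def)
  have "B x = int_linear a b c d x" for x
  proof -
    have "B x = matrix B *v x"
      using assms(1) by (simp add: matrix_works)
    then show ?thesis
      by (simp add: vec2_eq_iff matrix_vector_mult_def sum_2 mat *)
  qed
  moreover have "det (matrix B) = of_int (a * d - b * c)"
    by (simp add: det_2 mat *)
  ultimately show ?thesis
    using that by blast
qed

text \<open>Linear independence of 1 and the two coordinates over the rationals. The value of an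
  integer matrix at such a point, even modulo the lattice, determines the matrix, so equations
  between group elements become equations between entries.\<close>

definition generic_vector :: "real ^ 2 \<Rightarrow> bool" where
  "generic_vector x \<longleftrightarrow> (\<forall>p q r :: int. of_int p + of_int q * x $ 1 + of_int r * x $ 2 = 0 \<longrightarrow>
     p = 0 \<and> q = 0 \<and> r = 0)"

text \<open>Countability: the first coordinate avoids the rationals, the second the rational span of
  1 and the first.\<close>

lemma generic_vector_exists: obtains \<xi> where "generic_vector \<xi>"
proof -
  let ?S = "(\<lambda>(p, q). of_int p / of_int q :: real) ` (UNIV :: (int \<times> int) set)"
  obtain s where s: "s \<notin> ?S"
    using uncountable_UNIV_real
    by (metis UNIV_eq_I countableI_type countable_image)
  let ?T = "(\<lambda>(p, q, r). (of_int p + of_int q * s) / of_int r :: real) ` (UNIV :: (int \<times> int \<times> int) set)"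
  obtain t where t: "t \<notin> ?T"
    using uncountable_UNIV_real
    by (metis UNIV_eq_I countableI_type countable_image)
  have "generic_vector (vector [s, t])"
    unfolding generic_vector_def
  proof (intro allI impI)
    fix p q r :: int
    assume "of_int p + of_int q * (vector [s, t] :: real ^ 2) $ 1 + of_int r * (vector [s, t] :: real ^ 2) $ 2 = 0"
    then have *: "of_int p + of_int q * s + of_int r * t = 0"
      by simp
    have r: "r = 0"
    proof (rule ccontr)
      assume "r \<noteq> 0"
      then have "t = (of_int (- p) + of_int (- q) * s) / of_int r"
        using * by (simp add: field_simps)
      then show False
        using t by (metis (mono_tags, lifting) case_prod_conv rangeI)
    qed
    have q: "q = 0"
    proof (rule ccontr)
      assume "q \<noteq> 0"
      then have "s = of_int (- p) / of_int q"
        using * r by (simp add: field_simps)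
      then show False
        using s by (metis (mono_tags, lifting) case_prod_conv rangeI)
    qed
    show "p = 0 \<and> q = 0 \<and> r = 0"
      using * q r by simp
  qed
  then show ?thesis
    by (rule that)
qed

lemma generic_vector_cong:
  assumes "generic_vector \<xi>" and "int_linear a b c d \<xi> - int_linear a' b' c' d' \<xi> \<in> two_Z2"
  shows "a = a'" "b = b'" "c = c'" "d = d'"
proof -
  obtain k l :: int where
    "of_int a * \<xi> $ 1 + of_int b * \<xi> $ 2 - (of_int a' * \<xi> $ 1 + of_int b' * \<xi> $ 2) = 2 * of_int k"
    "of_int c * \<xi> $ 1 + of_int d * \<xi> $ 2 - (of_int c' * \<xi> $ 1 + of_int d' * \<xi> $ 2) = 2 * of_int l"
    using assms(2) by (auto simp: two_Z2_iff)
  then have "of_int (- 2 * k) + of_int (a - a') * \<xi> $ 1 + of_int (b - b') * \<xi> $ 2 = 0"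
    "of_int (- 2 * l) + of_int (c - c') * \<xi> $ 1 + of_int (d - d') * \<xi> $ 2 = 0"
    by (simp_all add: algebra_simps)
  then show "a = a'" "b = b'" "c = c'" "d = d'"
    using assms(1) unfolding generic_vector_def by (metis eq_iff_diff_eq_0)+
qed

lemma plane_to_complex_eq_iff [simp]: "plane_to_complex x = plane_to_complex y \<longleftrightarrow> x = y"
  by (auto simp: plane_to_complex_def vec2_eq_iff)

section \<open>Symmetries of the Weierstrass function of the square lattice\<close>

lemma plane_to_complex_image_lattice:
  assumes "\<And>x. \<sigma> (plane_to_complex x) = plane_to_complex (int_linear a b c d x)"
    and "\<And>x. int_linear a b c d (int_linear a' b' c' d' x) = x"
  shows "\<sigma> ` plane_to_complex ` two_Z2 = plane_to_complex ` two_Z2"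
proof
  show "\<sigma> ` plane_to_complex ` two_Z2 \<subseteq> plane_to_complex ` two_Z2"
    using assms(1) int_linear_two_Z2 by auto
  show "plane_to_complex ` two_Z2 \<subseteq> \<sigma> ` plane_to_complex ` two_Z2"
  proof clarify
    fix x assume "x \<in> two_Z2"
    then have "int_linear a' b' c' d' x \<in> two_Z2"
      by (rule int_linear_two_Z2)
    moreover have "plane_to_complex x = \<sigma> (plane_to_complex (int_linear a' b' c' d' x))"
      by (simp add: assms)
    ultimately show "plane_to_complex x \<in> \<sigma> ` plane_to_complex ` two_Z2"
      by blast
  qed
qed

lemma wp_minus: "wp (- x) = wp x"
proof -
  let ?\<Lambda> = "plane_to_complex ` two_Z2"
  have *: "- 1 * plane_to_complex x = plane_to_complex (int_linear (- 1) 0 0 (- 1) x)" for x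
    by (simp add: plane_to_complex_def complex_eq_iff)
  have img: "(*) (- 1) ` ?\<Lambda> = ?\<Lambda>"
    by (rule plane_to_complex_image_lattice[OF *, of "- 1" 0 0 "- 1"]) (simp add: vec2_eq_iff)
  have "wp (int_linear (- 1) 0 0 (- 1) x) = map_option ((*) (1 / (- 1)\<^sup>2)) (wp x)"
    unfolding wp_def *[symmetric] by (rule weierstrass_p_mult[OF _ img]) simp
  moreover have "int_linear (- 1) 0 0 (- 1) x = - x"
    by (simp add: vec2_eq_iff)
  moreover have "(*) (1 / (- 1 :: complex)\<^sup>2) = id"
    by (simp add: fun_eq_iff)
  ultimately show ?thesis
    by (metis option.map_id id_apply)
qed

text \<open>Homogeneity for the multiplier i, which permutes the square lattice; the sign is 1 /
  i^2.\<close>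

lemma wp_rotate: "wp (int_linear 0 (- 1) 1 0 x) = map_option uminus (wp x)"
proof -
  let ?\<Lambda> = "plane_to_complex ` two_Z2"
  have *: "\<i> * plane_to_complex x = plane_to_complex (int_linear 0 (- 1) 1 0 x)" for x
    by (simp add: plane_to_complex_def complex_eq_iff)
  have img: "(*) \<i> ` ?\<Lambda> = ?\<Lambda>"
    by (rule plane_to_complex_image_lattice[OF *, of 0 1 "- 1" 0]) (simp add: vec2_eq_iff)
  have "wp (int_linear 0 (- 1) 1 0 x) = map_option ((*) (1 / \<i>\<^sup>2)) (wp x)"
    unfolding wp_def *[symmetric] by (rule weierstrass_p_mult[OF _ img]) simp
  moreover have "(*) (1 / \<i>\<^sup>2) = uminus"
    by (simp add: fun_eq_iff)
  ultimately show ?thesis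
    by (simp only:)
qed

lemma wp_reflect: "wp (int_linear 1 0 0 (- 1) x) = map_option cnj (wp x)"
proof -
  have *: "cnj (plane_to_complex x) = plane_to_complex (int_linear 1 0 0 (- 1) x)" for x
    by (simp add: plane_to_complex_def complex_eq_iff)
  have "cnj ` plane_to_complex ` two_Z2 = plane_to_complex ` two_Z2"
    by (rule plane_to_complex_image_lattice[OF *, of 1 0 0 "- 1"]) (simp add: vec2_eq_iff)
  from weierstrass_p_cnj[OF this, of "plane_to_complex x"] show ?thesis
    unfolding wp_def * by simp
qed

text \<open>The one fibre that the definition shows directly. It forces every group element to fix
  the class of 0, which removes translation parts from the action.\<close>

lemma wp_eq_None_iff: "wp x = None \<longleftrightarrow> x \<in> two_Z2"
  by (auto simp: wp_def weierstrass_p_def)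

lemma generic_vector_not_congruent_rational:
  fixes x :: "real ^ 2"
  assumes "generic_vector \<xi>" and "x $ 1 \<in> \<rat>" "x $ 2 \<in> \<rat>"
  shows "\<xi> - x \<notin> two_Z2"
proof
  assume "\<xi> - x \<in> two_Z2"
  then obtain k :: int where "\<xi> $ 1 = x $ 1 + 2 * of_int k"
    by (auto simp: two_Z2_iff algebra_simps)
  then have "\<xi> $ 1 \<in> \<rat>"
    using assms(2) by simp
  then obtain p q :: int where "q > 0" "\<xi> $ 1 = of_int p / of_int q"
    by (metis Rats_cases')
  then have "of_int (- p) + of_int q * \<xi> $ 1 + of_int 0 * \<xi> $ 2 = 0"
    by (simp add: field_simps)
  then show False
    using assms(1) \<open>q > 0\<close> unfolding generic_vector_def by (metis less_irrefl)
qed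

text \<open>A translation part in the lattice disappears on the torus, so only the linear part acts,
  and it is integral because it preserves the lattice.\<close>

lemma torus_endomorphism_int_linear:
  assumes "torus_endomorphism_lift two_Z2 \<A> g" and "\<A> 0 \<in> two_Z2"
  obtains a b c d where "a * d - b * c > 0"
    "\<And>x. g (torus_proj two_Z2 x) = torus_proj two_Z2 (int_linear a b c d x)"
proof -
  have lin: "linear (linear_part \<A>)" "det (matrix (linear_part \<A>)) > 0"
    and L: "\<And>x y. x - y \<in> two_Z2 \<Longrightarrow> \<A> x - \<A> y \<in> two_Z2"
    and g: "\<And>x. g (torus_proj two_Z2 x) = torus_proj two_Z2 (\<A> x)"
    using assms(1) by (auto simp: torus_endomorphism_lift_def orientation_preserving_affine_def)
  have "linear_part \<A> x \<in> two_Z2" if "x \<in> two_Z2" for x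
    using L[of x 0] that by (simp add: linear_part_def)
  then obtain a b c d where *: "linear_part \<A> = int_linear a b c d"
      "det (matrix (linear_part \<A>)) = of_int (a * d - b * c)"
    by (rule linear_two_Z2_imp_int_linear[OF lin(1)])
  have "\<A> x - int_linear a b c d x \<in> two_Z2" for x
    using assms(2) by (simp flip: *(1) add: linear_part_def)
  then have "g (torus_proj two_Z2 x) = torus_proj two_Z2 (int_linear a b c d x)" for x
    by (simp add: g torus_proj_eq_iff)
  then show ?thesis
    using lin(2) that unfolding *(2) of_int_0_less_iff by blast
qed

text \<open>The equations say in entries that the matrix commutes with its conjugates by the quarter
  turn (\<open>rot\<close>) and by the reflection (\<open>refl\<close>). If b is nonzero, then a = d
  and c is b or -b. Determinant 1 then reads (a - b)(a + b) = 1, which forces b = 0, or a^2 + b^2 =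
  1, which leaves the quarter turns.\<close>

lemma commuting_conjugates_cases:
  fixes a b c d :: int
  assumes det: "a * d - b * c = 1"
    and rot: "b * b = c * c" "(a - d) * (b - c) = 0"
    and refl: "(a - d) * b = 0" "(a - d) * c = 0"
  shows "(b = 0 \<and> c = 0 \<and> (a = 1 \<and> d = 1 \<or> a = -1 \<and> d = -1)) \<or>
    (a = 0 \<and> d = 0 \<and> (b = 1 \<and> c = -1 \<or> b = -1 \<and> c = 1))"
proof (cases "b = 0")
  case True
  then have "c = 0"
    using rot by simp
  then show ?thesis
    using True det by (simp add: zmult_eq_1_iff)
next
  case False
  then have "a = d"
    using refl by simp
  consider "c = b" | "c = - b"
    using rot(1) square_eq_iff[of b c] by fastforce
  then show ?thesis
  proof cases
    case 1
    then have "(a - b) * (a + b) = 1"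
      using det \<open>a = d\<close> by (simp add: algebra_simps)
    then show ?thesis
      using False by (auto simp: zmult_eq_1_iff)
  next
    case 2
    then have *: "a * a + b * b = 1"
      using det \<open>a = d\<close> by simp
    moreover have "b * b \<ge> 1"
      using False by (auto simp: int_one_le_iff_zero_less zero_less_mult_iff)
    moreover have "a * a \<ge> 0"
      by simp
    ultimately have "a * a = 0" "b * b = 1"
      by linarith+
    then show ?thesis
      using 2 \<open>a = d\<close> by (auto simp: zmult_eq_1_iff)
  qed
qed

text \<open>
  Each group element acts by an integer matrix of determinant 1. The quarter turn and the reflection
  in the first axis permute the fibres of the Weierstrass function, so they normalise the group of these
  matrices; as this group is abelian, it only contains \<open>\<plusminus>1\<close> and possibly the quarter turns, and the
  latter change the sign of the Weierstrass function.
\<close>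

proposition wp_eq_iff:
  assumes h: "inj h" and \<Theta>: "\<Theta> \<circ> torus_proj two_Z2 = h \<circ> wp"
    and act: "induced_by_rigid_cyclic_action two_Z2 \<Theta>"
  shows "wp x = wp y \<longleftrightarrow> x - y \<in> two_Z2 \<or> x + y \<in> two_Z2"
proof -
  let ?p = "torus_proj two_Z2"
  obtain G :: "int monoid" and \<alpha> where G: "cyclic_group G" "group_action G (range ?p) \<alpha>"
    and aut: "\<forall>g\<in>carrier G. torus_automorphism two_Z2 (\<alpha> g)"
    and fib: "\<forall>t\<in>range ?p. \<forall>t'\<in>range ?p. \<Theta> t = \<Theta> t' \<longleftrightarrow> (\<exists>g\<in>carrier G. t = \<alpha> g t')"
    using act unfolding induced_by_rigid_cyclic_action_def topspace_torus
    by (elim exE conjE) (rule that)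
  interpret group_action G "range ?p" \<alpha>
    by (rule G(2))
  interpret G: comm_group G
    using G(1) group_hom group_hom.axioms(1) group.cyclic_imp_abelian_group by blast
  have wp_fib: "wp x = wp y \<longleftrightarrow> (\<exists>g\<in>carrier G. ?p x = \<alpha> g (?p y))" for x y
  proof -
    have "\<Theta> (?p x) = h (wp x)" for x
      using \<Theta> by (metis comp_apply)
    then show ?thesis
      using fib h by (simp add: inj_eq)
  qed
  define H where "H a b c d \<longleftrightarrow> (\<exists>g\<in>carrier G. \<forall>x. \<alpha> g (?p x) = ?p (int_linear a b c d x))" for a b c d
  have lift: "\<exists>a b c d. a * d - b * c > 0 \<and> (\<forall>x. \<alpha> g (?p x) = ?p (int_linear a b c d x))"
    if g: "g \<in> carrier G" for g
  proof -
    obtain \<A> where \<A>: "torus_endomorphism_lift two_Z2 \<A> (\<alpha> g)"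
      using aut g by (auto simp: torus_automorphism_def)
    then have "?p (\<A> 0) = \<alpha> g (?p 0)"
      by (simp add: torus_endomorphism_lift_def)
    then have "wp (\<A> 0) = wp 0"
      using wp_fib g by blast
    then have "\<A> 0 \<in> two_Z2"
      using two_Z2_0 by (metis wp_eq_None_iff)
    then show ?thesis
      using torus_endomorphism_int_linear[OF \<A>] by metis
  qed
  obtain \<xi> where \<xi>: "generic_vector \<xi>"
    by (rule generic_vector_exists)
  have cong: "a = a' \<and> b = b' \<and> c = c' \<and> d = d'"
    if "?p (int_linear a b c d \<xi>) = ?p (int_linear a' b' c' d' \<xi>)" for a b c d a' b' c' d'
    using generic_vector_cong[OF \<xi>] that torus_proj_eq_iff by metis
  have H_wp: "wp (int_linear a b c d x) = wp x" if H: "H a b c d" for a b c d x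
  proof -
    obtain g where "g \<in> carrier G" "?p (int_linear a b c d x) = \<alpha> g (?p x)"
      using H unfolding H_def by metis
    then show ?thesis
      unfolding wp_fib by blast
  qed
  \<comment> \<open>One generic point is enough: the group element that identifies the two points
    there acts by an integer matrix, and genericity makes this the given matrix.\<close>
  have H_I: "H a b c d" if wp: "wp (int_linear a b c d \<xi>) = wp \<xi>" for a b c d
  proof -
    obtain g where g: "g \<in> carrier G" "?p (int_linear a b c d \<xi>) = \<alpha> g (?p \<xi>)"
      using wp unfolding wp_fib by blast
    obtain a' b' c' d' where *: "\<And>x. \<alpha> g (?p x) = ?p (int_linear a' b' c' d' x)"
      using lift[OF g(1)] by blast
    have "a = a' \<and> b = b' \<and> c = c' \<and> d = d'"
      using g(2) unfolding * by (rule cong)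
    then show ?thesis
      unfolding H_def using g(1) * by blast
  qed
  \<comment> \<open>The inverse group element is also an integer matrix of positive determinant, and
    the two determinants multiply to 1.\<close>
  have H_det: "a * d - b * c = 1" if H: "H a b c d" for a b c d
  proof -
    obtain g where g: "g \<in> carrier G" "\<And>x. \<alpha> g (?p x) = ?p (int_linear a b c d x)"
      using H by (auto simp: H_def)
    obtain a' b' c' d' where g': "a' * d' - b' * c' > 0"
        "\<And>x. \<alpha> (inv\<^bsub>G\<^esub> g) (?p x) = ?p (int_linear a' b' c' d' x)"
      using lift[of "inv\<^bsub>G\<^esub> g"] g(1) by auto
    obtain a'' b'' c'' d'' where g'': "a'' * d'' - b'' * c'' > 0" "\<And>x. \<alpha> g (?p x) = ?p (int_linear a'' b'' c'' d'' x)"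
      using lift[OF g(1)] by blast
    have eq: "a'' = a \<and> b'' = b \<and> c'' = c \<and> d'' = d"
      by (rule cong) (simp flip: g(2) g''(2))
    have "\<alpha> g (\<alpha> (inv\<^bsub>G\<^esub> g) (?p \<xi>)) = \<alpha> \<one>\<^bsub>G\<^esub> (?p \<xi>)"
      using g(1) composition_rule[of "?p \<xi>" g "inv\<^bsub>G\<^esub> g"] by simp
    then have "\<alpha> g (\<alpha> (inv\<^bsub>G\<^esub> g) (?p \<xi>)) = ?p \<xi>"
      by (simp flip: id_eq_one)
    then have "?p (int_linear (a * a' + b * c') (a * b' + b * d') (c * a' + d * c') (c * b' + d * d') \<xi>)
        = ?p (int_linear 1 0 0 1 \<xi>)"
      unfolding g g' int_linear_compose int_linear_id .
    then have e: "a * a' + b * c' = 1" "a * b' + b * d' = 0" "c * a' + d * c' = 0" "c * b' + d * d' = 1"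
      by (blast dest: cong)+
    have "(a * d - b * c) * (a' * d' - b' * c') =
        (a * a' + b * c') * (c * b' + d * d') - (a * b' + b * d') * (c * a' + d * c')"
      by (simp add: algebra_simps)
    then have "(a * d - b * c) * (a' * d' - b' * c') = 1"
      by (simp add: e)
    then show ?thesis
      using g'(1) g''(1) eq by (auto simp: zmult_eq_1_iff)
  qed
  have H_comm: "a * a' + b * c' = a' * a + b' * c" "a * b' + b * d' = a' * b + b' * d"
    "c * a' + d * c' = c' * a + d' * c" "c * b' + d * d' = c' * b + d' * d"
    if H: "H a b c d" "H a' b' c' d'" for a b c d a' b' c' d'
  proof -
    obtain g where g: "g \<in> carrier G" "\<And>x. \<alpha> g (?p x) = ?p (int_linear a b c d x)"
      using H by (auto simp: H_def)
    obtain g' where g': "g' \<in> carrier G" "\<And>x. \<alpha> g' (?p x) = ?p (int_linear a' b' c' d' x)"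
      using H by (auto simp: H_def)
    have "\<alpha> g (\<alpha> g' (?p \<xi>)) = \<alpha> g' (\<alpha> g (?p \<xi>))"
      using composition_rule[of "?p \<xi>" g g'] composition_rule[of "?p \<xi>" g' g] g(1) g'(1)
      by (simp add: G.m_comm)
    then have "?p (int_linear (a * a' + b * c') (a * b' + b * d') (c * a' + d * c') (c * b' + d * d') \<xi>)
        = ?p (int_linear (a' * a + b' * c) (a' * b + b' * d) (c' * a + d' * c) (c' * b + d' * d) \<xi>)"
      unfolding g g' int_linear_compose .
    then show "a * a' + b * c' = a' * a + b' * c" "a * b' + b * d' = a' * b + b' * d"
      "c * a' + d * c' = c' * a + d' * c" "c * b' + d * d' = c' * b + d' * d"
      by (blast dest: cong)+
  qed
  \<comment> \<open>These are the entries of the conjugate by the quarter turn. Since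
    \<open>wp\<close> after the quarter turn is a function of \<open>wp\<close>, the conjugate
    preserves \<open>wp\<close> as well.\<close>
  have H_rotate: "H d (- c) (- b) a" if "H a b c d" for a b c d
  proof (rule H_I)
    let ?J = "int_linear 0 (- 1) 1 0"
    have "wp (int_linear d (- c) (- b) a (?J x)) = wp (?J x)" for x
    proof -
      have "int_linear d (- c) (- b) a (?J x) = ?J (int_linear a b c d x)"
        by (simp add: vec2_eq_iff)
      then show ?thesis
        by (simp only: wp_rotate H_wp[OF that])
    qed
    \<comment> \<open>The argument is the inverse quarter turn of \<xi>, so that \<open>?J\<close>
      leads back to \<xi>.\<close>
    from this[of "int_linear 0 1 (- 1) 0 \<xi>"]
    show "wp (int_linear d (- c) (- b) a \<xi>) = wp \<xi>"
      by (simp add: int_linear_compose int_linear_id)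
  qed
  have H_reflect: "H a (- b) (- c) d" if "H a b c d" for a b c d
  proof (rule H_I)
    let ?K = "int_linear 1 0 0 (- 1)"
    have "wp (int_linear a (- b) (- c) d (?K x)) = wp (?K x)" for x
    proof -
      have "int_linear a (- b) (- c) d (?K x) = ?K (int_linear a b c d x)"
        by (simp add: vec2_eq_iff)
      then show ?thesis
        by (simp only: wp_reflect H_wp[OF that])
    qed
    from this[of "?K \<xi>"]
    show "wp (int_linear a (- b) (- c) d \<xi>) = wp \<xi>"
      by (simp add: int_linear_compose int_linear_id)
  qed
  \<comment> \<open>Otherwise \<open>wp\<close> equals its negative and takes only the values 0 and
    infinity. A generic point and the rational point (1/2, 0) then both have value 0, so a group
    element relates them; but integer matrices keep rational points rational.\<close>
  have no_quarter: "\<not> H 0 b c 0" if "b = 1 \<and> c = -1 \<or> b = -1 \<and> c = 1" for b c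
  proof
    assume H: "H 0 b c 0"
    have "wp (int_linear 0 (- 1) 1 0 x) = wp x" for x
    proof -
      have "int_linear 0 (- 1) 1 0 x = int_linear 0 b c 0 x \<or> int_linear 0 (- 1) 1 0 x = - int_linear 0 b c 0 x"
        using that by (auto simp: vec2_eq_iff)
      then show ?thesis
        using H_wp[OF H, of x] wp_minus[of "int_linear 0 b c 0 x"] by auto
    qed
    then have odd: "wp x = map_option uminus (wp x)" for x
      by (simp add: wp_rotate)
    then have zero: "wp x = None \<or> wp x = Some 0" for x
      using odd[of x] by (cases "wp x") (auto simp: equal_neg_zero)
    let ?x = "vector [1 / 2, 0] :: real ^ 2"
    have rat: "int_linear a b c d ?x $ i \<in> \<rat>" for a b c d i
      using exhaust_2[of i] by auto
    have "wp \<xi> \<noteq> None"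
      using generic_vector_not_congruent_rational[OF \<xi>, of 0] by (simp add: wp_eq_None_iff)
    moreover have "wp ?x \<noteq> None"
    proof
      assume "wp ?x = None"
      then obtain k :: int where "1 / 2 = 2 * real_of_int k" by (auto simp: wp_eq_None_iff two_Z2_iff)
      then have "real_of_int (4 * k) = of_int 1" by simp
      then have "4 * k = 1" by (simp only: of_int_eq_iff)
      then show False by presburger
    qed
    ultimately have "wp \<xi> = wp ?x"
      using zero by metis
    then obtain g where "g \<in> carrier G" "?p \<xi> = \<alpha> g (?p ?x)"
      unfolding wp_fib by blast
    then obtain a b c d where "?p \<xi> = ?p (int_linear a b c d ?x)"
      using lift by metis
    then show False
      using generic_vector_not_congruent_rational[OF \<xi> rat rat] by (simp add: torus_proj_eq_iff)
  qed
  have H_cases: "b = 0 \<and> c = 0 \<and> (a = 1 \<and> d = 1 \<or> a = -1 \<and> d = -1)" if H: "H a b c d" for a b c d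
  proof -
    have "(b = 0 \<and> c = 0 \<and> (a = 1 \<and> d = 1 \<or> a = -1 \<and> d = -1)) \<or>
      (a = 0 \<and> d = 0 \<and> (b = 1 \<and> c = -1 \<or> b = -1 \<and> c = 1))"
    proof (rule commuting_conjugates_cases[OF H_det[OF H]])
      show "b * b = c * c" "(a - d) * (b - c) = 0"
        using H_comm[OF H H_rotate[OF H]] by (simp_all add: algebra_simps)
      show "(a - d) * b = 0" "(a - d) * c = 0"
        using H_comm[OF H H_reflect[OF H]] by (auto simp: algebra_simps)
    qed
    then show ?thesis
      using no_quarter H by metis
  qed
  show ?thesis
  proof
    assume "wp x = wp y"
    then obtain g where g: "g \<in> carrier G" "?p x = \<alpha> g (?p y)"
      unfolding wp_fib by blast
    obtain a b c d where *: "\<And>x. \<alpha> g (?p x) = ?p (int_linear a b c d x)"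
      using lift[OF g(1)] by blast
    then have "H a b c d"
      using g(1) H_def by blast
    from H_cases[OF this] have "int_linear a b c d y = y \<or> int_linear a b c d y = - y"
      by (auto simp: vec2_eq_iff)
    then show "x - y \<in> two_Z2 \<or> x + y \<in> two_Z2"
      using g(2) unfolding * torus_proj_eq_iff by auto
  next
    \<comment> \<open>Periodicity is inherited from \<Theta>, which is defined on the torus, through
      the injective \<open>h\<close>.\<close>
    have per: "wp x = wp y" if "x - y \<in> two_Z2" for x y
    proof -
      have "?p x = ?p y" using that by (simp add: torus_proj_eq_iff)
      then have "h (wp x) = h (wp y)" using \<Theta> by (metis comp_apply)
      then show ?thesis using h by (simp add: inj_eq)
    qed
    assume "x - y \<in> two_Z2 \<or> x + y \<in> two_Z2"
    then show "wp x = wp y"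
      using per[of x y] per[of x "- y"] by (auto simp: wp_minus)
  qed
qed

section \<open>Local orientation of planar embeddings\<close>

text \<open>In the coordinate u with w = z + exp u the punctured disc becomes the half-plane
  \<open>S\<close>. By injectivity the difference of \<phi> from its value at z has no zero there,
  hence has a continuous logarithm \<open>g\<close>. The increment of \<open>g\<close> over the
  period 2 pi i is a multiple of 2 pi i by an integer n that does not depend on u; this n is the
  degree.\<close>

lemma punctured_disc_degree:
  assumes r: "r > 0" and cont: "continuous_on (ball z r) \<phi>" and inj: "inj_on \<phi> (ball z r)"
  obtains n :: int where
    "\<forall>l k. path l \<and> (\<forall>t\<in>{0..1}. Re (l t) < ln r) \<and>
       pathfinish l - pathstart l = 2 * of_real pi * \<i> * of_int k \<longrightarrow>
       winding_number (\<phi> \<circ> (\<lambda>t. z + exp (l t))) (\<phi> z) = of_int (n * k)"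
proof -
  define S where "S = {u. Re u < ln r}"
  have "convex S"
    by (simp add: S_def convex_halfspace_Re_lt)
  have exp_ball: "z + exp u \<in> ball z r" if "u \<in> S" for u
  proof -
    have "norm (exp u) < r"
      using that r by (simp add: S_def) (metis exp_less_cancel_iff exp_ln)
    then show ?thesis
      by (simp add: dist_norm)
  qed
  have F: "continuous_on S (\<lambda>u. \<phi> (z + exp u) - \<phi> z)"
    by (intro continuous_intros continuous_on_compose2[OF cont]) (use exp_ball in auto)
  have F_nz: "\<phi> (z + exp u) - \<phi> z \<noteq> 0" if "u \<in> S" for u
    using inj_onD[OF inj _ exp_ball[OF that], of z] r by auto
  obtain g where g: "continuous_on S g" "\<And>u. u \<in> S \<Longrightarrow> \<phi> (z + exp u) - \<phi> z = exp (g u)"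
    using continuous_logarithm_on_contractible[OF F convex_imp_contractible[OF \<open>convex S\<close>] F_nz] by blast
  define p where "p = 2 * of_real pi * \<i>"
  have S_p: "u + of_int k * p \<in> S \<longleftrightarrow> u \<in> S" for u and k :: int
    by (simp add: S_def p_def)
  have exp_p: "exp (u + of_int k * p) = exp u" for u and k :: int
    by (simp add: exp_eq p_def)
  have diff: "\<exists>m :: int. g (u + p) - g u = of_int m * p" if "u \<in> S" for u
  proof -
    have "u + p \<in> S" "exp (u + p) = exp u"
      using S_p[of u 1] exp_p[of u 1] that by auto
    then have "exp (g (u + p)) = exp (g u)"
      using g(2) that by metis
    then obtain m :: int where "g (u + p) = g u + of_int (2 * m) * (of_real pi * \<i>)"
      unfolding exp_eq by auto
    then show ?thesis
      by (intro exI[of _ m]) (simp add: p_def)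
  qed
  have "(\<lambda>u. g (u + p) - g u) constant_on S"
  proof (rule continuous_discrete_range_constant)
    show "connected S"
      using \<open>convex S\<close> by (rule convex_connected)
    have "continuous_on S (\<lambda>u. g (u + p))"
      by (intro continuous_on_compose2[OF g(1)] continuous_intros) (use S_p[of _ 1] in auto)
    then show "continuous_on S (\<lambda>u. g (u + p) - g u)"
      using g(1) by (intro continuous_intros)
    fix u assume "u \<in> S"
    \<comment> \<open>Distinct integer multiples of 2 pi i are at least 2 pi apart, so the increment
      has discrete range on a connected set.\<close>
    have "2 * pi \<le> norm ((g (v + p) - g v) - (g (u + p) - g u))"
      if "v \<in> S" "g (v + p) - g v \<noteq> g (u + p) - g u" for v
    proof -
      obtain m m' :: int where m: "g (u + p) - g u = of_int m * p" "g (v + p) - g v = of_int m' * p"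
        using diff \<open>u \<in> S\<close> \<open>v \<in> S\<close> by metis
      then have eq: "(g (v + p) - g v) - (g (u + p) - g u) = of_int (m' - m) * p"
        by (simp add: left_diff_distrib)
      have "m \<noteq> m'"
        using m that(2) by auto
      then have "1 \<le> real_of_int \<bar>m' - m\<bar>"
        by linarith
      then have "1 * (2 * pi) \<le> real_of_int \<bar>m' - m\<bar> * (2 * pi)"
        by (intro mult_right_mono) auto
      then show ?thesis
        unfolding eq norm_mult norm_of_int by (simp add: p_def norm_mult)
    qed
    then show "\<exists>e>0. \<forall>v. v \<in> S \<and> g (v + p) - g v \<noteq> g (u + p) - g u \<longrightarrow>
        e \<le> norm ((g (v + p) - g v) - (g (u + p) - g u))"
      by (intro exI[of _ "2 * pi"]) auto
  qed
  then obtain c where c: "\<And>u. u \<in> S \<Longrightarrow> g (u + p) - g u = c"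
    by (auto simp: constant_on_def)
  have "of_real (ln r - 1) \<in> S"
    by (simp add: S_def)
  then obtain n :: int where n: "c = of_int n * p"
    using c diff by metis
  have shift_nat: "g (u + of_nat k * p) = g u + of_nat k * of_int n * p" if "u \<in> S" for u k
  proof (induction k)
    case (Suc k)
    have "u + of_nat k * p \<in> S"
      using S_p[of u "int k"] that by simp
    from c[OF this] show ?case
      using Suc by (simp add: n algebra_simps)
  qed auto
  have shift: "g (u + of_int k * p) = g u + of_int k * of_int n * p" if "u \<in> S" for u k
  proof (cases "k \<ge> 0")
    case True
    then show ?thesis
      using shift_nat[OF that, of "nat k"] by simp
  next
    case False
    have "u + of_int k * p \<in> S"
      using that by (simp add: S_p)
    \<comment> \<open>For negative k, the forward shift by -k steps starts at the point already
      shifted back.\<close>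
    from shift_nat[OF this, of "nat (- k)"] show ?thesis
      using False by (simp add: algebra_simps)
  qed
  have "winding_number (\<phi> \<circ> (\<lambda>t. z + exp (l t))) (\<phi> z) = of_int (n * k)"
    if l: "path l" "\<forall>t\<in>{0..1}. Re (l t) < ln r"
      "pathfinish l - pathstart l = 2 * of_real pi * \<i> * of_int k" for l k
  proof -
    have lS: "l t \<in> S" if "t \<in> {0..1}" for t
      using l(2) that by (simp add: S_def)
    have "path (g \<circ> l)"
      by (intro path_continuous_image l(1) continuous_on_subset[OF g(1)]) (use lS in \<open>auto simp: path_image_def\<close>)
    have "l 1 = l 0 + of_int k * p"
      using l(3) by (simp add: pathfinish_def pathstart_def p_def algebra_simps)
    then have gl: "g (l 1) - g (l 0) = of_int (n * k) * p"
      using shift[OF lS[of 0], of k] by simp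
    have "winding_number (\<phi> \<circ> (\<lambda>t. z + exp (l t))) (\<phi> z)
        = winding_number (\<lambda>t. (\<phi> \<circ> (\<lambda>t. z + exp (l t))) t - \<phi> z) 0"
      by (rule winding_number_offset)
    also have "\<dots> = winding_number (exp \<circ> (g \<circ> l)) 0"
      by (rule winding_number_cong) (use g(2) lS in auto)
    also have "\<dots> = (pathfinish (g \<circ> l) - pathstart (g \<circ> l)) / (2 * of_real pi * \<i>)"
      using \<open>path (g \<circ> l)\<close> by (rule winding_number_compose_exp)
    also have "\<dots> = of_int (n * k)"
      using gl by (simp add: pathfinish_def pathstart_def p_def)
    finally show ?thesis .
  qed
  then show ?thesis
    using that by blast
qed

lemma circlepath_eq_exp:
  assumes "r > 0"
  shows "circlepath z r = (\<lambda>t. z + exp (of_real (ln r) + 2 * of_real pi * \<i> * of_real t))"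
  using assms by (auto simp: circlepath exp_add exp_of_real fun_eq_iff)

definition local_embedding_at :: "(complex \<Rightarrow> complex) \<Rightarrow> complex \<Rightarrow> bool" where
  "local_embedding_at \<phi> z \<longleftrightarrow> (\<exists>R>0. continuous_on (ball z R) \<phi> \<and> inj_on \<phi> (ball z R))"

text \<open>The germ of \<open>orientation_preserving_on\<close> at a point: only small circles are
  tested, so it depends on \<phi> near z alone and can be carried through charts.\<close>

definition oriented_at :: "(complex \<Rightarrow> complex) \<Rightarrow> complex \<Rightarrow> bool" where
  "oriented_at \<phi> z \<longleftrightarrow> (\<exists>R>0. \<forall>r. 0 < r \<and> r < R \<longrightarrow> winding_number (\<phi> \<circ> circlepath z r) (\<phi> z) = 1)"

lemma punctured_disc_degree_circlepath:
  assumes r: "r > 0" and cont: "continuous_on (ball z r) \<phi>" and inj: "inj_on \<phi> (ball z r)"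
  obtains n :: int where
    "\<forall>s. 0 < s \<and> s < r \<longrightarrow> winding_number (\<phi> \<circ> circlepath z s) (\<phi> z) = of_int n"
    "\<forall>l k. path l \<and> (\<forall>t\<in>{0..1}. Re (l t) < ln r) \<and>
       pathfinish l - pathstart l = 2 * of_real pi * \<i> * of_int k \<longrightarrow>
       winding_number (\<phi> \<circ> (\<lambda>t. z + exp (l t))) (\<phi> z) = of_int (n * k)"
proof -
  obtain n :: int where n: "\<forall>l k. path l \<and> (\<forall>t\<in>{0..1}. Re (l t) < ln r) \<and>
       pathfinish l - pathstart l = 2 * of_real pi * \<i> * of_int k \<longrightarrow>
       winding_number (\<phi> \<circ> (\<lambda>t. z + exp (l t))) (\<phi> z) = of_int (n * k)"
    by (rule punctured_disc_degree[OF assms])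
  have "winding_number (\<phi> \<circ> circlepath z s) (\<phi> z) = of_int (n * 1)" if "0 < s" "s < r" for s
  proof -
    have "path (\<lambda>t. of_real (ln s) + 2 * of_real pi * \<i> * of_real t)"
      unfolding path_def by (intro continuous_intros)
    then show ?thesis
      unfolding circlepath_eq_exp[OF that(1)] using that
      by (intro n[rule_format]) (auto simp: pathfinish_def pathstart_def)
  qed
  then have c: "winding_number (\<phi> \<circ> circlepath z s) (\<phi> z) = of_int n" if "0 < s" "s < r" for s
    using that by simp
  have "\<forall>s. 0 < s \<and> s < r \<longrightarrow> winding_number (\<phi> \<circ> circlepath z s) (\<phi> z) = of_int n"
    by (intro allI impI c) auto
  then show ?thesis
    using n by (rule that)
qed

text \<open>One small circle identifies the degree of the punctured disc as 1, and the degree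
  governs all circles and all loops with a logarithm.\<close>

lemma oriented_at_imp_all_circles:
  assumes "oriented_at \<phi> z" and "r > 0" "continuous_on (ball z r) \<phi>" "inj_on \<phi> (ball z r)"
  obtains "\<forall>s. 0 < s \<and> s < r \<longrightarrow> winding_number (\<phi> \<circ> circlepath z s) (\<phi> z) = 1"
    "\<forall>l k. path l \<and> (\<forall>t\<in>{0..1}. Re (l t) < ln r) \<and>
       pathfinish l - pathstart l = 2 * of_real pi * \<i> * of_int k \<longrightarrow>
       winding_number (\<phi> \<circ> (\<lambda>t. z + exp (l t))) (\<phi> z) = of_int k"
proof -
  obtain n :: int where n:
    "\<forall>s. 0 < s \<and> s < r \<longrightarrow> winding_number (\<phi> \<circ> circlepath z s) (\<phi> z) = of_int n"
    "\<forall>l k. path l \<and> (\<forall>t\<in>{0..1}. Re (l t) < ln r) \<and>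
       pathfinish l - pathstart l = 2 * of_real pi * \<i> * of_int k \<longrightarrow>
       winding_number (\<phi> \<circ> (\<lambda>t. z + exp (l t))) (\<phi> z) = of_int (n * k)"
    by (rule punctured_disc_degree_circlepath[OF assms(2-4)])
  obtain R where R: "R > 0" "\<And>s. 0 < s \<Longrightarrow> s < R \<Longrightarrow> winding_number (\<phi> \<circ> circlepath z s) (\<phi> z) = 1"
    using assms(1) by (auto simp: oriented_at_def)
  have "of_int n = (1 :: complex)"
    using n(1)[rule_format, of "min r R / 2"] R(2)[of "min r R / 2"] R(1) assms(2) by simp
  then have "n = 1"
    by (simp only: of_int_eq_1_iff)
  show ?thesis
    using n unfolding \<open>n = 1\<close> mult_1 of_int_1 by (rule that)
qed

lemma oriented_at_cong:
  assumes "oriented_at \<phi> z" and "open U" "z \<in> U" and eq: "\<And>u. u \<in> U \<Longrightarrow> \<phi> u = \<psi> u"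
  shows "oriented_at \<psi> z"
proof -
  obtain R where R: "R > 0" "\<And>s. 0 < s \<Longrightarrow> s < R \<Longrightarrow> winding_number (\<phi> \<circ> circlepath z s) (\<phi> z) = 1"
    using assms(1) by (auto simp: oriented_at_def)
  obtain e where e: "e > 0" "cball z e \<subseteq> U"
    using assms by (meson open_contains_cball)
  have "winding_number (\<psi> \<circ> circlepath z s) (\<psi> z) = 1" if s: "0 < s" "s < min R e" for s
  proof -
    have "circlepath z s t \<in> U" if "t \<in> {0..1}" for t
    proof -
      have "circlepath z s t \<in> path_image (circlepath z s)"
        using that by (auto simp: path_image_def)
      then show ?thesis
        using s e by (auto simp: path_image_circlepath_nonneg)
    qed
    then have "winding_number (\<psi> \<circ> circlepath z s) (\<psi> z) = winding_number (\<phi> \<circ> circlepath z s) (\<psi> z)"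
      by (intro winding_number_cong) (auto simp: eq)
    then show ?thesis
      using R s eq[OF assms(3)] by simp
  qed
  then show ?thesis
    unfolding oriented_at_def using R(1) e(1) by (intro exI[of _ "min R e"]) auto
qed

text \<open>For the converse direction, compactness of a closed disc in W provides a slightly larger
  open ball in W, on which a single degree belongs to all circles around the centre.\<close>

lemma orientation_preserving_on_iff:
  assumes W: "open W" and cont: "continuous_on W \<phi>" and inj: "inj_on \<phi> W"
  shows "orientation_preserving_on W \<phi> \<longleftrightarrow> (\<forall>z\<in>W. oriented_at \<phi> z)"
proof
  assume *: "orientation_preserving_on W \<phi>"
  show "\<forall>z\<in>W. oriented_at \<phi> z"
  proof
    fix z assume "z \<in> W"
    then obtain R where R: "R > 0" "cball z R \<subseteq> W"
      using W by (meson open_contains_cball)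
    then have "cball z r \<subseteq> W" if "r < R" for r
      using that by (meson order.trans less_imp_le subset_cball)
    then show "oriented_at \<phi> z"
      using * R(1) unfolding oriented_at_def orientation_preserving_on_def by auto
  qed
next
  assume *: "\<forall>z\<in>W. oriented_at \<phi> z"
  show "orientation_preserving_on W \<phi>"
    unfolding orientation_preserving_on_def
  proof (intro allI impI)
    fix z r assume r: "0 < r \<and> cball z r \<subseteq> W"
    then obtain e where e: "e > 0" "(\<Union>x\<in>cball z r. ball x e) \<subseteq> W"
      using compact_subset_open_imp_ball_epsilon_subset[OF compact_cball W] by metis
    have "ball z (r + e) \<subseteq> W"
    proof
      fix x assume x: "x \<in> ball z (r + e)"
      show "x \<in> W"
      proof (cases "dist z x \<le> r")
        case True
        then show ?thesis
          using r by auto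
      next
        case False
        \<comment> \<open>The radial projection of x to the circle of radius r, which is closer to x
          than e.\<close>
        define y where "y = z + (r / dist z x) *\<^sub>R (x - z)"
        have pos: "dist z x > 0"
          using False r by linarith
        have "dist z y = r"
          using pos r by (simp add: y_def dist_norm norm_minus_commute)
        moreover have "dist y x < e"
        proof -
          have "y - x = (r / dist z x - 1) *\<^sub>R (x - z)"
            by (simp add: y_def algebra_simps)
          then have "dist y x = \<bar>r / dist z x - 1\<bar> * dist z x"
            by (simp add: dist_norm norm_minus_commute)
          also have "\<dots> = dist z x - r"
            using False pos by (simp add: abs_if field_simps)
          also have "\<dots> < e"
            using x by simp
          finally show ?thesis .
        qed
        ultimately show ?thesis
          using e(2) by (metis UN_I mem_ball mem_cball order_refl subset_iff)
      qed
    qed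
    then have "continuous_on (ball z (r + e)) \<phi>" "inj_on \<phi> (ball z (r + e))"
      using cont inj by (meson continuous_on_subset inj_on_subset)+
    moreover have "z \<in> W"
      using r by auto
    then have "oriented_at \<phi> z"
      using * by blast
    ultimately show "winding_number (\<phi> \<circ> circlepath z r) (\<phi> z) = 1"
      using r e(1) by (elim oriented_at_imp_all_circles[of \<phi> z "r + e"]) auto
  qed
qed

text \<open>The image under \<iota> of a small circle around \<open>\<beta> z\<close> is a loop
  around z, with some winding number k. Its image under \<beta> is the circle again, so k = 1; its
  image under \<alpha> therefore also winds once. This stands in for the chain rule of
  orientations.\<close>

lemma oriented_at_comp_inverse:
  assumes \<alpha>: "oriented_at \<alpha> z" "local_embedding_at \<alpha> z"
    and \<beta>: "oriented_at \<beta> z" "local_embedding_at \<beta> z"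
    and V: "open V" "\<beta> z \<in> V" and \<iota>: "continuous_on V \<iota>" "inj_on \<iota> V" "\<iota> (\<beta> z) = z"
    and inv: "\<And>u. u \<in> V \<Longrightarrow> \<beta> (\<iota> u) = u"
  shows "oriented_at (\<alpha> \<circ> \<iota>) (\<beta> z)"
proof -
  obtain R1 R2 where "R1 > 0" "continuous_on (ball z R1) \<alpha>" "inj_on \<alpha> (ball z R1)"
    "R2 > 0" "continuous_on (ball z R2) \<beta>" "inj_on \<beta> (ball z R2)"
    using \<alpha>(2) \<beta>(2) by (auto simp: local_embedding_at_def)
  moreover define R where "R = min R1 R2"
  moreover have "ball z R \<subseteq> ball z R1" "ball z R \<subseteq> ball z R2"
    by (auto simp: R_def)
  ultimately have R: "R > 0" "continuous_on (ball z R) \<alpha>" "inj_on \<alpha> (ball z R)"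
    "continuous_on (ball z R) \<beta>" "inj_on \<beta> (ball z R)"
    by (auto intro: continuous_on_subset inj_on_subset)
  have "open (V \<inter> \<iota> -` ball z R)"
    using \<iota>(1) V(1) by (intro continuous_open_preimage) auto
  moreover have "\<beta> z \<in> V \<inter> \<iota> -` ball z R"
    using V \<iota> R by simp
  ultimately obtain s where s: "s > 0" "cball (\<beta> z) s \<subseteq> V \<inter> \<iota> -` ball z R"
    by (meson open_contains_cball)
  have "winding_number ((\<alpha> \<circ> \<iota>) \<circ> circlepath (\<beta> z) r) ((\<alpha> \<circ> \<iota>) (\<beta> z)) = 1" if r: "0 < r" "r < s" for r
  proof -
    let ?c = "circlepath (\<beta> z) r"
    have c: "?c t \<in> V" "\<iota> (?c t) \<in> ball z R" "?c t \<noteq> \<beta> z" if "t \<in> {0..1}" for t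
    proof -
      have "?c t \<in> path_image ?c"
        using that by (auto simp: path_image_def)
      then have "dist (\<beta> z) (?c t) = r"
        using r by (auto simp: path_image_circlepath_nonneg)
      then show "?c t \<in> V" "\<iota> (?c t) \<in> ball z R" "?c t \<noteq> \<beta> z"
        using s r by (auto simp: subset_iff)
    qed
    have "continuous_on {0..1} (\<lambda>t. \<iota> (?c t))"
      by (rule continuous_on_compose2[OF \<iota>(1)])
        (use c path_circlepath[of "\<beta> z" r] in \<open>auto simp: path_def\<close>)
    then have F: "continuous_on {0..1} (\<lambda>t. \<iota> (?c t) - z)"
      by (intro continuous_intros)
    have F_nz: "\<iota> (?c t) - z \<noteq> 0" if "t \<in> {0..1}" for t
      using c[OF that] V(2) \<iota> by (metis eq_iff_diff_eq_0 inj_onD)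
    have "contractible {0..1 :: real}"
      by (simp add: convex_imp_contractible)
    from continuous_logarithm_on_contractible[OF F this F_nz]
    obtain l where l: "continuous_on {0..1} l" "\<And>t. t \<in> {0..1} \<Longrightarrow> \<iota> (?c t) - z = exp (l t)"
      by blast
    have "?c 1 = ?c 0"
      by (metis pathfinish_circlepath pathfinish_def pathstart_circlepath pathstart_def)
    then have "exp (l 1) = exp (l 0)"
      using l(2)[of 0] l(2)[of 1] by simp
    then obtain k :: int where "l 1 = l 0 + of_int (2 * k) * (of_real pi * \<i>)"
      unfolding exp_eq by auto
    then have k: "pathfinish l - pathstart l = 2 * of_real pi * \<i> * of_int k"
      by (simp add: pathfinish_def pathstart_def)
    have "path l"
      using l(1) by (simp add: path_def)
    have Re_l: "Re (l t) < ln R" if "t \<in> {0..1}" for t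
    proof -
      have "norm (exp (l t)) < R"
        using l(2)[OF that] c(2)[OF that] by (simp add: dist_norm norm_minus_commute flip: l(2)[OF that])
      then show ?thesis
        using R(1) by (metis exp_ln exp_less_cancel_iff norm_exp_eq_Re)
    qed
    have eq: "z + exp (l t) = \<iota> (?c t)" if "t \<in> {0..1}" for t
      by (simp flip: l(2)[OF that])
    have "winding_number (\<beta> \<circ> (\<lambda>t. z + exp (l t))) (\<beta> z) = of_int k"
      by (rule oriented_at_imp_all_circles[OF \<beta>(1) R(1,4,5)]) (use \<open>path l\<close> Re_l k in blast)
    moreover have "winding_number (\<beta> \<circ> (\<lambda>t. z + exp (l t))) (\<beta> z) = winding_number ?c (\<beta> z)"
      by (rule winding_number_cong) (simp add: eq inv c)
    ultimately have "of_int k = (1 :: complex)"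
      using r by (simp add: winding_number_circlepath_centre)
    moreover have "winding_number (\<alpha> \<circ> (\<lambda>t. z + exp (l t))) (\<alpha> z) = of_int k"
      by (rule oriented_at_imp_all_circles[OF \<alpha>(1) R(1,2,3)]) (use \<open>path l\<close> Re_l k in blast)
    moreover have "winding_number (\<alpha> \<circ> (\<lambda>t. z + exp (l t))) (\<alpha> z) = winding_number ((\<alpha> \<circ> \<iota>) \<circ> ?c) (\<alpha> z)"
      by (rule winding_number_cong) (simp add: eq)
    ultimately show ?thesis
      by (simp add: \<iota>(3))
  qed
  then show ?thesis
    unfolding oriented_at_def using s(1) by blast
qed

text \<open>A circle of fixed radius slides from w to z along the segment. By injectivity its image
  never meets the image of the moving centre, so the winding number is unchanged.\<close>

lemma oriented_at_locally_constant:
  assumes R: "R > 0" and cont: "continuous_on (ball z R) \<phi>" and inj: "inj_on \<phi> (ball z R)"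
    and w: "dist z w < R / 2" and or: "oriented_at \<phi> w"
  shows "oriented_at \<phi> z"
proof -
  \<comment> \<open>The centres stay within R / 2 of z, so circles of radius R / 4 stay in the ball
    around z; the radius is also below R / 2, which keeps the first circle in the ball used around
    w.\<close>
  define e where "e = R / 4"
  define h where "h = (\<lambda>(s, t). \<phi> (circlepath (linepath w z s) e t) - \<phi> (linepath w z s))"
  have line: "dist z (linepath w z s) < R / 2" if "s \<in> {0..1}" for s
  proof -
    have "linepath w z s \<in> closed_segment w z"
      using that by (auto simp: linepath_image_01[symmetric])
    then have "dist (linepath w z s) z \<le> dist w z"
      by (metis dist_norm norm_minus_commute segment_bound(2))
    then show ?thesis
      using w by (simp add: dist_commute)
  qed
  have circ: "dist (linepath w z s) (circlepath (linepath w z s) e t) = e" for s t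
    using R by (simp add: circlepath e_def dist_norm norm_mult)
  have circ_in: "circlepath (linepath w z s) e t \<in> ball z R" if "s \<in> {0..1}" for s t
    using line[OF that] circ[of s t] dist_triangle[of z "circlepath (linepath w z s) e t" "linepath w z s"] R
    by (simp add: e_def)
  have line_in: "linepath w z s \<in> ball z R" if "s \<in> {0..1}" for s
    using line[OF that] R by simp
  have "homotopic_loops (- {0}) (\<lambda>t. \<phi> (circlepath w e t) - \<phi> w) (\<lambda>t. \<phi> (circlepath z e t) - \<phi> z)"
    unfolding homotopic_loops
  proof (intro exI[of _ h] conjI ballI)
    show "continuous_on ({0..1} \<times> {0..1}) h"
      unfolding h_def case_prod_unfold circlepath linepath_def
      by (intro continuous_intros continuous_on_compose2[OF cont])
        (use circ_in line_in in \<open>auto simp: circlepath linepath_def\<close>)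
    show "h \<in> {0..1} \<times> {0..1} \<rightarrow> - {0}"
    proof clarsimp
      fix s t :: real assume s: "0 \<le> s" "s \<le> 1" and 0: "h (s, t) = 0"
      then have "circlepath (linepath w z s) e t = linepath w z s"
        using inj_onD[OF inj _ circ_in[of s t] line_in[of s]] by (simp add: h_def)
      then show False
        using circ[of s t] R by (simp add: e_def)
    qed
  qed (auto simp: h_def linepath_def pathfinish_def pathstart_def circlepath)
  then have "winding_number (\<lambda>t. \<phi> (circlepath w e t) - \<phi> w) 0 = winding_number (\<lambda>t. \<phi> (circlepath z e t) - \<phi> z) 0"
    by (rule winding_number_homotopic_loops)
  then have eq: "winding_number (\<phi> \<circ> circlepath w e) (\<phi> w) = winding_number (\<phi> \<circ> circlepath z e) (\<phi> z)"
    using winding_number_offset[of "\<phi> \<circ> circlepath w e" "\<phi> w"] winding_number_offset[of "\<phi> \<circ> circlepath z e" "\<phi> z"]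
    by (simp only: o_def)
  have "ball w (R / 2) \<subseteq> ball z R"
  proof
    fix u assume "u \<in> ball w (R / 2)"
    then show "u \<in> ball z R"
      using w dist_triangle[of z u w] by simp
  qed
  then have "continuous_on (ball w (R / 2)) \<phi>" "inj_on \<phi> (ball w (R / 2))"
    using cont inj by (auto intro: continuous_on_subset inj_on_subset)
  then have "winding_number (\<phi> \<circ> circlepath w e) (\<phi> w) = 1"
    by (rule oriented_at_imp_all_circles[OF or, of "R / 2", rotated]) (use R in \<open>auto simp: e_def\<close>)
  moreover obtain n :: int where n: "\<forall>s. 0 < s \<and> s < R \<longrightarrow> winding_number (\<phi> \<circ> circlepath z s) (\<phi> z) = of_int n"
    by (rule punctured_disc_degree_circlepath[OF R cont inj]) (rule that)
  ultimately have "of_int n = (1 :: complex)"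
    using eq R by (simp add: e_def)
  then show ?thesis
    unfolding oriented_at_def using R n by auto
qed

section \<open>Charts, coordinate changes and local forms\<close>

lemma is_chartI:
  assumes "openin X U" and "continuous_map (subtopology X U) euclidean \<phi>" and "inj_on \<phi> U"
    and "\<And>N. openin X N \<Longrightarrow> N \<subseteq> U \<Longrightarrow> open (\<phi> ` N)"
  shows "is_chart X (U, \<phi>)"
proof -
  have U: "U \<subseteq> topspace X"
    using assms(1) by (rule openin_subset)
  have "homeomorphic_map (subtopology X U) (top_of_set (\<phi> ` U)) \<phi>"
  proof (rule bijective_open_imp_homeomorphic_map)
    show "continuous_map (subtopology X U) (top_of_set (\<phi> ` U)) \<phi>"
      using assms(2) by (auto simp: continuous_map_in_subtopology)
    show "open_map (subtopology X U) (top_of_set (\<phi> ` U)) \<phi>"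
      unfolding open_map_def
    proof (intro allI impI)
      fix N assume "openin (subtopology X U) N"
      then have N: "openin X N" "N \<subseteq> U"
        unfolding openin_open_subtopology[OF assms(1)] by blast+
      then show "openin (top_of_set (\<phi> ` U)) (\<phi> ` N)"
        using assms(4) by (metis image_mono openin_open_Int Int_absorb1)
    qed
  qed (use U assms(3) in \<open>auto simp: topspace_subtopology_subset intro: inj_on_subset\<close>)
  then show ?thesis
    using assms by (simp add: is_chart_def)
qed

lemma is_chartD:
  assumes "is_chart X (U, \<phi>)"
  shows "openin X U" "continuous_map (subtopology X U) euclidean \<phi>" "inj_on \<phi> U"
    "\<And>N. openin X N \<Longrightarrow> N \<subseteq> U \<Longrightarrow> open (\<phi> ` N)"
    "\<And>W. open W \<Longrightarrow> openin X {x \<in> U. \<phi> x \<in> W}"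
proof -
  have *: "openin X U" "open (\<phi> ` U)" and hom: "homeomorphic_map (subtopology X U) (top_of_set (\<phi> ` U)) \<phi>"
    using assms by (auto simp: is_chart_def)
  have U: "topspace (subtopology X U) = U"
    using openin_subset[OF *(1)] by (rule topspace_subtopology_subset)
  show "openin X U"
    by (rule *)
  show cont: "continuous_map (subtopology X U) euclidean \<phi>"
    using homeomorphic_imp_continuous_map[OF hom] by (simp add: continuous_map_in_subtopology)
  show "inj_on \<phi> U"
    using homeomorphic_imp_injective_map[OF hom] U by simp
  show "open (\<phi> ` N)" if "openin X N" "N \<subseteq> U" for N
  proof -
    have "openin (subtopology X U) N"
      using that *(1) by (simp add: openin_open_subtopology)
    then have "openin (top_of_set (\<phi> ` U)) (\<phi> ` N)"
      using homeomorphic_imp_open_map[OF hom] by (simp add: open_map_def)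
    then show ?thesis
      using *(2) openin_open_eq by blast
  qed
  show "openin X {x \<in> U. \<phi> x \<in> W}" if "open W" for W
  proof -
    have "openin (subtopology X U) {x \<in> topspace (subtopology X U). \<phi> x \<in> W}"
      using cont that by (intro openin_continuous_map_preimage) auto
    then show ?thesis
      unfolding U openin_open_subtopology[OF *(1)] by (rule conjunct1)
  qed
qed

lemma chart_inv_into:
  assumes "is_chart X (U, \<phi>)" and "x \<in> U"
  shows "inv_into U \<phi> (\<phi> x) = x"
  using is_chartD(3)[OF assms(1)] assms(2) by (rule inv_into_f_f)

lemma transition_map:
  assumes U: "is_chart X (U, \<phi>)" and V: "is_chart X (V, \<psi>)"
  shows "open (\<phi> ` (U \<inter> V))"
    and "continuous_on (\<phi> ` (U \<inter> V)) (\<psi> \<circ> inv_into U \<phi>)"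
    and "inj_on (\<psi> \<circ> inv_into U \<phi>) (\<phi> ` (U \<inter> V))"
proof -
  have UV: "openin X (U \<inter> V)"
    using is_chartD(1)[OF U] is_chartD(1)[OF V] by blast
  show op: "open (\<phi> ` (U \<inter> V))"
    using is_chartD(4)[OF U UV] by simp
  show "inj_on (\<psi> \<circ> inv_into U \<phi>) (\<phi> ` (U \<inter> V))"
    using is_chartD(3)[OF V] by (auto simp: inj_on_def chart_inv_into[OF U])
  have "open (\<phi> ` (U \<inter> V) \<inter> (\<psi> \<circ> inv_into U \<phi>) -` W)" if "open W" for W
  proof -
    have "openin X ((U \<inter> V) \<inter> {x \<in> V. \<psi> x \<in> W})"
      using UV is_chartD(5)[OF V that] by blast
    then have "open (\<phi> ` ((U \<inter> V) \<inter> {x \<in> V. \<psi> x \<in> W}))"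
      by (rule is_chartD(4)[OF U]) blast
    moreover have "\<phi> ` ((U \<inter> V) \<inter> {x \<in> V. \<psi> x \<in> W}) = \<phi> ` (U \<inter> V) \<inter> (\<psi> \<circ> inv_into U \<phi>) -` W"
      by (auto simp: chart_inv_into[OF U])
    ultimately show ?thesis
      by simp
  qed
  then show "continuous_on (\<phi> ` (U \<inter> V)) (\<psi> \<circ> inv_into U \<phi>)"
    using continuous_on_open_vimage[OF op] by (metis inf_commute)
qed

lemma compatible_charts_iff:
  assumes U: "is_chart X (U, \<phi>)" and V: "is_chart X (V, \<psi>)"
  shows "compatible_charts (U, \<phi>) (V, \<psi>) \<longleftrightarrow> (\<forall>x\<in>U \<inter> V. oriented_at (\<psi> \<circ> inv_into U \<phi>) (\<phi> x))"
  using orientation_preserving_on_iff[OF transition_map[OF assms]]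
  by (simp add: compatible_charts_def)

lemma transition_local_embedding:
  assumes U: "is_chart X (U, \<phi>)" and V: "is_chart X (V, \<psi>)" and x: "x \<in> U \<inter> V"
  shows "local_embedding_at (\<psi> \<circ> inv_into U \<phi>) (\<phi> x)"
proof -
  obtain R where "R > 0" "ball (\<phi> x) R \<subseteq> \<phi> ` (U \<inter> V)"
    using transition_map(1)[OF U V] x by (meson image_eqI openE)
  then show ?thesis
    unfolding local_embedding_at_def using transition_map(2,3)[OF U V]
    by (meson continuous_on_subset inj_on_subset)
qed

text \<open>This centres a chart of the atlas at a prescribed point, as
  \<open>has_local_form\<close> demands. Translations carry circles to circles and so respect
  orientation.\<close>

lemma positive_chart_translate:
  assumes "positive_chart X \<O> (U, \<phi>)"
  shows "positive_chart X \<O> (U, \<lambda>x. \<phi> x - c)"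
proof -
  have U: "is_chart X (U, \<phi>)"
    using assms by (simp add: positive_chart_def)
  have img: "(\<lambda>x. \<phi> x - c) ` N = (+) (- c) ` \<phi> ` N" for N
    by auto
  have chart: "is_chart X (U, \<lambda>x. \<phi> x - c)"
  proof (rule is_chartI)
    show "continuous_map (subtopology X U) euclidean (\<lambda>x. \<phi> x - c)"
      using is_chartD(2)[OF U] by (intro continuous_intros) auto
    show "open ((\<lambda>x. \<phi> x - c) ` N)" if "openin X N" "N \<subseteq> U" for N
      unfolding img using is_chartD(4)[OF U that] by (rule open_translation)
  qed (use is_chartD[OF U] in \<open>auto simp: inj_on_def\<close>)
  have "compatible_charts (U, \<lambda>x. \<phi> x - c) (V, \<psi>)" if V: "(V, \<psi>) \<in> \<O>" for V \<psi>
  proof -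
    have *: "orientation_preserving_on (\<phi> ` (U \<inter> V)) (\<psi> \<circ> inv_into U \<phi>)"
      using assms V by (auto simp: positive_chart_def compatible_charts_def)
    have inv: "inv_into U (\<lambda>x. \<phi> x - c) z = inv_into U \<phi> (z + c)" for z
      by (simp add: inv_into_def diff_eq_eq)
    have "winding_number ((\<psi> \<circ> inv_into U (\<lambda>x. \<phi> x - c)) \<circ> circlepath z r) ((\<psi> \<circ> inv_into U (\<lambda>x. \<phi> x - c)) z) = 1"
      if r: "0 < r" "cball z r \<subseteq> (\<lambda>x. \<phi> x - c) ` (U \<inter> V)" for z r
    proof -
      have "cball (z + c) r \<subseteq> \<phi> ` (U \<inter> V)"
      proof
        fix u assume "u \<in> cball (z + c) r"
        then have "u - c \<in> cball z r"
          by (simp add: dist_norm algebra_simps)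
        then show "u \<in> \<phi> ` (U \<inter> V)"
          using r(2) by auto
      qed
      then have "winding_number ((\<psi> \<circ> inv_into U \<phi>) \<circ> circlepath (z + c) r) ((\<psi> \<circ> inv_into U \<phi>) (z + c)) = 1"
        using * r(1) by (simp add: orientation_preserving_on_def)
      moreover have "(\<psi> \<circ> inv_into U (\<lambda>x. \<phi> x - c)) \<circ> circlepath z r = (\<psi> \<circ> inv_into U \<phi>) \<circ> circlepath (z + c) r"
        by (simp add: fun_eq_iff inv circlepath algebra_simps)
      ultimately show ?thesis
        by (simp add: inv)
    qed
    then show ?thesis
      by (simp add: compatible_charts_def orientation_preserving_on_def)
  qed
  then show ?thesis
    using chart by (auto simp: positive_chart_def)
qed

text \<open>
  A non-trivial local degree contradicts injectivity because \<open>z \<mapsto> z ^ d\<close> identifies a point with its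
  rotation by a \<open>d\<close>-th root of unity.
\<close>

lemma local_form_locally_injective:
  assumes form: "has_local_form X \<O>\<^sub>X Y \<O>\<^sub>Y f p d" and d: "d \<ge> 1"
    and W: "openin X W" "p \<in> W" "inj_on f W"
  shows "d = 1"
proof (rule ccontr)
  assume "d \<noteq> 1"
  then have "d \<ge> 2"
    using d by simp
  obtain U \<phi> V \<psi> where *: "positive_chart X \<O>\<^sub>X (U, \<phi>)" "positive_chart Y \<O>\<^sub>Y (V, \<psi>)"
      "p \<in> U" "\<phi> p = 0" "f ` U \<subseteq> V" "\<forall>x\<in>U. \<psi> (f x) = \<phi> x ^ d"
    using form unfolding has_local_form_def by blast
  then have U: "is_chart X (U, \<phi>)" and V: "is_chart Y (V, \<psi>)"
    by (auto simp: positive_chart_def)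
  have "openin X (U \<inter> W)"
    using is_chartD(1)[OF U] W(1) by blast
  then have "open (\<phi> ` (U \<inter> W))"
    by (rule is_chartD(4)[OF U]) blast
  moreover have "0 \<in> \<phi> ` (U \<inter> W)"
    using *(3,4) W(2) by force
  ultimately obtain r where r: "r > 0" "cball 0 r \<subseteq> \<phi> ` (U \<inter> W)"
    by (meson open_contains_cball)
  define \<zeta> where "\<zeta> = exp (2 * of_real pi * \<i> / of_nat d)"
  have "\<zeta> ^ d = 1"
    using d by (simp add: \<zeta>_def flip: exp_of_nat_mult)
  have "\<zeta> \<noteq> 1"
  proof
    assume "\<zeta> = 1"
    then obtain n :: int where "2 * pi / real d = of_int (2 * n) * pi"
      unfolding \<zeta>_def exp_eq_1 by auto
    then have "real_of_int (n * int d) = real_of_int 1"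
      using d by (simp add: field_simps)
    then have "n * int d = 1"
      by (simp only: of_int_eq_iff)
    then show False
      using \<open>d \<ge> 2\<close> by (simp add: zmult_eq_1_iff)
  qed
  have "norm \<zeta> = 1"
    by (simp add: \<zeta>_def)
  then have "of_real r * \<zeta> \<in> cball 0 r" "of_real r \<in> cball (0 :: complex) r"
    using r(1) by (simp_all add: norm_mult)
  then have "of_real r * \<zeta> \<in> \<phi> ` (U \<inter> W)" "of_real r \<in> \<phi> ` (U \<inter> W)"
    using r(2) by blast+
  then obtain x y where x: "x \<in> U \<inter> W" "\<phi> x = of_real r * \<zeta>" and y: "y \<in> U \<inter> W" "\<phi> y = of_real r"
    by (metis imageE)
  have "\<psi> (f x) = \<psi> (f y)"
    using *(6) x y \<open>\<zeta> ^ d = 1\<close> by (simp add: power_mult_distrib)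
  moreover have "f x \<in> V" "f y \<in> V"
    using *(5) x y by auto
  ultimately have "f x = f y"
    using is_chartD(3)[OF V] by (meson inj_onD)
  then have "x = y"
    using W(3) x y by (meson IntD2 inj_onD)
  then show False
    using x y r(1) \<open>\<zeta> \<noteq> 1\<close> by simp
qed

text \<open>In the pulled-back chart the map f becomes the identity, which is the local form with
  exponent 1 once the chart is known to be positive.\<close>

lemma chart_comp:
  assumes V: "is_chart Y (V, \<psi>)" and W: "openin X W" "f ` W \<subseteq> V" "inj_on f W"
    and f: "continuous_map X Y f" "open_map X Y f"
  shows "is_chart X (W, \<psi> \<circ> f)"
proof (rule is_chartI)
  have "continuous_map (subtopology X W) (subtopology Y V) f"
    using f(1) W(2) by (auto simp: continuous_map_in_subtopology continuous_map_from_subtopology)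
  then show "continuous_map (subtopology X W) euclidean (\<psi> \<circ> f)"
    using is_chartD(2)[OF V] by (rule continuous_map_compose)
  show "inj_on (\<psi> \<circ> f) W"
    using is_chartD(3)[OF V] W by (meson comp_inj_on inj_on_subset)
  show "open ((\<psi> \<circ> f) ` N)" if N: "openin X N" "N \<subseteq> W" for N
  proof -
    have "openin Y (f ` N)"
      using f(2) N(1) by (simp add: open_map_def)
    then have "open (\<psi> ` f ` N)"
      by (rule is_chartD(4)[OF V]) (use N W in auto)
    then show ?thesis
      by (simp add: image_comp)
  qed
qed (rule W)

text \<open>The orientation of \<open>f\<close> at \<open>p\<close> is inherited from the nearby points, where \<open>f\<close> has a local form.\<close>

lemma local_form_extends:
  assumes atlas: "oriented_atlas X \<O>" and f: "continuous_map X X f" "open_map X X f"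
    and W: "openin X W" "p \<in> W" "inj_on f W"
    and form: "\<And>q. q \<in> W - {p} \<Longrightarrow> has_local_form X \<O> X \<O> f q 1"
  shows "has_local_form X \<O> X \<O> f p 1"
proof -
  have "p \<in> topspace X"
    using W openin_subset by blast
  then have "f p \<in> topspace X"
    using f(1) by (auto simp: continuous_map_def)
  then have "f p \<in> (\<Union>c\<in>\<O>. fst c)"
    using atlas by (simp add: oriented_atlas_def)
  then obtain V \<psi>0 where V0: "(V, \<psi>0) \<in> \<O>" "f p \<in> V"
    by auto
  define \<psi> where "\<psi> = (\<lambda>x. \<psi>0 x - \<psi>0 (f p))"
  have "positive_chart X \<O> (V, \<psi>0)"
    using atlas V0(1) by (auto simp: oriented_atlas_def positive_chart_def)
  then have pos: "positive_chart X \<O> (V, \<psi>)"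
    unfolding \<psi>_def by (rule positive_chart_translate)
  then have V: "is_chart X (V, \<psi>)"
    by (simp add: positive_chart_def)
  define N where "N = W \<inter> {x \<in> topspace X. f x \<in> V}"
  have N: "openin X N" "p \<in> N" "f ` N \<subseteq> V" "inj_on f N" "N \<subseteq> W"
  proof -
    show "openin X N"
      unfolding N_def using W(1) openin_continuous_map_preimage[OF f(1) is_chartD(1)[OF V]] by blast
    show "p \<in> N"
      using W(2) V0(2) \<open>p \<in> topspace X\<close> by (simp add: N_def)
    show "inj_on f N"
      using W(3) by (rule inj_on_subset) (auto simp: N_def)
  qed (auto simp: N_def)
  define \<phi> where "\<phi> = \<psi> \<circ> f"
  have chart: "is_chart X (N, \<phi>)"
    unfolding \<phi>_def by (rule chart_comp[OF V N(1,3,4) f])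
  have "compatible_charts (N, \<phi>) (V', \<psi>')" if V': "(V', \<psi>') \<in> \<O>" for V' \<psi>'
  proof -
    have chart': "is_chart X (V', \<psi>')"
      using V' atlas by (auto simp: oriented_atlas_def)
    let ?T = "\<psi>' \<circ> inv_into N \<phi>"
    have other: "oriented_at ?T (\<phi> q)" if q: "q \<in> N \<inter> V'" "q \<noteq> p" for q
    proof -
      have "q \<in> W - {p}"
        using q N(5) by blast
      then obtain U1 \<phi>1 V1 \<psi>1 where 1: "positive_chart X \<O> (U1, \<phi>1)" "positive_chart X \<O> (V1, \<psi>1)"
        "q \<in> U1" "f q \<in> V1" "f ` U1 \<subseteq> V1" "\<forall>x\<in>U1. \<psi>1 (f x) = \<phi>1 x ^ 1"
        using form unfolding has_local_form_def by blast
      then have chart1: "is_chart X (U1, \<phi>1)" "is_chart X (V1, \<psi>1)"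
        by (auto simp: positive_chart_def)
      \<comment> \<open>Since \<open>\<psi>1 (f x) = \<phi>1 x\<close>, the map
        \<open>?\<beta>\<close> turns the coordinate \<open>\<phi>1\<close> into
        \<open>\<phi>\<close>. Hence \<open>?\<iota>\<close> inverts \<open>?\<beta>\<close>, and
        \<open>?T\<close> is \<open>?\<alpha>\<close> after \<open>?\<iota>\<close> near
        \<open>\<phi> q\<close>. Both \<open>?\<alpha>\<close> and \<open>?\<gamma>\<close> are
        changes from positive charts into the atlas, and \<open>?\<beta>\<close> differs from
        \<open>?\<gamma>\<close> by a translation.\<close>
      let ?\<alpha> = "\<psi>' \<circ> inv_into U1 \<phi>1" and ?\<gamma> = "\<psi>0 \<circ> inv_into V1 \<psi>1" and ?\<beta> = "\<psi> \<circ> inv_into V1 \<psi>1"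
        and ?\<iota> = "\<phi>1 \<circ> inv_into N \<phi>"
      have eq: "\<psi>1 (f x) = \<phi>1 x" if "x \<in> U1" for x
        using 1 that by simp
      have "f q \<in> V"
        using q N(3) by blast
      have \<alpha>: "oriented_at ?\<alpha> (\<phi>1 q)"
        using 1(1,3) V' q compatible_charts_iff[OF chart1(1) chart'] by (auto simp: positive_chart_def)
      have "is_chart X (V, \<psi>0)"
        using V0 atlas by (auto simp: oriented_atlas_def)
      from compatible_charts_iff[OF chart1(2) this] have "oriented_at ?\<gamma> (\<psi>1 (f q))"
        using 1(2,4) V0 \<open>f q \<in> V\<close> by (auto simp: positive_chart_def)
      then have \<beta>: "oriented_at ?\<beta> (\<phi>1 q)"
        using eq[OF 1(3)] unfolding oriented_at_def \<psi>_def
        by (simp add: winding_number_offset_NO_MATCH o_def)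
      have \<beta>_q: "?\<beta> (\<phi>1 x) = \<phi> x" if "x \<in> U1" for x
        using that 1(5) by (simp add: \<phi>_def chart_inv_into[OF chart1(2)] image_subset_iff flip: eq[OF that])
      have "oriented_at (?\<alpha> \<circ> ?\<iota>) (?\<beta> (\<phi>1 q))"
      proof (rule oriented_at_comp_inverse[OF \<alpha> _ \<beta>])
        show "local_embedding_at ?\<alpha> (\<phi>1 q)"
          using transition_local_embedding[OF chart1(1) chart'] q 1(3) by blast
        show "local_embedding_at ?\<beta> (\<phi>1 q)"
          using transition_local_embedding[OF chart1(2) V, of "f q"] eq[OF 1(3)] 1(4) \<open>f q \<in> V\<close> by simp
        show "open (\<phi> ` (N \<inter> U1))" "continuous_on (\<phi> ` (N \<inter> U1)) ?\<iota>" "inj_on ?\<iota> (\<phi> ` (N \<inter> U1))"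
          by (rule transition_map[OF chart chart1(1)])+
        show "?\<beta> (\<phi>1 q) \<in> \<phi> ` (N \<inter> U1)"
          unfolding \<beta>_q[OF 1(3)] using q 1(3) by blast
        show "?\<iota> (?\<beta> (\<phi>1 q)) = \<phi>1 q"
          unfolding \<beta>_q[OF 1(3)] using q chart_inv_into[OF chart] by simp
        fix u assume "u \<in> \<phi> ` (N \<inter> U1)"
        then obtain x where "x \<in> N" "x \<in> U1" "u = \<phi> x"
          by blast
        then show "?\<beta> (?\<iota> u) = u"
          using \<beta>_q chart_inv_into[OF chart] by simp
      qed
      then have "oriented_at (?\<alpha> \<circ> ?\<iota>) (\<phi> q)"
        using \<beta>_q[OF 1(3)] by simp
      then show ?thesis
      proof (rule oriented_at_cong)
        show "open (\<phi> ` (N \<inter> U1))"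
          by (rule transition_map[OF chart chart1(1)])
        show "\<phi> q \<in> \<phi> ` (N \<inter> U1)"
          using q 1(3) by blast
        show "(?\<alpha> \<circ> ?\<iota>) u = ?T u" if "u \<in> \<phi> ` (N \<inter> U1)" for u
          using that by (auto simp: chart_inv_into[OF chart] chart_inv_into[OF chart1(1)])
      qed
    qed
    have "oriented_at ?T (\<phi> p)" if p: "p \<in> V'"
    proof -
      obtain R where R: "R > 0" "ball (\<phi> p) R \<subseteq> \<phi> ` (N \<inter> V')"
        using transition_map(1)[OF chart chart'] p N(2) by (meson IntI image_eqI openE)
      \<comment> \<open>A point of the disc other than its centre, where the orientation is already
        known, and closer than R / 2 so that it passes to the centre.\<close>
      define w where "w = \<phi> p + of_real (R / 4)"
      have "dist (\<phi> p) w < R / 2" "w \<noteq> \<phi> p"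
        using R(1) by (auto simp: w_def dist_norm)
      moreover from this have "w \<in> ball (\<phi> p) R"
        using R(1) by simp
      then obtain q where "q \<in> N \<inter> V'" "w = \<phi> q"
        using R(2) by blast
      ultimately have "oriented_at ?T w"
        using other by blast
      then show ?thesis
        using R transition_map(2,3)[OF chart chart'] \<open>dist (\<phi> p) w < R / 2\<close>
        by (intro oriented_at_locally_constant[of R "\<phi> p" ?T w])
          (auto intro: continuous_on_subset inj_on_subset)
    qed
    then show ?thesis
      using compatible_charts_iff[OF chart chart'] other by blast
  qed
  then have "positive_chart X \<O> (N, \<phi>)"
    using chart by (auto simp: positive_chart_def)
  moreover have "\<phi> p = 0" "\<psi> (f p) = 0"
    by (simp_all add: \<phi>_def \<psi>_def)
  ultimately show ?thesis
    unfolding has_local_form_def using pos N V0(2)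
    by (intro exI[of _ N] exI[of _ \<phi>] exI[of _ V] exI[of _ \<psi>]) (auto simp: \<phi>_def)
qed

text \<open>
  If \<open>f\<close> had no local form at \<open>p\<close>, the local degree would be the arbitrary value of
  \<open>THE d. False\<close>. Were this value at least 2, then all points of \<open>S\<close> without local form would be
  critical; as the postcritical set is finite they are isolated, and the previous lemma applies.
\<close>

lemma critical_points_disjoint_locally_injective:
  assumes atlas: "oriented_atlas X \<O>" and f: "continuous_map X X f" "open_map X X f"
    and X: "t1_space X" and S: "openin X S"
    and inj: "\<And>p. p \<in> S \<Longrightarrow> \<exists>W. openin X W \<and> p \<in> W \<and> inj_on f W"
    and fin: "finite (post X \<O> f)" "\<And>q. finite {p \<in> S. f p = q}"
  shows "critical_points X \<O> f \<inter> S = {}"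
proof (rule ccontr)
  let ?form = "\<lambda>p. has_local_form X \<O> X \<O> f p"
  assume "critical_points X \<O> f \<inter> S \<noteq> {}"
  then obtain p where p: "p \<in> S" "p \<in> critical_points X \<O> f"
    by blast
  \<comment> \<open>Local injectivity leaves 1 as the only exponent, so the predicate under
    \<open>THE\<close> holds for 1 alone or for nothing.\<close>
  have deg: "(d \<ge> 1 \<and> ?form q d) \<longleftrightarrow> d = 1 \<and> ?form q 1" if "q \<in> S" for q d
    using inj[OF that] local_form_locally_injective by fastforce
  have no_form: "local_degree X \<O> f q = (THE d. False)" if "q \<in> S" "\<not> ?form q 1" for q
    unfolding local_degree_def deg[OF that(1)] using that(2) by simp
  have "local_degree X \<O> f q = 1" if "q \<in> S" "?form q 1" for q
    using deg[OF that(1)] that(2) by (simp add: local_degree_def)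
  then have p_no: "\<not> ?form p 1"
    using p by (force simp: critical_points_def)
  define B where "B = {q \<in> S. \<not> ?form q 1}"
  have "B \<subseteq> critical_points X \<O> f"
    using p openin_subset[OF S] no_form[OF p(1) p_no] no_form by (auto simp: B_def critical_points_def)
  moreover have "f ` critical_points X \<O> f \<subseteq> post X \<O> f"
    unfolding post_def by (intro subsetI UN_I[of 1]) auto
  ultimately have "B \<subseteq> (\<Union>q\<in>post X \<O> f. {p \<in> S. f p = q})"
    by (auto simp: B_def)
  then have "finite B"
    using fin by (meson finite_UN_I finite_subset)
  then have "closedin X (B - {p})"
    using X openin_subset[OF S] by (intro t1_space_closedin_finite[THEN iffD1, rule_format]) (auto simp: B_def)
  obtain W where W: "openin X W" "p \<in> W" "inj_on f W"
    using inj[OF p(1)] by blast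
  have "?form p 1"
  proof (rule local_form_extends[OF atlas f])
    show "openin X (W \<inter> S - (B - {p}))"
      using W S \<open>closedin X (B - {p})\<close> by blast
    show "inj_on f (W \<inter> S - (B - {p}))"
      using W(3) by (rule inj_on_subset) auto
  qed (use W p in \<open>auto simp: B_def\<close>)
  then show False
    using p_no by simp
qed

section \<open>Openness of branched coverings\<close>

lemma power_image_ball:
  assumes "d \<ge> 1" "w \<in> ball (0 :: complex) (r ^ d)" "r > 0"
  obtains z where "z \<in> ball 0 r" "z ^ d = w"
proof -
  obtain z where z: "z ^ d = w"
  proof (cases "w = 0")
    case True
    then show ?thesis
      using that[of 0] assms(1) by simp
  next
    case False
    have "exp (Ln w / of_nat d) ^ d = exp (of_nat d * (Ln w / of_nat d))"
      by (rule exp_of_nat_mult[symmetric])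
    also have "\<dots> = w"
      using False assms(1) by simp
    finally show ?thesis
      by (rule that)
  qed
  have "norm z ^ d < r ^ d"
    using assms(2) by (simp add: z flip: norm_power)
  then have "norm z < r"
    using assms(3) by (meson less_imp_le power_less_imp_less_base)
  then show ?thesis
    using that z by simp
qed

text \<open>The power map sends the disc of radius r onto the disc of radius r^d, so the image of a
  neighbourhood contains a coordinate disc around the image point.\<close>

lemma branched_covering_open_map:
  assumes f: "branched_covering X \<O>\<^sub>X Y \<O>\<^sub>Y f"
  shows "open_map X Y f"
  unfolding open_map_def
proof (intro allI impI)
  fix N assume N: "openin X N"
  show "openin Y (f ` N)"
  proof (subst openin_subopen, intro ballI)
    fix q assume "q \<in> f ` N"
    then obtain p where p: "p \<in> N" "q = f p"
      by blast
    then have "p \<in> topspace X"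
      using openin_subset[OF N] by blast
    then obtain d where d: "d \<ge> 1" "has_local_form X \<O>\<^sub>X Y \<O>\<^sub>Y f p d"
      using f by (auto simp: branched_covering_def)
    then obtain U \<phi> V \<psi> where *: "positive_chart X \<O>\<^sub>X (U, \<phi>)" "positive_chart Y \<O>\<^sub>Y (V, \<psi>)"
        "p \<in> U" "\<phi> p = 0" "f p \<in> V" "\<psi> (f p) = 0" "f ` U \<subseteq> V" "\<forall>x\<in>U. \<psi> (f x) = \<phi> x ^ d"
      unfolding has_local_form_def by blast
    then have U: "is_chart X (U, \<phi>)" and V: "is_chart Y (V, \<psi>)"
      by (auto simp: positive_chart_def)
    have "openin X (U \<inter> N)"
      using is_chartD(1)[OF U] N by blast
    then have "open (\<phi> ` (U \<inter> N))"
      by (rule is_chartD(4)[OF U]) blast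
    moreover have "0 \<in> \<phi> ` (U \<inter> N)"
      using *(3,4) p(1) by force
    ultimately obtain r where r: "r > 0" "ball 0 r \<subseteq> \<phi> ` (U \<inter> N)"
      by (meson openE)
    let ?W = "{y \<in> V. \<psi> y \<in> ball 0 (r ^ d)}"
    have "openin Y ?W"
      by (rule is_chartD(5)[OF V open_ball])
    moreover have "q \<in> ?W"
      using *(5,6) p(2) r(1) by simp
    moreover have "?W \<subseteq> f ` N"
    proof
      fix y assume y: "y \<in> ?W"
      then obtain z where z: "z \<in> ball 0 r" "z ^ d = \<psi> y"
        using power_image_ball[OF d(1) _ r(1)] by blast
      then obtain x where x: "x \<in> U" "x \<in> N" "z = \<phi> x"
        using r(2) by blast
      then have "\<psi> (f x) = \<psi> y"
        using *(8) z(2) by simp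
      then have "f x = y"
        using is_chartD(3)[OF V] x(1) y *(7) by (auto dest: inj_onD)
      then show "y \<in> f ` N"
        using x(2) by blast
    qed
    ultimately show "\<exists>W. openin Y W \<and> q \<in> W \<and> W \<subseteq> f ` N"
      by blast
  qed
qed

section \<open>The pillow\<close>

text \<open>The operator norm for the maximum norm is the largest absolute row sum
  \<open>r i\<close>, and it is attained at the vector of signs of that row.\<close>

lemma infnorm_op_attained:
  assumes "linear L"
  obtains i v where "\<forall>k. \<bar>v $ k\<bar> = 1" "L v $ i = infnorm_op L"
    "\<forall>u j. \<bar>L u $ j\<bar> \<le> infnorm_op L * infnorm u"
proof -
  define r where "r j = \<bar>L (axis 1 1) $ j\<bar> + \<bar>L (axis 2 1) $ j\<bar>" for j
  have L: "L u $ j = u $ 1 * L (axis 1 1) $ j + u $ 2 * L (axis 2 1) $ j" for u j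
  proof -
    have eq: "(u $ 1) *\<^sub>R axis 1 1 + (u $ 2) *\<^sub>R axis 2 1 = u"
      by (simp add: vec2_eq_iff axis_def)
    have "L ((u $ 1) *\<^sub>R axis 1 1 + (u $ 2) *\<^sub>R axis 2 1) = (u $ 1) *\<^sub>R L (axis 1 1) + (u $ 2) *\<^sub>R L (axis 2 1)"
      using assms by (simp add: linear_add linear_cmul)
    then show ?thesis
      unfolding eq by simp
  qed
  obtain i where i: "\<And>j. r j \<le> r i"
  proof (cases "r 1 \<le> r 2")
    case True
    show thesis
      by (rule that[of 2]) (metis True exhaust_2 order_refl)
  next
    case False
    show thesis
      by (rule that[of 1]) (metis False exhaust_2 linear order_refl)
  qed
  define v :: "real ^ 2" where "v = (\<chi> k. if L (axis k 1) $ i \<ge> 0 then 1 else - 1)"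
  have v: "\<bar>v $ k\<bar> = 1" for k
    by (simp add: v_def)
  have bound: "\<bar>L u $ j\<bar> \<le> r i * infnorm u" for u j
  proof -
    have "\<bar>L u $ j\<bar> \<le> \<bar>u $ 1\<bar> * \<bar>L (axis 1 1) $ j\<bar> + \<bar>u $ 2\<bar> * \<bar>L (axis 2 1) $ j\<bar>"
      by (subst L) (simp only: abs_mult[symmetric] abs_triangle_ineq)
    also have "\<dots> \<le> infnorm u * \<bar>L (axis 1 1) $ j\<bar> + infnorm u * \<bar>L (axis 2 1) $ j\<bar>"
      by (intro add_mono mult_right_mono) (auto simp: infnorm_2)
    also have "\<dots> = r j * infnorm u"
      by (simp add: r_def algebra_simps)
    also have "\<dots> \<le> r i * infnorm u"
      using i by (intro mult_right_mono) (auto simp: infnorm_pos_le)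
    finally show ?thesis .
  qed
  have Lv: "L v $ i = r i"
    by (subst L) (simp add: v_def r_def)
  have "infnorm v = 1"
    by (simp add: infnorm_2 v)
  have "infnorm_op L = r i"
    unfolding infnorm_op_def
  proof (rule cSup_eq_maximum)
    have "infnorm (L v) \<le> r i"
      using bound[of v] \<open>infnorm v = 1\<close> by (simp add: infnorm_2)
    moreover have "r i \<le> infnorm (L v)"
      using Lv by (metis abs_ge_self component_le_infnorm_cart order_trans)
    ultimately show "r i \<in> (\<lambda>v. infnorm (L v)) ` {v. infnorm v = 1}"
      using \<open>infnorm v = 1\<close> by (auto intro!: image_eqI[of _ _ v])
    show "x \<le> r i" if "x \<in> (\<lambda>v. infnorm (L v)) ` {v. infnorm v = 1}" for x
    proof -
      obtain u where "infnorm u = 1" "x = infnorm (L u)"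
        using \<open>x \<in> _\<close> by auto
      then show ?thesis
        using bound[of u] by (simp add: infnorm_2[of "L u"])
    qed
  qed
  with Lv v bound show ?thesis
    by (intro that[of v i]) simp_all
qed

text \<open>Each set lies in a closed interval of length \<delta> that starts at its infimum;
  Lebesgue measure is subadditive on these intervals.\<close>

lemma unit_interval_cover:
  fixes S :: "'i \<Rightarrow> real set"
  assumes fin: "finite J" and cover: "{0..1} \<subseteq> (\<Union>j\<in>J. S j)"
    and diam: "\<And>j x y. j \<in> J \<Longrightarrow> x \<in> S j \<Longrightarrow> y \<in> S j \<Longrightarrow> \<bar>x - y\<bar> \<le> \<delta>"
  shows "1 \<le> real (card J) * \<delta>"
proof -
  define a where "a j = Inf (S j)" for j
  \<comment> \<open>Empty sets are dropped first, as their \<open>Inf\<close> says nothing.\<close>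
  define J' where "J' = {j \<in> J. S j \<noteq> {}}"
  have J': "finite J'" "card J' \<le> card J"
    using fin by (auto simp: J'_def intro: card_mono)
  obtain x0 j0 where "j0 \<in> J" "x0 \<in> S j0"
    using cover by (metis UN_E atLeastAtMost_iff order_refl subsetD zero_le_one)
  then have "\<delta> \<ge> 0"
    using diam by force
  have int: "S j \<subseteq> {a j..a j + \<delta>}" if j: "j \<in> J'" for j
  proof
    fix x assume x: "x \<in> S j"
    have lower: "x - \<delta> \<le> y" if "y \<in> S j" for y
      using diam[of j x y] j x that by (simp add: J'_def)
    then have "x - \<delta> \<le> a j"
      unfolding a_def using x by (intro cInf_greatest) auto
    moreover have "a j \<le> x"
      unfolding a_def using x lower by (intro cInf_lower bdd_belowI)
    ultimately show "x \<in> {a j..a j + \<delta>}"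
      by simp
  qed
  have sub: "{0..1} \<subseteq> (\<Union>j\<in>J'. {a j..a j + \<delta>})"
  proof
    fix x :: real assume "x \<in> {0..1}"
    then obtain j where "j \<in> J" "x \<in> S j"
      using cover by blast
    then have "j \<in> J'"
      by (auto simp: J'_def)
    then show "x \<in> (\<Union>j\<in>J'. {a j..a j + \<delta>})"
      using int \<open>x \<in> S j\<close> by blast
  qed
  have "(\<Union>j\<in>J'. {a j..a j + \<delta>}) \<in> fmeasurable lborel"
    using J'(1) by (intro fmeasurable.finite_UN) (auto intro!: fmeasurableI simp: emeasure_lborel_Icc_eq)
  have "1 = measure lborel {0..1 :: real}"
    by simp
  also have "\<dots> \<le> measure lborel (\<Union>j\<in>J'. {a j..a j + \<delta>})"
    by (rule measure_mono_fmeasurable[OF sub]) (simp, fact)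
  also have "\<dots> \<le> (\<Sum>j\<in>J'. measure lborel {a j..a j + \<delta>})"
    using J' by (intro measure_UNION_le) auto
  also have "\<dots> = real (card J') * \<delta>"
    using \<open>\<delta> \<ge> 0\<close> by simp
  also have "\<dots> \<le> real (card J) * \<delta>"
    using J' \<open>\<delta> \<ge> 0\<close> by (intro mult_right_mono) auto
  finally show ?thesis .
qed

text \<open>The complement of one member is the union of the others and hence open. Each member is
  thus clopen and connected.\<close>

lemma connected_components_of_eqI:
  assumes union: "\<Union>\<U> = topspace Y"
    and comp: "\<And>U. U \<in> \<U> \<Longrightarrow> openin Y U" "\<And>U. U \<in> \<U> \<Longrightarrow> connectedin Y U" "\<And>U. U \<in> \<U> \<Longrightarrow> U \<noteq> {}"
    and disj: "pairwise disjnt \<U>"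
  shows "connected_components_of Y = \<U>"
proof
  show sub: "\<U> \<subseteq> connected_components_of Y"
  proof
    fix U assume U: "U \<in> \<U>"
    have "Y \<noteq> trivial_topology"
      using comp(3)[OF U] U union by auto
    then obtain K where K: "K \<in> connected_components_of Y" "U \<subseteq> K"
      using exists_connected_component_of_superset[OF comp(2)[OF U]] by blast
    have "topspace Y - U = \<Union>(\<U> - {U})"
      using union U disj by (auto simp: pairwise_def disjnt_def)
    moreover have "openin Y (\<Union>(\<U> - {U}))"
      using comp(1) by (intro openin_Union) auto
    ultimately have "openin Y (topspace Y - U)"
      by simp
    then have "closedin Y U"
      using U union by (auto simp: closedin_def)
    then have "K \<subseteq> U \<or> disjnt K U"
      using connectedin_clopen_cases connectedin_connected_components_of[OF K(1)] comp(1)[OF U] by blast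
    then have "K = U"
      using K(2) comp(3)[OF U] by (auto simp: disjnt_def)
    then show "U \<in> connected_components_of Y"
      using K(1) by simp
  qed
  show "connected_components_of Y \<subseteq> \<U>"
  proof
    fix K assume K: "K \<in> connected_components_of Y"
    then obtain x where x: "x \<in> K"
      using nonempty_connected_components_of by blast
    then have "x \<in> \<Union>\<U>"
      using connected_components_of_subset[OF K] union by blast
    then obtain U where "U \<in> \<U>" "x \<in> U"
      by blast
    then show "K \<in> \<U>"
      using connected_components_of_overlap[OF K, of U] sub x by blast
  qed
qed

lemma closure_of_image:
  assumes X: "Hausdorff_space X" and g: "continuous_map euclidean X g" and S: "compact (closure S)"
  shows "X closure_of (g ` S) = g ` closure S"
proof
  have "compactin X (g ` closure S)"
    using image_compactin[OF _ g] S by simp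
  then have "closedin X (g ` closure S)"
    using X by (rule compactin_imp_closedin[rotated])
  then show "X closure_of (g ` S) \<subseteq> g ` closure S"
    by (intro closure_of_minimal image_mono closure_subset)
  show "g ` closure S \<subseteq> X closure_of (g ` S)"
    using continuous_map_image_closure_subset[OF g, of S] by simp
qed

text \<open>Each point of K is the limit of a segment inside S that leads towards \<open>m\<close>.
  It is applied with \<open>m\<close> the midpoint of a side of the square.\<close>

lemma closure_eqI_segment:
  fixes K :: "'b::euclidean_space set"
  assumes "closed K" "S \<subseteq> K" "m \<in> S" and "\<And>x. x \<in> K \<Longrightarrow> open_segment x m \<subseteq> S"
  shows "closure S = K"
proof
  show "closure S \<subseteq> K"
    using assms by (intro closure_minimal)
  show "K \<subseteq> closure S"
  proof
    fix x assume x: "x \<in> K"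
    show "x \<in> closure S"
    proof (cases "x = m")
      case True
      then show ?thesis
        using assms(3) closure_subset by blast
    next
      case False
      then have "x \<in> closure (open_segment x m)"
        by (simp add: closure_open_segment)
      then show ?thesis
        using closure_mono[OF assms(4)[OF x]] by blast
    qed
  qed
qed

section \<open>The unit square and the folding of the line onto [0, 1]\<close>

definition Z2 :: "(real ^ 2) set" where
  "Z2 = {x. \<forall>i. x $ i \<in> \<int>}"

definition square_side :: "2 \<Rightarrow> real \<Rightarrow> (real ^ 2) set" where
  "square_side i c = {x \<in> cbox 0 1. x $ i = c}"

lemma other_index:
  fixes i :: 2
  obtains j where "j \<noteq> i" "\<And>k. k = i \<or> k = j"
proof (cases "i = 1")
  case True
  then show ?thesis
    using that[of 2] exhaust_2 by auto
next
  case False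
  then show ?thesis
    using that[of 1] exhaust_2 by metis
qed

lemma mem_unit_square: "x \<in> cbox 0 (1 :: real ^ 2) \<longleftrightarrow> (\<forall>i. 0 \<le> x $ i \<and> x $ i \<le> 1)"
  by (simp add: mem_box_cart)

lemma frontier_unit_square: "frontier (cbox 0 (1 :: real ^ 2)) = (\<Union>i. square_side i 0 \<union> square_side i 1)"
proof -
  have "x \<notin> box 0 1 \<longleftrightarrow> (\<exists>i. x $ i = 0 \<or> x $ i = 1)" if "x \<in> cbox 0 (1 :: real ^ 2)" for x
    using that by (auto simp: mem_unit_square mem_box_cart not_less order_antisym) (metis order_antisym_conv order_le_less)+
  then show ?thesis
    by (auto simp: frontier_cbox square_side_def)
qed

text \<open>Subtracting the nearest even integer leaves a number in [-1, 1], and the sign moves it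
  to [0, 1].\<close>

lemma fold_to_unit_interval:
  fixes t :: real
  obtains s :: real and k :: int where "s = 1 \<or> s = - 1" "0 \<le> s * t + 2 * of_int k" "s * t + 2 * of_int k \<le> 1"
proof -
  have *: "of_int (round (t / 2)) - t / 2 \<le> 1 / 2" "- (of_int (round (t / 2)) - t / 2) \<le> 1 / 2"
    using abs_le_D1[OF of_int_round_abs_le[of "t / 2"]] abs_le_D2[OF of_int_round_abs_le[of "t / 2"]] by simp_all
  show ?thesis
  proof (cases "of_int (round (t / 2)) \<le> t / 2")
    case True
    show ?thesis
      by (rule that[of 1 "- round (t / 2)"]) (use True * in simp_all)
  next
    case False
    show ?thesis
      by (rule that[of "- 1" "round (t / 2)"]) (use False * in simp_all)
  qed
qed

text \<open>The even integers are invariant under even translations and under reflection, and so is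
  the distance to them. This is what lets the distance descend to the sphere coordinate by
  coordinate.\<close>

lemma infdist_even_integers:
  fixes t u :: real
  defines "E \<equiv> range (\<lambda>k :: int. 2 * real_of_int k)"
  shows "\<bar>infdist t E - infdist u E\<bar> \<le> \<bar>t - u\<bar>"
    and "(t - u) / 2 \<in> \<int> \<or> (t + u) / 2 \<in> \<int> \<Longrightarrow> infdist t E = infdist u E"
    and "infdist 0 E = 0" and "infdist 1 E = 1"
proof -
  have ne: "E \<noteq> {}"
    by (auto simp: E_def)
  show "\<bar>infdist t E - infdist u E\<bar> \<le> \<bar>t - u\<bar>"
    using infdist_triangle_abs[of t E u] by (simp add: dist_real_def)
  have le: "infdist t E \<le> infdist u E" if *: "(t - u) / 2 \<in> \<int> \<or> (t + u) / 2 \<in> \<int>" for t u :: real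
  proof -
    have "infdist t E \<le> dist u e" if e: "e \<in> E" for e
    proof -
      obtain k :: int where k: "e = 2 * of_int k"
        using e by (auto simp: E_def)
      consider m :: int where "(t - u) / 2 = of_int m" | m :: int where "(t + u) / 2 = of_int m"
        using * by (auto simp: Ints_def)
      then show ?thesis
      proof cases
        case 1
        then have "dist u e = dist t (2 * of_int (k + m))"
          by (simp add: k dist_real_def)
        moreover have "2 * real_of_int (k + m) \<in> E"
          unfolding E_def by (rule rangeI)
        ultimately show ?thesis
          by (simp only: infdist_le)
      next
        case 2
        then have "dist u e = dist t (2 * of_int (m - k))"
          by (simp add: k dist_real_def)
        moreover have "2 * real_of_int (m - k) \<in> E"
          unfolding E_def by (rule rangeI)
        ultimately show ?thesis
          by (simp only: infdist_le)
      qed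
    qed
    then show ?thesis
      unfolding infdist_notempty[OF ne, of u] using ne by (intro cINF_greatest)
  qed
  show "infdist t E = infdist u E" if *: "(t - u) / 2 \<in> \<int> \<or> (t + u) / 2 \<in> \<int>"
  proof (rule order_antisym)
    have "(u - t) / 2 \<in> \<int> \<or> (u + t) / 2 \<in> \<int>"
      using * Ints_minus[of "(t - u) / 2"] by (auto simp: add.commute minus_divide_left)
    then show "infdist u E \<le> infdist t E"
      by (rule le)
  qed (rule le[OF *])
  have "0 \<in> E"
    by (auto simp: E_def image_iff)
  then show "infdist 0 E = 0"
    by simp
  have "1 \<le> dist 1 e" if e: "e \<in> E" for e
  proof -
    obtain k :: int where k: "e = 2 * of_int k"
      using e by (auto simp: E_def)
    have "1 \<le> \<bar>1 - 2 * k\<bar>"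
      by presburger
    then have "1 \<le> real_of_int \<bar>1 - 2 * k\<bar>"
      by linarith
    then show ?thesis
      by (simp add: k dist_real_def)
  qed
  then have "1 \<le> infdist 1 E"
    unfolding infdist_notempty[OF ne] using ne by (intro cINF_greatest)
  moreover have "infdist 1 E \<le> 1"
    using infdist_le[OF \<open>0 \<in> E\<close>, of 1] by simp
  ultimately show "infdist 1 E = 1"
    by simp
qed

text \<open>The interface between analysis and geometry: what is needed of h after \<open>wp\<close>
  is that it is an open quotient map onto a Hausdorff space with these fibres.\<close>

locale pillow =
  fixes X :: "'a topology" and P :: "real ^ 2 \<Rightarrow> 'a"
  assumes Hausdorff: "Hausdorff_space X"
    and P_cont: "continuous_map euclidean X P" and P_open: "open_map euclidean X P"
    and P_surj: "range P = topspace X"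
    and P_eq_iff: "P x = P y \<longleftrightarrow> x - y \<in> two_Z2 \<or> x + y \<in> two_Z2"
begin

lemma P_eq_component:
  assumes "P x = P y"
  shows "(x $ i - y $ i) / 2 \<in> \<int> \<or> (x $ i + y $ i) / 2 \<in> \<int>"
  using assms by (auto simp: P_eq_iff two_Z2_component)

lemma P_eq_cases:
  assumes "P x = P y"
  obtains s l where "s = 1 \<or> s = - 1" "l \<in> two_Z2" "y = s *\<^sub>R x + l"
proof (cases "x - y \<in> two_Z2")
  case True
  then show ?thesis
    using that[of 1 "y - x"] two_Z2_minus[of "x - y"] by simp
next
  case False
  then have "x + y \<in> two_Z2"
    using assms by (simp add: P_eq_iff)
  then show ?thesis
    using that[of "- 1" "x + y"] by simp
qed

lemma P_signed_translate:
  assumes "s = 1 \<or> s = - 1" "l \<in> two_Z2"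
  shows "P (s *\<^sub>R x + l) = P x"
  using assms by (auto simp: P_eq_iff)

lemma P_square_side:
  assumes "x $ i = of_int m"
  shows "P x \<in> P ` square_side i (of_int (m mod 2))"
proof -
  obtain j where j: "j \<noteq> i" "\<And>k. k = i \<or> k = j"
    using other_index by metis
  obtain s :: real and k :: int where sk: "s = 1 \<or> s = - 1" "0 \<le> s * x $ j + 2 * of_int k" "s * x $ j + 2 * of_int k \<le> 1"
    using fold_to_unit_interval by metis
  \<comment> \<open>The sign chosen to fold coordinate j also acts on coordinate i. As m and -m
    agree modulo 2, an even translation still brings coordinate i to \<open>m mod 2\<close>.\<close>
  define l :: "real ^ 2" where "l = (\<chi> n. if n = i then of_int (m mod 2) - s * of_int m else 2 * of_int k)"
  have "l \<in> two_Z2"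
    unfolding two_Z2_component
  proof
    fix n
    have "(of_int (m mod 2) - s * of_int m) / 2 = (of_int (if s = 1 then - (m div 2) else m - m div 2) :: real)"
    proof -
      have "m mod 2 = m - 2 * (m div 2)"
        by (rule minus_mult_div_eq_mod[symmetric])
      then have "real_of_int (m mod 2) = of_int m - 2 * of_int (m div 2)"
        by (simp only: of_int_diff of_int_mult of_int_numeral)
      then show ?thesis
        using sk(1) by auto
    qed
    then have "(of_int (m mod 2) - s * of_int m) / 2 \<in> \<int>"
      by (metis Ints_of_int)
    then show "l $ n / 2 \<in> \<int>"
      by (simp add: l_def)
  qed
  then have "P (s *\<^sub>R x + l) = P x"
    using sk(1) by (intro P_signed_translate)
  moreover have "s *\<^sub>R x + l \<in> square_side i (of_int (m mod 2))"
  proof -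
    have "(s *\<^sub>R x + l) $ i = of_int (m mod 2)"
      using assms by (simp add: l_def)
    moreover have "(s *\<^sub>R x + l) $ j = s * x $ j + 2 * of_int k"
      using j(1) by (simp add: l_def)
    moreover have "0 \<le> real_of_int (m mod 2)" "real_of_int (m mod 2) \<le> 1"
      by simp_all
    ultimately have "0 \<le> (s *\<^sub>R x + l) $ n \<and> (s *\<^sub>R x + l) $ n \<le> 1" for n
      using sk(2,3) j(2)[of n] by auto
    then show ?thesis
      using \<open>(s *\<^sub>R x + l) $ i = _\<close> by (simp add: square_side_def mem_unit_square)
  qed
  ultimately show ?thesis
    by (metis imageI)
qed

lemma P_mem_Z2_iff: "P x \<in> P ` Z2 \<longleftrightarrow> x \<in> Z2"
proof
  assume "P x \<in> P ` Z2"
  then obtain y where y: "P y = P x" "y \<in> Z2"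
    by force
  obtain s l where sl: "s = 1 \<or> s = - 1" "l \<in> two_Z2" "x = s *\<^sub>R y + l"
    using y(1) by (rule P_eq_cases)
  have "2 * (l $ i / 2) \<in> \<int>" for i
    using sl(2) by (intro Ints_mult) (auto simp: two_Z2_component)
  then have "l $ i \<in> \<int>" for i
    by simp
  then show "x \<in> Z2"
    using sl y(2) by (auto simp: Z2_def)
qed auto

text \<open>For two numbers in [0, 1], an even difference is 0 and an even sum is 0 or 2; in each
  case the numbers are equal. This works separately in each coordinate.\<close>

lemma P_inj_on_unit_square: "inj_on P (cbox 0 1)"
proof (rule inj_onI)
  fix x y :: "real ^ 2" assume xy: "x \<in> cbox 0 1" "y \<in> cbox 0 1" "P x = P y"
  have "x $ i = y $ i" for i
  proof -
    have bounds: "0 \<le> x $ i" "x $ i \<le> 1" "0 \<le> y $ i" "y $ i \<le> 1"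
      using xy by (auto simp: mem_unit_square)
    from P_eq_component[OF xy(3), of i] show ?thesis
    proof
      assume "(x $ i - y $ i) / 2 \<in> \<int>"
      then obtain k :: int where k: "x $ i - y $ i = 2 * of_int k"
        by (auto simp: Ints_def field_simps)
      then have "2 * \<bar>real_of_int k\<bar> \<le> 1"
        using bounds by linarith
      then have "k = 0"
        by linarith
      then show ?thesis
        using k by simp
    next
      assume "(x $ i + y $ i) / 2 \<in> \<int>"
      then obtain k :: int where k: "x $ i + y $ i = 2 * of_int k"
        by (auto simp: Ints_def field_simps)
      then have "k = 0 \<or> k = 1"
        using bounds by linarith
      then show ?thesis
        using k bounds by auto
    qed
  qed
  then show "x = y"
    by (simp add: vec_eq_iff)
qed

text \<open>Integrality of a coordinate survives the sign and the even translation, and conversely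
  every line of the integer grid folds onto a side.\<close>

lemma P_mem_curve_iff: "P x \<in> P ` frontier (cbox 0 1) \<longleftrightarrow> (\<exists>i. x $ i \<in> \<int>)"
proof
  assume "P x \<in> P ` frontier (cbox 0 1)"
  then obtain y i where y: "P x = P y" "y $ i = 0 \<or> y $ i = 1"
    by (auto simp: frontier_unit_square square_side_def)
  then have "y $ i \<in> \<int>"
    by auto
  have "(x $ i - y $ i) / 2 \<in> \<int> \<or> (x $ i + y $ i) / 2 \<in> \<int>"
    using y(1) by (rule P_eq_component)
  then have "x $ i - y $ i \<in> \<int> \<or> x $ i + y $ i \<in> \<int>"
    by (metis Ints_mult Ints_numeral nonzero_mult_div_cancel_left times_divide_eq_right zero_neq_numeral)
  then have "x $ i \<in> \<int>"
    using \<open>y $ i \<in> \<int>\<close> by (metis Ints_add Ints_diff add_diff_cancel_right' diff_add_cancel)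
  then show "\<exists>i. x $ i \<in> \<int>" ..
next
  assume "\<exists>i. x $ i \<in> \<int>"
  then obtain i m where m: "x $ i = of_int m"
    by (auto simp: Ints_def)
  then have "P x \<in> P ` square_side i (of_int (m mod 2))"
    by (rule P_square_side)
  moreover have "real_of_int (m mod 2) = 0 \<or> real_of_int (m mod 2) = 1"
    by (cases "even m") (auto simp: odd_iff_mod_2_eq_one)
  then have "square_side i (of_int (m mod 2)) \<subseteq> frontier (cbox 0 1)"
    unfolding frontier_unit_square by auto
  ultimately show "P x \<in> P ` frontier (cbox 0 1)"
    by blast
qed

lemma closedin_P_image: "compact S \<Longrightarrow> closedin X (P ` S)"
  using image_compactin[OF _ P_cont, of S] Hausdorff by (simp add: compactin_imp_closedin)

lemma compact_square_side: "compact (square_side i c)"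
proof -
  have "square_side i c = cbox 0 1 \<inter> {x. x $ i = c}"
    by (auto simp: square_side_def)
  moreover have "closed {x :: real ^ 2. x $ i = c}"
    by (intro closed_Collect_eq continuous_intros)
  ultimately show ?thesis
    using compact_Int_closed[OF compact_cbox] by metis
qed

section \<open>The 0-edges as images of the sides of the square\<close>

definition open_side :: "2 \<Rightarrow> real \<Rightarrow> (real ^ 2) set" where
  "open_side i c = square_side i c - Z2"

lemma open_side_iff:
  assumes "c \<in> {0, 1}"
  shows "x \<in> open_side i c \<longleftrightarrow> x $ i = c \<and> (\<forall>j. j \<noteq> i \<longrightarrow> 0 < x $ j \<and> x $ j < 1)"
proof -
  obtain j where j: "j \<noteq> i" "\<And>k. k = i \<or> k = j"
    using other_index by metis
  have all: "(\<forall>k. Q k) \<longleftrightarrow> Q i \<and> Q j" for Q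
    using j(2) by metis
  have int: "t \<in> \<int> \<longleftrightarrow> t = 0 \<or> t = 1" if "0 \<le> t" "t \<le> 1" for t :: real
    using that by (auto simp: Ints_def)
  show ?thesis
    using assms j(1) by (auto simp: open_side_def square_side_def Z2_def mem_unit_square all int)
qed

lemma convex_open_side:
  assumes "c \<in> {0, 1}"
  shows "convex (open_side i c)"
proof -
  show ?thesis
    unfolding convex_def
  proof (intro ballI allI impI)
    fix x y :: "real ^ 2" and u v :: real
    assume xy: "x \<in> open_side i c" "y \<in> open_side i c" and uv: "0 \<le> u" "0 \<le> v" "u + v = 1"
    have "u * x $ j + v * y $ j \<in> {0<..<1}" if "j \<noteq> i" for j
      using convexD[OF convex_real_interval(8) _ _ uv, of "x $ j" 0 1 "y $ j"] xy that
      by (simp add: open_side_iff[OF assms])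
    moreover have "u * c + v * c = c"
      using uv(3) by (simp flip: distrib_right)
    ultimately show "u *\<^sub>R x + v *\<^sub>R y \<in> open_side i c"
      using xy by (simp add: open_side_iff[OF assms])
  qed
qed

lemma closure_open_side:
  assumes "c \<in> {0, 1}"
  shows "closure (open_side i c) = square_side i c"
proof (rule closure_eqI_segment)
  show "closed (square_side i c)"
    using compact_square_side by (rule compact_imp_closed)
  show "open_side i c \<subseteq> square_side i c"
    by (auto simp: open_side_def)
  define m :: "real ^ 2" where "m = (\<chi> k. if k = i then c else 1 / 2)"
  show "m \<in> open_side i c"
    by (simp add: open_side_iff[OF assms] m_def)
  fix x assume x: "x \<in> square_side i c"
  show "open_segment x m \<subseteq> open_side i c"
  proof
    fix y assume "y \<in> open_segment x m"
    then obtain u where u: "0 < u" "u < 1" "y = (1 - u) *\<^sub>R x + u *\<^sub>R m"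
      by (auto simp: in_segment)
    have x': "x $ i = c" "0 \<le> x $ k" "x $ k \<le> 1" for k
      using x by (auto simp: square_side_def mem_unit_square)
    have "y $ i = (1 - u) * c + u * c"
      using x'(1) by (simp add: u(3) m_def)
    then have "y $ i = c"
      by (simp flip: distrib_right)
    moreover have "0 < y $ j \<and> y $ j < 1" if "j \<noteq> i" for j
    proof -
      have "y $ j = (1 - u) * x $ j + u / 2"
        using that by (simp add: u m_def)
      moreover have "0 \<le> (1 - u) * x $ j" "(1 - u) * x $ j \<le> 1 - u"
        using x'(2,3)[of j] u by (auto intro!: mult_left_le)
      ultimately have "0 < y $ j" "y $ j < 1"
        using u(1,2) by linarith+
      then show ?thesis ..
    qed
    ultimately show "y \<in> open_side i c"
      by (simp add: open_side_iff[OF assms])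
  qed
qed

lemma square_side_Int_imp_eq:
  assumes "x \<in> open_side i c" "x \<in> square_side i' c'" and "c \<in> {0, 1}" "c' \<in> {0, 1}"
  shows "i' = i \<and> c' = c"
  using assms by (auto simp: open_side_iff square_side_def)

text \<open>Injectivity on the square makes the image of an open side the complement, within the
  punctured curve, of the images of the other three closed sides. Those are compact, so the image is
  relatively open.\<close>

lemma components_of_punctured_curve:
  "connected_components_of (subtopology X (P ` frontier (cbox 0 1) - P ` Z2)) =
     (\<lambda>(i, c). P ` open_side i c) ` (UNIV \<times> {0, 1})"
proof (rule connected_components_of_eqI)
  let ?Y = "P ` frontier (cbox 0 1) - P ` Z2" and ?I = "UNIV \<times> {0, 1} :: (2 \<times> real) set"
  have Y: "?Y = (\<Union>(i, c)\<in>?I. P ` open_side i c)"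
  proof
    show "?Y \<subseteq> (\<Union>(i, c)\<in>?I. P ` open_side i c)"
    proof
      fix p assume "p \<in> ?Y"
      then obtain x where x: "p = P x" "x \<in> frontier (cbox 0 1)" "x \<notin> Z2"
        by auto
      then obtain i c where "c \<in> {0, 1}" "x \<in> square_side i c"
        by (auto simp: frontier_unit_square)
      then show "p \<in> (\<Union>(i, c)\<in>?I. P ` open_side i c)"
        using x by (intro UN_I[of "(i, c)"]) (auto simp: open_side_def)
    qed
    show "(\<Union>(i, c)\<in>?I. P ` open_side i c) \<subseteq> ?Y"
      using P_mem_Z2_iff by (auto simp: open_side_def frontier_unit_square)
  qed
  have "?Y \<subseteq> topspace X"
    using P_surj by blast
  then have top: "topspace (subtopology X ?Y) = ?Y"
    by (rule topspace_subtopology_subset)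
  show "\<Union>((\<lambda>(i, c). P ` open_side i c) ` ?I) = topspace (subtopology X ?Y)"
    unfolding top unfolding Y by auto
  fix U assume "U \<in> (\<lambda>(i, c). P ` open_side i c) ` ?I"
  then obtain i c where U: "U = P ` open_side i c" and c: "c \<in> {0, 1}"
    by auto
  have U_sub: "U \<subseteq> ?Y"
    unfolding Y U using c by (intro UN_upper[of "(i, c)", THEN order.trans[rotated]]) auto
  let ?K = "\<Union>(i', c')\<in>?I - {(i, c)}. P ` square_side i' c'"
  have "U = ?Y - ?K"
  proof
    have "P x \<notin> P ` square_side i' c'" if x: "x \<in> open_side i c" and ne: "(i', c') \<in> ?I - {(i, c)}" for x i' c'
    proof
      assume "P x \<in> P ` square_side i' c'"
      then obtain y where y: "P x = P y" "y \<in> square_side i' c'"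
        by auto
      then have "x = y"
        using x inj_onD[OF P_inj_on_unit_square, of x y] by (auto simp: open_side_def square_side_def)
      then show False
        using square_side_Int_imp_eq[OF x, of i' c'] y c ne by auto
    qed
    then have "U \<inter> ?K = {}"
      unfolding U by fast
    then show "U \<subseteq> ?Y - ?K"
      using U_sub by blast
    show "?Y - ?K \<subseteq> U"
    proof
      fix p assume p: "p \<in> ?Y - ?K"
      then obtain i' c' x where x: "c' \<in> {0, 1}" "x \<in> open_side i' c'" "p = P x"
        unfolding Y by auto
      then have "p \<in> P ` square_side i' c'"
        by (auto simp: open_side_def)
      then have "(i', c') = (i, c)"
        using p x(1) by auto
      then show "p \<in> U"
        using x U by auto
    qed
  qed
  then have U_eq: "U = ?Y \<inter> (topspace X - ?K)"
    using \<open>?Y \<subseteq> topspace X\<close> by blast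
  have "closedin X ?K"
    by (intro closedin_Union) (auto simp: closedin_P_image compact_square_side)
  then show "openin (subtopology X ?Y) U"
    unfolding U_eq by (intro openin_subtopology_Int2 openin_diff) auto
  have "connectedin X U"
    unfolding U using convex_connected[OF convex_open_side[OF c]]
    by (intro connectedin_continuous_map_image[OF P_cont]) simp
  then show "connectedin (subtopology X ?Y) U"
    using U_sub by (simp add: connectedin_subtopology)
  show "U \<noteq> {}"
  proof -
    have "closure (open_side i c) \<noteq> {}"
    proof -
      have "(\<chi> k. c) \<in> square_side i c"
        using c by (auto simp: square_side_def mem_unit_square)
      then show ?thesis
        unfolding closure_open_side[OF c] by blast
    qed
    then show ?thesis
      unfolding U by auto
  qed
next
  show "pairwise disjnt ((\<lambda>(i, c). P ` open_side i c) ` (UNIV \<times> {0, 1 :: real}))"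
  proof (rule pairwiseI)
    fix U U' assume "U \<in> (\<lambda>(i, c). P ` open_side i c) ` (UNIV \<times> {0, 1 :: real})"
      and "U' \<in> (\<lambda>(i, c). P ` open_side i c) ` (UNIV \<times> {0, 1 :: real})" and ne: "U \<noteq> U'"
    obtain i c where U: "U = P ` open_side i c" "c \<in> {0, 1}"
      using \<open>U \<in> _\<close> by auto
    obtain i' c' where U': "U' = P ` open_side i' c'" "c' \<in> {0, 1}"
      using \<open>U' \<in> _\<close> by auto
    show "disjnt U U'"
    proof (rule ccontr)
      assume "\<not> disjnt U U'"
      then obtain x y where xy: "x \<in> open_side i c" "y \<in> open_side i' c'" "P x = P y"
        unfolding U(1) U'(1) disjnt_def by blast
      then have "x = y"
        using inj_onD[OF P_inj_on_unit_square, of x y] by (auto simp: open_side_def square_side_def)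
      then have "i' = i \<and> c' = c"
        using xy U U' by (intro square_side_Int_imp_eq[of x]) (auto simp: open_side_def)
      then show False
        using ne U U' by simp
    qed
  qed
qed

lemma zero_edges_eq:
  assumes "post X \<O> f = P ` Z2"
  shows "zero_edges X \<O> f (P ` frontier (cbox 0 1)) = (\<lambda>(i, c). P ` square_side i c) ` (UNIV \<times> {0, 1})"
proof -
  have "X closure_of (P ` open_side i c) = P ` square_side i c" if "c \<in> {0, 1}" for i c
    using closure_of_image[OF Hausdorff P_cont, of "open_side i c"] compact_square_side
    by (simp add: closure_open_side[OF that])
  then show ?thesis
    unfolding zero_edges_def assms components_of_punctured_curve image_image
    by (intro image_cong) auto
qed

lemma square_sides_disjoint_iff:
  assumes "c \<in> {0, 1}" "c' \<in> {0, 1}"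
  shows "P ` square_side i c \<inter> P ` square_side i' c' = {} \<longleftrightarrow> i = i' \<and> c \<noteq> c'"
proof
  assume disj: "P ` square_side i c \<inter> P ` square_side i' c' = {}"
  show "i = i' \<and> c \<noteq> c'"
  proof (rule ccontr)
    assume *: "\<not> (i = i' \<and> c \<noteq> c')"
    \<comment> \<open>A corner of the square that lies on both sides.\<close>
    define x :: "real ^ 2" where "x = (\<chi> k. if k = i then c else c')"
    have "x \<in> square_side i c" "x \<in> square_side i' c'"
      using assms * by (auto simp: square_side_def mem_unit_square x_def)
    then show False
      using disj by blast
  qed
next
  assume *: "i = i' \<and> c \<noteq> c'"
  show "P ` square_side i c \<inter> P ` square_side i' c' = {}"
  proof (rule ccontr)
    assume "P ` square_side i c \<inter> P ` square_side i' c' \<noteq> {}"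
    then obtain x y where xy: "x \<in> square_side i c" "y \<in> square_side i' c'" "P x = P y"
      by auto
    then have "x = y"
      using inj_onD[OF P_inj_on_unit_square, of x y] by (auto simp: square_side_def)
    then show False
      using xy * by (auto simp: square_side_def)
  qed
qed

text \<open>Reduction modulo 2 leaves four representatives. The bound meets the four postcritical
  points counted by the orbifold type.\<close>

lemma card_P_Z2: "finite (P ` Z2)" "card (P ` Z2) \<le> 4"
proof -
  let ?Q = "(\<lambda>(s, t). P (vector [s, t])) ` ({0, 1} \<times> {0, 1} :: (real \<times> real) set)"
  have "P ` Z2 \<subseteq> ?Q"
  proof
    fix p assume "p \<in> P ` Z2"
    then obtain x where x: "p = P x" "x \<in> Z2"
      by blast
    then obtain k l :: int where kl: "x $ 1 = of_int k" "x $ 2 = of_int l"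
      unfolding Z2_def by (metis (mono_tags, lifting) Ints_cases mem_Collect_eq)
    let ?y = "vector [of_int (k mod 2), of_int (l mod 2)] :: real ^ 2"
    have "x - ?y \<in> two_Z2"
      unfolding two_Z2_iff
    proof (intro exI conjI)
      have "k - k mod 2 = 2 * (k div 2)" "l - l mod 2 = 2 * (l div 2)"
        by (simp_all add: minus_mod_eq_mult_div)
      then show "(x - ?y) $ 1 = 2 * of_int (k div 2)" "(x - ?y) $ 2 = 2 * of_int (l div 2)"
        unfolding vector_minus_component kl vector_2 by (metis of_int_diff of_int_mult of_int_numeral)+
    qed
    then have "p = P ?y"
      unfolding x(1) P_eq_iff by simp
    moreover have "real_of_int (j mod 2) \<in> {0, 1}" for j
      by (cases "even j") (auto simp: odd_iff_mod_2_eq_one)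
    ultimately show "p \<in> ?Q"
      by (intro image_eqI[of _ _ "(of_int (k mod 2), of_int (l mod 2))"]) auto
  qed
  moreover have "finite ?Q"
    by simp
  ultimately have "card (P ` Z2) \<le> card ?Q"
    by (intro card_mono)
  also have "\<dots> \<le> card ({0, 1} \<times> {0, 1} :: (real \<times> real) set)"
    by (rule card_image_le) simp
  finally show "card (P ` Z2) \<le> 4"
    by (simp add: card_cartesian_product)
  show "finite (P ` Z2)"
    using \<open>P ` Z2 \<subseteq> ?Q\<close> \<open>finite ?Q\<close> by (rule finite_subset)
qed

text \<open>The distance is independent of the chosen preimage, and continuity descends because
  \<open>P\<close> is a quotient map.\<close>

lemma fold_coordinate:
  obtains \<phi> :: "'a \<Rightarrow> real" where "continuous_map X euclidean \<phi>"
    "\<And>x. \<phi> (P x) = infdist (x $ i) (range (\<lambda>k :: int. 2 * real_of_int k))"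
proof -
  let ?h = "\<lambda>x. infdist (x $ i) (range (\<lambda>k :: int. 2 * real_of_int k))"
  define \<phi> where "\<phi> p = ?h (SOME x. P x = p)" for p
  have \<phi>: "\<phi> (P x) = ?h x" for x
  proof -
    have "P (SOME y. P y = P x) = P x"
      by (rule someI) (rule refl)
    then show ?thesis
      unfolding \<phi>_def by (intro infdist_even_integers(2) P_eq_component)
  qed
  have "quotient_map euclidean X P"
    using P_cont P_open P_surj by (intro continuous_open_imp_quotient_map) auto
  moreover have "continuous_map euclidean euclidean (\<phi> \<circ> P)"
    by (auto simp: o_def \<phi> intro!: continuous_intros)
  ultimately have "continuous_map X euclidean \<phi>"
    using continuous_compose_quotient_map_eq by blast
  with \<phi> that show ?thesis
    by blast
qed

end

text \<open>It is interpreted twice: with F = f, to find the postcritical set, and with F the n-th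
  iterate of f, to describe the n-tiles.\<close>

locale pillow_tiling = pillow X P
  for X :: "'a topology" and P :: "real ^ 2 \<Rightarrow> 'a" +
  fixes F :: "'a \<Rightarrow> 'a" and B Bi :: "real ^ 2 \<Rightarrow> real ^ 2" and b :: "real ^ 2"
  assumes lin_B: "linear B" and lin_Bi: "linear Bi"
    and B_Bi: "B (Bi x) = x" and Bi_B: "Bi (B x) = x"
    and b_Z2: "b \<in> Z2"
    and F_P: "F (P x) = P (B x + b)"
begin

definition T :: "real ^ 2 \<Rightarrow> real ^ 2" where "T x = B x + b"
definition R :: "real ^ 2 \<Rightarrow> real ^ 2" where "R x = Bi (x - b)"

lemma T_R [simp]: "T (R x) = x" and R_T [simp]: "R (T x) = x"
  by (simp_all add: T_def R_def B_Bi Bi_B)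

lemma continuous_on_T: "continuous_on S T" and continuous_on_R: "continuous_on S R"
proof -
  have "continuous_on UNIV B" "continuous_on UNIV Bi"
    using lin_B lin_Bi by (simp_all add: linear_continuous_on linear_conv_bounded_linear)
  then have *: "continuous_on A B" "continuous_on A Bi" for A
    by (auto intro: continuous_on_subset)
  show "continuous_on S T"
    unfolding T_def by (intro continuous_intros *)
  show "continuous_on S R"
    unfolding R_def by (intro continuous_intros continuous_on_compose2[OF *(2)[of UNIV]]) auto
qed

lemma continuous_map_P_R: "continuous_map euclidean X (\<lambda>x. P (R x))"
  using continuous_map_compose[OF _ P_cont, of euclidean R] continuous_on_R[of UNIV] by (simp add: o_def)

lemma R_image_eq: "R ` S = T -` S"
proof
  show "T -` S \<subseteq> R ` S"
    by (metis R_T image_eqI subsetI vimageD)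
qed auto

abbreviation unit_cell :: "real ^ 2 \<Rightarrow> (real ^ 2) set" where
  "unit_cell m \<equiv> cbox m (m + 1)"

lemma mem_open_cell: "x \<in> box m (m + 1) \<longleftrightarrow> (\<forall>i. m $ i < x $ i \<and> x $ i < m $ i + 1)" for m :: "real ^ 2"
  by (simp add: mem_box_cart)

lemma mem_unit_cell: "x \<in> unit_cell m \<longleftrightarrow> (\<forall>i. m $ i \<le> x $ i \<and> x $ i \<le> m $ i + 1)"
  by (simp add: mem_box_cart)

lemma open_cell_nonempty: "box m (m + 1) \<noteq> ({} :: (real ^ 2) set)"
proof -
  have "(\<chi> i. m $ i + 1 / 2) \<in> box m (m + 1)"
    by (simp add: mem_open_cell)
  then show ?thesis
    by blast
qed

lemma closure_open_cell: "closure (box m (m + 1)) = unit_cell m"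
  using open_cell_nonempty by (rule closure_box)

text \<open>A symmetry of the fibres of \<open>P\<close>, conjugated by \<open>T\<close>, becomes
  \<open>s *\<^sub>R u + l\<close>. That \<open>l\<close> is in the lattice is seen on the sphere:
  \<open>R l\<close> and \<open>R 0\<close> have the same image under \<open>P\<close>, and applying
  \<open>F\<close> gives \<open>P l = P 0\<close>.\<close>

lemma fibre_symmetry:
  assumes "P x = P y"
  obtains s l where "s = 1 \<or> s = - 1" "l \<in> two_Z2" "T y = s *\<^sub>R T x + l"
    "\<forall>u. P (R (s *\<^sub>R u + l)) = P (R u)"
proof -
  obtain s l0 where s: "s = 1 \<or> s = - 1" and l0: "l0 \<in> two_Z2" "y = s *\<^sub>R x + l0"
    using assms by (metis P_eq_cases)
  define l where "l = B l0 + b - s *\<^sub>R b"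
  have T: "T (s *\<^sub>R u + l0) = s *\<^sub>R T u + l" for u
    using lin_B by (simp add: T_def l_def linear_add linear_cmul algebra_simps)
  have sym: "P (R (s *\<^sub>R u + l)) = P (R u)" for u
  proof -
    have "R (s *\<^sub>R u + l) = s *\<^sub>R R u + l0"
      using T[of "R u"] by (metis R_T T_R)
    then show ?thesis
      using P_signed_translate[OF s l0(1)] by simp
  qed
  have "P l = P (T (R (s *\<^sub>R 0 + l)))"
    by simp
  also have "\<dots> = P (T (R 0))"
    unfolding T_def using F_P sym by metis
  finally have "P l = P 0"
    by simp
  then have "l \<in> two_Z2"
    by (simp add: P_eq_iff)
  then show ?thesis
    using that[of s l] s T l0(2) sym by simp
qed

lemma open_cells_transport:
  assumes m: "m \<in> Z2" "m' \<in> Z2" and s: "s = 1 \<or> s = - 1" and l: "l \<in> two_Z2"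
    and u: "u \<in> box m (m + 1)" "s *\<^sub>R u + l \<in> box m' (m' + 1)" and v: "v \<in> box m (m + 1)"
  shows "s *\<^sub>R v + l \<in> box m' (m' + 1)"
  unfolding mem_open_cell
proof
  fix i
  obtain a a' c :: int where ints: "m $ i = of_int a" "m' $ i = of_int a'" "l $ i = of_int c"
  proof -
    obtain k :: int where "l $ i = 2 * of_int k"
      using l by (auto simp: two_Z2_def)
    then have "l $ i = of_int (2 * k)"
      by simp
    moreover have "m $ i \<in> \<int>" "m' $ i \<in> \<int>"
      using m by (auto simp: Z2_def)
    ultimately show thesis
      using that by (metis Ints_cases)
  qed
  have "m $ i < u $ i" "u $ i < m $ i + 1" "m $ i < v $ i" "v $ i < m $ i + 1"
    "m' $ i < (s *\<^sub>R u + l) $ i" "(s *\<^sub>R u + l) $ i < m' $ i + 1"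
    using u v unfolding mem_open_cell by blast+
  then have *: "of_int a < u $ i" "u $ i < of_int a + 1" "of_int a < v $ i" "v $ i < of_int a + 1"
    "of_int a' < s * u $ i + of_int c" "s * u $ i + of_int c < of_int a' + 1"
    by (simp_all add: ints)
  show "m' $ i < (s *\<^sub>R v + l) $ i \<and> (s *\<^sub>R v + l) $ i < m' $ i + 1"
    using s
  proof
    assume "s = 1"
    then have "a' = a + c"
      using * by (simp; linarith)
    then show ?thesis
      using * \<open>s = 1\<close> by (simp add: ints)
  next
    assume "s = - 1"
    \<comment> \<open>The reflection exchanges the ends of the interval (a, a + 1), so its lower end
      is now c - (a + 1).\<close>
    then have "a' = c - a - 1"
      using * by (simp; linarith)
    then show ?thesis
      using * \<open>s = - 1\<close> by (simp add: ints)
  qed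
qed

lemma open_tiles_overlap:
  assumes m: "m \<in> Z2" "m' \<in> Z2"
    and overlap: "P ` R ` box m (m + 1) \<inter> P ` R ` box m' (m' + 1) \<noteq> {}"
  shows "P ` R ` box m (m + 1) \<subseteq> P ` R ` box m' (m' + 1)"
proof -
  obtain u u' where u: "u \<in> box m (m + 1)" "u' \<in> box m' (m' + 1)" "P (R u) = P (R u')"
    using overlap by auto
  obtain s l where s: "s = 1 \<or> s = - 1" "l \<in> two_Z2" "T (R u') = s *\<^sub>R T (R u) + l"
    "\<forall>u. P (R (s *\<^sub>R u + l)) = P (R u)"
    using u(3) by (rule fibre_symmetry)
  have "P (R v) \<in> P ` R ` box m' (m' + 1)" if "v \<in> box m (m + 1)" for v
  proof -
    have "s *\<^sub>R v + l \<in> box m' (m' + 1)"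
      using open_cells_transport[OF m s(1,2) u(1) _ that] u(2) s(3) by simp
    then show ?thesis
      using s(4)[rule_format, of v] by (metis imageI)
  qed
  then show ?thesis
    by auto
qed

text \<open>A point avoids the preimage of the curve when no coordinate of \<open>T x\<close> is an
  integer, and the floors then name its open cell. Images of cells are open since \<open>P\<close>
  is, and two that meet coincide by the symmetry of the grid.\<close>

lemma components_off_preimage:
  "connected_components_of (subtopology X (topspace X - {p \<in> topspace X. F p \<in> P ` frontier (cbox 0 1)})) =
     (\<lambda>m. P ` R ` box m (m + 1)) ` Z2"
proof (rule connected_components_of_eqI)
  let ?Y = "topspace X - {p \<in> topspace X. F p \<in> P ` frontier (cbox 0 1)}"
  let ?t = "\<lambda>m. P ` R ` box m (m + 1)"
  have mem_Y: "P x \<in> ?Y \<longleftrightarrow> (\<forall>i. T x $ i \<notin> \<int>)" for x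
    using P_surj by (auto simp: F_P P_mem_curve_iff simp flip: T_def)
  have top: "topspace (subtopology X ?Y) = ?Y"
    by auto
  have t_sub: "?t m \<subseteq> ?Y" if m: "m \<in> Z2" for m
  proof -
    have "P (R u) \<in> ?Y" if u: "u \<in> box m (m + 1)" for u
      unfolding mem_Y T_R
    proof
      fix i
      obtain a :: int where "m $ i = of_int a"
        using m by (metis (mono_tags, lifting) Ints_cases Z2_def mem_Collect_eq)
      moreover have "m $ i < u $ i" "u $ i < m $ i + 1"
        using u unfolding mem_open_cell by blast+
      ultimately have "of_int a < u $ i" "u $ i < of_int (a + 1)"
        by simp_all
      then show "u $ i \<notin> \<int>"
        by (auto simp: Ints_def)
    qed
    then show ?thesis
      by blast
  qed
  have "?Y \<subseteq> \<Union>(?t ` Z2)"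
  proof
    fix p assume p: "p \<in> ?Y"
    then obtain x where x: "p = P x"
      using P_surj by blast
    define m :: "real ^ 2" where "m = (\<chi> i. of_int \<lfloor>T x $ i\<rfloor>)"
    have "m \<in> Z2"
      by (simp add: Z2_def m_def)
    have "T x \<in> box m (m + 1)"
      unfolding mem_open_cell
    proof
      fix i
      have "T x $ i \<notin> \<int>"
        using p unfolding x mem_Y by blast
      then have "T x $ i \<noteq> of_int \<lfloor>T x $ i\<rfloor>"
        by (metis Ints_of_int)
      then show "m $ i < T x $ i \<and> T x $ i < m $ i + 1"
        unfolding m_def by (simp; linarith)
    qed
    then have "p \<in> ?t m"
      unfolding R_image_eq x by blast
    then show "p \<in> \<Union>(?t ` Z2)"
      using \<open>m \<in> Z2\<close> by blast
  qed
  then show "\<Union>(?t ` Z2) = topspace (subtopology X ?Y)"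
    unfolding top using t_sub by blast
  fix U assume "U \<in> ?t ` Z2"
  then obtain m where m: "m \<in> Z2" "U = ?t m"
    by blast
  have "open (R ` box m (m + 1))"
    unfolding R_image_eq by (rule open_vimage[OF open_box continuous_on_T])
  then have "openin X U"
    using P_open m(2) by (simp add: open_map_def)
  then have "openin (subtopology X ?Y) (?Y \<inter> U)"
    by (rule openin_subtopology_Int2)
  then show "openin (subtopology X ?Y) U"
    using t_sub[OF m(1)] m(2) by (simp add: Int_absorb1)
  have "connected (box m (m + 1))"
    by (simp add: convex_connected)
  then have "connectedin X ((\<lambda>x. P (R x)) ` box m (m + 1))"
    by (intro connectedin_continuous_map_image[OF continuous_map_P_R]) simp
  then show "connectedin (subtopology X ?Y) U"
    using t_sub[OF m(1)] m(2) by (simp add: connectedin_subtopology image_image)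
  show "U \<noteq> {}"
    using m(2) open_cell_nonempty by simp
next
  show "pairwise disjnt ((\<lambda>m. P ` R ` box m (m + 1)) ` Z2)"
  proof (rule pairwiseI)
    fix U U' assume U: "U \<in> (\<lambda>m. P ` R ` box m (m + 1)) ` Z2" "U' \<in> (\<lambda>m. P ` R ` box m (m + 1)) ` Z2" "U \<noteq> U'"
    obtain m where m: "m \<in> Z2" "U = P ` R ` box m (m + 1)"
      using U(1) by blast
    obtain m' where m': "m' \<in> Z2" "U' = P ` R ` box m' (m' + 1)"
      using U(2) by blast
    show "disjnt U U'"
    proof (rule ccontr)
      assume "\<not> disjnt U U'"
      then have "U \<inter> U' \<noteq> {}" "U' \<inter> U \<noteq> {}"
        by (auto simp: disjnt_def)
      then have "U \<subseteq> U'" "U' \<subseteq> U"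
        unfolding m(2) m'(2) using open_tiles_overlap m(1) m'(1) by blast+
      then show False
        using U(3) by blast
    qed
  qed
qed

lemma tiles_eq:
  assumes "F = f ^^ n"
  shows "tiles X f (P ` frontier (cbox 0 1)) n = (\<lambda>m. P ` R ` unit_cell m) ` Z2"
proof -
  have "X closure_of (P ` R ` box m (m + 1)) = P ` R ` unit_cell m" for m
    using closure_of_image[OF Hausdorff continuous_map_P_R, of "box m (m + 1)"]
    by (simp add: closure_open_cell image_image)
  then show ?thesis
    unfolding tiles_def assms[symmetric] components_off_preimage image_image by simp
qed

section \<open>The two bounds for the number of tiles\<close>

lemma R_cell_diameter:
  assumes "x \<in> unit_cell m" "y \<in> unit_cell m"
  shows "\<bar>R x $ i - R y $ i\<bar> \<le> infnorm_op Bi"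
proof -
  obtain i' v where *: "\<forall>k. \<bar>v $ k\<bar> = 1" "Bi v $ i' = infnorm_op Bi"
    "\<forall>u j. \<bar>Bi u $ j\<bar> \<le> infnorm_op Bi * infnorm u"
    by (rule infnorm_op_attained[OF lin_Bi])
  have "infnorm v = 1"
    by (simp add: infnorm_2 *)
  then have "0 \<le> infnorm_op Bi"
    using *(3)[rule_format, of v i'] by simp
  have "R x - R y = Bi (x - y)"
    unfolding R_def by (simp add: linear_diff[OF lin_Bi, symmetric])
  then have "\<bar>R x $ i - R y $ i\<bar> \<le> infnorm_op Bi * infnorm (x - y)"
    using *(3) by (metis vector_minus_component)
  also have "infnorm (x - y) \<le> 1"
    using assms by (auto simp: infnorm_2 mem_unit_cell abs_le_iff) (smt (verit))+
  then have "infnorm_op Bi * infnorm (x - y) \<le> infnorm_op Bi * 1"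
    using \<open>0 \<le> infnorm_op Bi\<close> by (intro mult_left_mono)
  finally show ?thesis
    by simp
qed

lemma connecting_tiles_lower_bound:
  assumes post: "post X \<O> f = P ` Z2" and F: "F = f ^^ n"
    and t: "\<forall>j\<in>{1..N}. t j \<in> tiles X f (P ` frontier (cbox 0 1)) n"
    and conn: "connectedin X (\<Union>j\<in>{1..N}. t j)"
    and join: "joins_opposite_sides X \<O> f (P ` frontier (cbox 0 1)) (\<Union>j\<in>{1..N}. t j)"
  shows "1 \<le> real N * infnorm_op Bi"
proof -
  let ?K = "\<Union>j\<in>{1..N}. t j"
  obtain i c i' c' where ic: "c \<in> {0, 1 :: real}" "c' \<in> {0, 1 :: real}"
    and disj: "P ` square_side i c \<inter> P ` square_side i' c' = {}"
    and meet: "?K \<inter> P ` square_side i c \<noteq> {}" "?K \<inter> P ` square_side i' c' \<noteq> {}"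
  proof -
    obtain E E' where E: "E \<in> (\<lambda>(i, c). P ` square_side i c) ` (UNIV \<times> {0, 1})"
      "E' \<in> (\<lambda>(i, c). P ` square_side i c) ` (UNIV \<times> {0, 1})" "E \<inter> E' = {}" "?K \<inter> E \<noteq> {}" "?K \<inter> E' \<noteq> {}"
      using join unfolding joins_opposite_sides_def zero_edges_eq[OF post] by blast
    obtain i c where ic: "c \<in> {0, 1}" "E = P ` square_side i c"
      using E(1) by auto
    obtain i' c' where ic': "c' \<in> {0, 1}" "E' = P ` square_side i' c'"
      using E(2) by auto
    show thesis
      using that[OF ic(1) ic'(1)] E(3-5) unfolding ic(2) ic'(2) by blast
  qed
  have i: "i' = i" "c \<noteq> c'"
    using disj ic by (auto simp: square_sides_disjoint_iff)
  obtain \<phi> where \<phi>: "continuous_map X euclidean \<phi>"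
    "\<And>x. \<phi> (P x) = infdist (x $ i) (range (\<lambda>k :: int. 2 * real_of_int k))"
    using fold_coordinate by metis
  have \<phi>_side: "\<phi> (P x) = d" if "x \<in> square_side i d" "d \<in> {0, 1}" for x d
    using that infdist_even_integers(3,4) by (auto simp: \<phi>(2) square_side_def)
  have "c \<in> \<phi> ` ?K" "c' \<in> \<phi> ` ?K"
    using meet \<phi>_side ic unfolding i(1) by (force simp: image_iff)+
  then have "0 \<in> \<phi> ` ?K" "1 \<in> \<phi> ` ?K"
    using ic i(2) by auto
  moreover have "connected (\<phi> ` ?K)"
    using connectedin_continuous_map_image[OF \<phi>(1) conn] by simp
  ultimately have "{0..1} \<subseteq> \<phi> ` ?K"
    by (intro connected_contains_Icc)
  then have "1 \<le> real (card {1..N}) * infnorm_op Bi"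
  proof (intro unit_interval_cover)
    show "{0..1} \<subseteq> (\<Union>j\<in>{1..N}. \<phi> ` t j)" if "{0..1} \<subseteq> \<phi> ` ?K"
      using that by (simp add: image_UN)
    fix j x y assume j: "j \<in> {1..N}" and xy: "x \<in> \<phi> ` t j" "y \<in> \<phi> ` t j"
    obtain m where "t j = P ` R ` unit_cell m"
      using t j unfolding tiles_eq[OF F] by blast
    then obtain u v where uv: "u \<in> unit_cell m" "x = \<phi> (P (R u))" "v \<in> unit_cell m" "y = \<phi> (P (R v))"
      using xy by auto
    have "\<bar>x - y\<bar> \<le> \<bar>R u $ i - R v $ i\<bar>"
      unfolding uv \<phi>(2) by (rule infdist_even_integers(1))
    then show "\<bar>x - y\<bar> \<le> infnorm_op Bi"
      using R_cell_diameter[OF uv(1,3), of i] by linarith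
  qed auto
  then show ?thesis
    by simp
qed

lemma infnorm_op_Bi_pos: "infnorm_op Bi > 0"
proof -
  have *: "\<forall>u j. \<bar>Bi u $ j\<bar> \<le> infnorm_op Bi * infnorm u"
    by (rule infnorm_op_attained[OF lin_Bi])
  have "Bi 1 \<noteq> 0"
    using B_Bi[of 1] linear_0[OF lin_B] by (metis zero_neq_one)
  then obtain j where "Bi 1 $ j \<noteq> 0"
    by (auto simp: vec_eq_iff)
  then have "0 < infnorm_op Bi * infnorm (1 :: real ^ 2)"
    using *[rule_format, of 1 j] by linarith
  then show ?thesis
    by (simp add: infnorm_2)
qed

text \<open>
  The chain consists of the images of unit squares strung along a diagonal direction \<open>v\<close> for which
  \<open>Bi v\<close> attains the norm; it starts at \<open>0\<close>, which is a vertex because \<open>b\<close> is an integer point.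
\<close>

lemma connecting_tiles_exist:
  assumes post: "post X \<O> f = P ` Z2" and F: "F = f ^^ n"
  defines "N \<equiv> nat \<lceil>1 / infnorm_op Bi\<rceil>"
  obtains t where "\<forall>j\<in>{1..N}. t j \<in> tiles X f (P ` frontier (cbox 0 1)) n"
    "connectedin X (\<Union>j\<in>{1..N}. t j)"
    "joins_opposite_sides X \<O> f (P ` frontier (cbox 0 1)) (\<Union>j\<in>{1..N}. t j)"
proof -
  let ?\<delta> = "infnorm_op Bi"
  obtain i v where v: "\<forall>k. \<bar>v $ k\<bar> = 1" and vi: "Bi v $ i = ?\<delta>"
    by (rule infnorm_op_attained[OF lin_Bi])
  define c where "c s = b + s *\<^sub>R v" for s
  \<comment> \<open>The lower left corner of the square whose diagonal runs from
    \<open>c (real j - 1)\<close> to \<open>c (real j)\<close>, for any signs in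
    \<open>v\<close>.\<close>
  define m where "m j = (\<chi> k. min (c (real j - 1) $ k) (c (real j) $ k))" for j
  define t where "t j = P ` R ` unit_cell (m j)" for j :: nat
  have v_cases: "v $ k = 1 \<or> v $ k = - 1" for k
    using v[rule_format, of k] by linarith
  have m_Z2: "m j \<in> Z2" for j
    unfolding Z2_def mem_Collect_eq
  proof
    fix k
    have "b $ k \<in> \<int>" "v $ k \<in> \<int>"
      using b_Z2 v_cases[of k] by (auto simp: Z2_def)
    then show "m j $ k \<in> \<int>"
      by (auto simp: m_def c_def min_def)
  qed
  have cell: "c s \<in> unit_cell (m j)" if "real j - 1 \<le> s" "s \<le> real j" for s j
    unfolding mem_unit_cell
  proof
    fix k
    show "m j $ k \<le> c s $ k \<and> c s $ k \<le> m j $ k + 1"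
      using v_cases[of k] that by (auto simp: m_def c_def min_def)
  qed
  have "N \<ge> 1"
    using infnorm_op_Bi_pos by (simp add: N_def Suc_le_eq)
  have conn: "connected (\<Union>j\<in>{1..Suc n}. unit_cell (m j))" for n
  proof (induction n)
    case (Suc n)
    have "(\<Union>j\<in>{1..Suc (Suc n)}. unit_cell (m j)) = (\<Union>j\<in>{1..Suc n}. unit_cell (m j)) \<union> unit_cell (m (Suc (Suc n)))"
      by (auto simp: atLeastAtMostSuc_conv)
    moreover have "c (real (Suc n)) \<in> unit_cell (m (Suc n))" "c (real (Suc n)) \<in> unit_cell (m (Suc (Suc n)))"
      by (intro cell; simp)+
    then have "(\<Union>j\<in>{1..Suc n}. unit_cell (m j)) \<inter> unit_cell (m (Suc (Suc n))) \<noteq> {}"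
      by fastforce
    ultimately show ?case
      using Suc by (simp only:) (intro connected_Un; simp add: convex_connected)
  qed (simp add: convex_connected)
  show ?thesis
  proof
    show "\<forall>j\<in>{1..N}. t j \<in> tiles X f (P ` frontier (cbox 0 1)) n"
      unfolding tiles_eq[OF F] t_def using m_Z2 by blast
    have "connectedin X ((\<lambda>x. P (R x)) ` (\<Union>j\<in>{1..N}. unit_cell (m j)))"
      using conn[of "N - 1"] \<open>N \<ge> 1\<close> by (intro connectedin_continuous_map_image[OF continuous_map_P_R]) simp
    then show "connectedin X (\<Union>j\<in>{1..N}. t j)"
      by (simp add: image_UN t_def image_image)
    have R_c: "R (c s) = s *\<^sub>R Bi v" for s
      by (simp add: R_def c_def linear_cmul[OF lin_Bi])
    have in_tile: "P (s *\<^sub>R Bi v) \<in> t j" if "real j - 1 \<le> s" "s \<le> real j" for s j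
      unfolding t_def using cell[OF that] R_c[of s] by (metis imageI)
    have "P 0 \<in> t 1"
      using in_tile[of 1 0] by simp
    then have "P 0 \<in> (\<Union>j\<in>{1..N}. t j)"
      using \<open>N \<ge> 1\<close> by force
    moreover have "(0 :: real ^ 2) \<in> square_side i 0"
      by (simp add: square_side_def mem_unit_square)
    ultimately have meet0: "(\<Union>j\<in>{1..N}. t j) \<inter> P ` square_side i 0 \<noteq> {}"
      by blast
    \<comment> \<open>Coordinate i of \<open>s *\<^sub>R Bi v\<close> is s times the norm, so it
      equals 1 at this parameter. Rounding up puts the parameter between N - 1 and N, that is, into
      the last square.\<close>
    let ?x = "(1 / ?\<delta>) *\<^sub>R Bi v"
    have "0 < 1 / ?\<delta>"
      using infnorm_op_Bi_pos by simp
    then have "real N - 1 \<le> 1 / ?\<delta>" "1 / ?\<delta> \<le> real N"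
      unfolding N_def by linarith+
    then have "P ?x \<in> t N"
      by (rule in_tile)
    then have "P ?x \<in> (\<Union>j\<in>{1..N}. t j)"
      using \<open>N \<ge> 1\<close> by force
    moreover have "?x $ i = of_int 1"
      using infnorm_op_Bi_pos by (simp add: vi)
    \<comment> \<open>Only coordinate i is controlled; folding brings the other one into
      [0, 1].\<close>
    then have "P ?x \<in> P ` square_side i 1"
      using P_square_side[of ?x i 1] by simp
    ultimately have meet1: "(\<Union>j\<in>{1..N}. t j) \<inter> P ` square_side i 1 \<noteq> {}"
      by blast
    have "P ` square_side i 0 \<inter> P ` square_side i 1 = {}"
      by (simp add: square_sides_disjoint_iff)
    moreover have "P ` square_side i c \<in> zero_edges X \<O> f (P ` frontier (cbox 0 1))" if "c \<in> {0, 1}" for c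
      unfolding zero_edges_eq[OF post] using that by (intro image_eqI[of _ _ "(i, c)"]) auto
    ultimately show "joins_opposite_sides X \<O> f (P ` frontier (cbox 0 1)) (\<Union>j\<in>{1..N}. t j)"
      unfolding joins_opposite_sides_def using meet0 meet1
      by (intro bexI[of _ "P ` square_side i 0"] bexI[of _ "P ` square_side i 1"]) auto
  qed
qed

lemma D_num_bounds:
  assumes post: "post X \<O> f = P ` Z2" and F: "F = f ^^ n"
  shows "1 / infnorm_op Bi \<le> real (D_num X \<O> f (P ` frontier (cbox 0 1)) n)"
    and "real (D_num X \<O> f (P ` frontier (cbox 0 1)) n) \<le> 1 / infnorm_op Bi + 1"
proof -
  let ?C = "P ` frontier (cbox 0 1)" and ?N = "nat \<lceil>1 / infnorm_op Bi\<rceil>"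
  let ?Q = "\<lambda>N. \<exists>t. (\<forall>j\<in>{1..N}. t j \<in> tiles X f ?C n) \<and>
    connectedin X (\<Union>j\<in>{1..N}. t j) \<and> joins_opposite_sides X \<O> f ?C (\<Union>j\<in>{1..N}. t j)"
  obtain t where "\<forall>j\<in>{1..?N}. t j \<in> tiles X f ?C n"
    "connectedin X (\<Union>j\<in>{1..?N}. t j)" "joins_opposite_sides X \<O> f ?C (\<Union>j\<in>{1..?N}. t j)"
    by (rule connecting_tiles_exist[OF post F])
  then have Q: "?Q ?N"
    by blast
  have D: "D_num X \<O> f ?C n = (LEAST N. ?Q N)"
    by (simp add: D_num_def)
  \<comment> \<open>The chain of the upper bound is the witness that makes \<open>LEAST\<close>
    meaningful, so the lower bound rests on it too.\<close>
  have "?Q (D_num X \<O> f ?C n)"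
    unfolding D using Q by (rule LeastI)
  then have "1 \<le> real (D_num X \<O> f ?C n) * infnorm_op Bi"
    by (elim exE conjE) (rule connecting_tiles_lower_bound[OF post F])
  then show "1 / infnorm_op Bi \<le> real (D_num X \<O> f ?C n)"
    using infnorm_op_Bi_pos by (simp add: field_simps)
  have "D_num X \<O> f ?C n \<le> ?N"
    unfolding D using Q by (rule Least_le)
  moreover have "real ?N \<le> 1 / infnorm_op Bi + 1"
    using infnorm_op_Bi_pos by (simp; linarith)
  ultimately show "real (D_num X \<O> f ?C n) \<le> 1 / infnorm_op Bi + 1"
    by linarith
qed

section \<open>Local injectivity of the map and its postcritical set\<close>

lemma F_continuous: "continuous_map X X F"
proof -
  have "continuous_map euclidean X (P \<circ> T)"
    using continuous_on_T[of UNIV] by (intro continuous_map_compose[OF _ P_cont]) simp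
  moreover have "P \<circ> T = F \<circ> P"
    by (simp add: fun_eq_iff F_P T_def)
  moreover have "quotient_map euclidean X P"
    using P_cont P_open P_surj by (intro continuous_open_imp_quotient_map) auto
  ultimately show ?thesis
    by (simp add: continuous_compose_quotient_map_eq)
qed

lemma F_open: "open_map X X F"
  unfolding open_map_def
proof (intro allI impI)
  fix U assume U: "openin X U"
  have "openin euclidean {x \<in> topspace euclidean. P x \<in> U}"
    using P_cont U by (rule openin_continuous_map_preimage)
  then have "open (P -` U)"
    by (simp add: vimage_def)
  moreover have "T ` (P -` U) = R -` (P -` U)"
  proof
    show "R -` (P -` U) \<subseteq> T ` (P -` U)"
      by (metis T_R image_eqI subsetI vimageD)
  qed auto
  ultimately have "open (T ` (P -` U))"
    by (simp only: open_vimage[OF _ continuous_on_R])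
  then have "openin X (P ` T ` (P -` U))"
    using P_open by (simp add: open_map_def)
  moreover have "P ` T ` (P -` U) = F ` P ` (P -` U)"
    unfolding image_image by (intro image_cong) (simp_all add: F_P T_def)
  moreover have "P ` (P -` U) = U"
    using P_surj openin_subset[OF U] by (auto simp: image_vimage_eq)
  ultimately show "openin X (F ` U)"
    by simp
qed

text \<open>Here \<open>T x\<close> is not integral, so \<open>T x + T x\<close> is off the closed
  lattice. For y and y' near x, \<open>P\<close> can identify \<open>T y\<close> with
  \<open>T y'\<close> neither by a reflection, which would put their sum into the lattice, nor by a
  nonzero translation, as they are too close.\<close>

lemma F_locally_injective:
  assumes "F p \<notin> P ` Z2" "p \<in> topspace X"
  obtains W where "openin X W" "p \<in> W" "inj_on F W"
proof -
  obtain x where x: "p = P x"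
    using assms(2) P_surj by blast
  have "T x \<notin> Z2"
    using assms(1) by (auto simp: x F_P T_def)
  then obtain i where i: "T x $ i \<notin> \<int>"
    by (auto simp: Z2_def)
  have "T x + T x \<notin> two_Z2"
    using i by (auto simp: two_Z2_component)
  then obtain e where e: "e > 0" "ball (T x + T x) e \<subseteq> - two_Z2"
    using closed_two_Z2 by (metis ComplI open_Compl open_contains_ball)
  \<comment> \<open>The radius e / 2 keeps the sum of two points off the lattice; 1 / 2 keeps each
    coordinate of their difference below 1, where 0 is the only even integer.\<close>
  define N where "N = T -` ball (T x) (min (e / 2) (1 / 2))"
  have "open N"
    unfolding N_def by (rule open_vimage[OF open_ball continuous_on_T])
  have "inj_on F (P ` N)"
  proof (rule inj_onI)
    fix q q' assume q: "q \<in> P ` N" "q' \<in> P ` N" "F q = F q'"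
    obtain y where y: "q = P y" "y \<in> N"
      using q(1) by blast
    obtain y' where y': "q' = P y'" "y' \<in> N"
      using q(2) by blast
    have norms: "norm (T x - T y) < e / 2" "norm (T x - T y) < 1 / 2" "norm (T x - T y') < e / 2" "norm (T x - T y') < 1 / 2"
      using y(2) y'(2) by (auto simp: N_def dist_norm)
    have "dist (T x + T x) (T y + T y') = norm ((T x - T y) + (T x - T y'))"
      by (simp add: dist_norm algebra_simps)
    also have "\<dots> \<le> norm (T x - T y) + norm (T x - T y')"
      by (rule norm_triangle_ineq)
    also have "\<dots> < e"
      using norms by linarith
    finally have "T y + T y' \<notin> two_Z2"
      using e(2) by auto
    moreover have "P (T y) = P (T y')"
      using q(3) by (simp add: y y' F_P T_def)
    ultimately have L: "T y - T y' \<in> two_Z2"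
      by (simp add: P_eq_iff)
    have "T y $ i = T y' $ i" for i
    proof -
      have "\<bar>(T x - T y) $ i\<bar> < 1 / 2" "\<bar>(T x - T y') $ i\<bar> < 1 / 2"
        using norms(2,4) component_le_norm_cart[of "T x - T y" i] component_le_norm_cart[of "T x - T y'" i] by linarith+
      then have "\<bar>T x $ i - T y $ i\<bar> < 1 / 2" "\<bar>T x $ i - T y' $ i\<bar> < 1 / 2"
        by simp_all
      then have less: "\<bar>T y $ i - T y' $ i\<bar> < 1"
        by linarith
      obtain k :: int where k: "T y $ i - T y' $ i = 2 * of_int k"
        using L by (auto simp: two_Z2_def)
      then have "\<bar>2 * real_of_int k\<bar> < 1"
        using less by simp
      then have "k = 0"
        by linarith
      then show ?thesis
        using k by simp
    qed
    then have "T y = T y'"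
      by (simp add: vec_eq_iff)
    then show "q = q'"
      using y y' by (metis R_T)
  qed
  moreover have "openin X (P ` N)"
    using P_open \<open>open N\<close> by (simp add: open_map_def)
  moreover have "p \<in> P ` N"
    unfolding x using e(1) by (intro imageI) (simp add: N_def)
  ultimately show ?thesis
    using that by blast
qed

text \<open>The fibre is compact and covered by open sets on which \<open>F\<close> is injective,
  each of which contains at most one of its points.\<close>

lemma finite_regular_fibre:
  assumes X: "compact_space X" and q: "q \<notin> P ` Z2"
  shows "finite {p \<in> topspace X. F p = q}"
proof (cases "q \<in> topspace X")
  case True
  let ?K = "{p \<in> topspace X. F p = q}"
  have "closedin X {q}"
    using Hausdorff True by (simp add: closedin_Hausdorff_singleton)
  then have "closedin X {p \<in> topspace X. F p \<in> {q}}"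
    using F_continuous by (rule closedin_continuous_map_preimage[rotated])
  then have K: "compactin X ?K"
    using X by (simp add: closedin_compact_space)
  let ?\<U> = "{W. openin X W \<and> inj_on F W}"
  have "?K \<subseteq> \<Union>?\<U>"
  proof
    fix p assume "p \<in> ?K"
    then show "p \<in> \<Union>?\<U>"
      using q by (auto elim: F_locally_injective[of p])
  qed
  then obtain \<F> where \<F>: "finite \<F>" "\<F> \<subseteq> ?\<U>" "?K \<subseteq> \<Union>\<F>"
    using compactinD[OF K, of ?\<U>] by auto
  have "finite (W \<inter> ?K)" if "W \<in> \<F>" for W
  proof -
    have "inj_on F (W \<inter> ?K)"
      using that \<F>(2) by (auto intro: inj_on_subset)
    moreover have "finite (F ` (W \<inter> ?K))"
      by (rule finite_subset[of _ "{q}"]) auto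
    ultimately show ?thesis
      by (rule finite_imageD[rotated])
  qed
  then have "finite (\<Union>W\<in>\<F>. W \<inter> ?K)"
    using \<F>(1) by (intro finite_UN_I)
  then show ?thesis
    by (rule rev_finite_subset) (use \<F>(3) in blast)
next
  case False
  then have "{p \<in> topspace X. F p = q} = {}"
    using F_continuous by (auto simp: continuous_map_def)
  then show ?thesis
    by (simp only: finite.emptyI)
qed

text \<open>
  Off the preimage of the image of \<open>Z2\<close> the map is locally injective, so all postcritical points lie in
  the image of \<open>Z2\<close>, which has at most four elements.
\<close>

lemma post_eq:
  assumes atlas: "oriented_atlas X \<O>" and X: "compact_space X"
    and type: "has_orbifold_type X \<O> F [2, 2, 2, 2]" and B: "\<And>x. x \<in> Z2 \<Longrightarrow> B x \<in> Z2"
  shows "post X \<O> F = P ` Z2"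
proof -
  obtain \<nu> :: "'a \<Rightarrow> enat" and ps where ps: "distinct ps" "set ps = post X \<O> F" "map \<nu> ps = [2, 2, 2, 2]"
    using type unfolding has_orbifold_type_def by (elim exE conjE) (rule that)
  \<comment> \<open>The type has four entries, so there are four postcritical points. As the image
    of \<open>Z2\<close> has at most four points, inclusion becomes equality.\<close>
  have "length ps = 4"
    using arg_cong[OF ps(3), of length] by simp
  then have card: "card (post X \<O> F) = 4"
    using ps(1,2) distinct_card by metis
  have fin: "finite (post X \<O> F)"
    using ps(2) by (metis List.finite_set)
  define S where "S = {p \<in> topspace X. F p \<notin> P ` Z2}"
  have "critical_points X \<O> F \<inter> S = {}"
  proof (rule critical_points_disjoint_locally_injective[OF atlas F_continuous F_open _ _ _ fin])
    show T1: "t1_space X"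
      using Hausdorff by (rule Hausdorff_imp_t1_space)
    have "P ` Z2 \<subseteq> topspace X"
      using P_surj by blast
    then have "closedin X (P ` Z2)"
      using T1 card_P_Z2(1) by (simp add: t1_space_closedin_finite)
    then have "openin X (topspace X - P ` Z2)"
      by (rule openin_diff[OF openin_topspace])
    with F_continuous have "openin X {p \<in> topspace X. F p \<in> topspace X - P ` Z2}"
      by (rule openin_continuous_map_preimage)
    moreover have "{p \<in> topspace X. F p \<in> topspace X - P ` Z2} = S"
      using F_continuous by (auto simp: S_def continuous_map_def)
    ultimately show "openin X S"
      by simp
    show "\<exists>W. openin X W \<and> p \<in> W \<and> inj_on F W" if "p \<in> S" for p
      using that unfolding S_def by (auto elim: F_locally_injective[of p])
    show "finite {p \<in> S. F p = q}" for q
    proof (cases "q \<in> P ` Z2")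
      case True
      then have "{p \<in> S. F p = q} = {}"
        by (auto simp: S_def)
      then show ?thesis
        by (simp only: finite.emptyI)
    next
      case False
      show ?thesis
        by (rule finite_subset[OF _ finite_regular_fibre[OF X False]]) (auto simp: S_def)
    qed
  qed
  then have crit: "F c \<in> P ` Z2" if "c \<in> critical_points X \<O> F" for c
    using that by (auto simp: S_def critical_points_def)
  have F_Z2: "F p \<in> P ` Z2" if p: "p \<in> P ` Z2" for p
  proof -
    obtain x where "p = P x" "x \<in> Z2"
      using p by blast
    then have "F p = P (B x + b)" "B x + b \<in> Z2"
      using B[of x] b_Z2 by (auto simp: F_P Z2_def)
    then show ?thesis
      by blast
  qed
  have "(F ^^ n) c \<in> P ` Z2" if "n \<ge> 1" "c \<in> critical_points X \<O> F" for n c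
    using that(1) by (induction n rule: dec_induct) (use crit[OF that(2)] F_Z2 in simp_all)
  then have "post X \<O> F \<subseteq> P ` Z2"
    by (auto simp: post_def)
  moreover have "card (P ` Z2) \<le> card (post X \<O> F)"
    using card card_P_Z2(2) by simp
  ultimately show ?thesis
    using card_P_Z2(1) by (metis card_seteq)
qed

text \<open>\<open>T ^^ n\<close> lifts the iterate, and its translation part
  \<open>(T ^^ n) 0\<close> is integral because \<open>T\<close> maps \<open>Z2\<close> into
  itself.\<close>

lemma iterate_tiling:
  assumes B: "\<And>x. x \<in> Z2 \<Longrightarrow> B x \<in> Z2"
  shows "pillow_tiling X P (F ^^ n) (B ^^ n) (Bi ^^ n) ((T ^^ n) 0)"
proof (intro pillow_tiling.intro pillow_tiling_axioms.intro)
  show "pillow X P"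
    by (rule pillow_axioms)
  show "linear (B ^^ n)"
  proof (induction n)
    case (Suc n)
    then show ?case
      using linear_compose[OF _ lin_B] by (simp only: funpow.simps)
  qed (simp add: linear_iff)
  show "linear (Bi ^^ n)"
  proof (induction n)
    case (Suc n)
    then show ?case
      using linear_compose[OF _ lin_Bi] by (simp only: funpow.simps)
  qed (simp add: linear_iff)
  show "(B ^^ n) ((Bi ^^ n) x) = x" for x
    by (induction n arbitrary: x) (simp_all add: funpow_swap1 B_Bi)
  show "(Bi ^^ n) ((B ^^ n) x) = x" for x
    by (induction n arbitrary: x) (simp_all add: funpow_swap1 Bi_B)
  have T_Z2: "T x \<in> Z2" if "x \<in> Z2" for x
    using B[OF that] b_Z2 by (auto simp: T_def Z2_def)
  show "(T ^^ n) 0 \<in> Z2"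
    by (induction n) (auto simp: T_Z2 Z2_def[symmetric], simp add: Z2_def)
  have T_n: "(T ^^ n) x = (B ^^ n) x + (T ^^ n) 0" for x
    by (induction n) (simp_all add: T_def linear_add[OF lin_B])
  have "(F ^^ n) (P x) = P ((T ^^ n) x)" for x
    by (induction n arbitrary: x) (simp_all add: F_P T_def)
  then show "(F ^^ n) (P x) = P ((B ^^ n) x + (T ^^ n) 0)" for x
    using T_n by metis
qed

end

section \<open>Lattes-type maps over the standard lattice\<close>

lemma oriented_sphere_topology:
  assumes "oriented_sphere X \<O>"
  shows "Hausdorff_space X" "compact_space X" "connected_space X"
proof -
  let ?S = "sphere (0 :: real ^ 3) 1"
  have hom: "X homeomorphic_space top_of_set ?S"
    using assms by (simp add: oriented_sphere_def)
  show "Hausdorff_space X"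
    using homeomorphic_Hausdorff_space[OF hom] by (simp add: Hausdorff_space_subtopology)
  show "compact_space X"
    using homeomorphic_compact_space[OF hom] by (simp add: compact_space_subtopology)
  have "connected ?S"
    by (rule connected_sphere) simp
  then show "connected_space X"
    using homeomorphic_connected_space[OF hom] by (simp add: connected_space_subtopology)
qed

text \<open>Surjectivity is topological: the range is open, and closed as the compact image of a
  period square, so it is all of the connected sphere.\<close>

lemma pillow_of_presentation:
  assumes X: "oriented_sphere X \<O>" and h: "homeomorphic_map riemann_sphere X h"
    and \<Theta>: "branched_covering (torus two_Z2) (torus_atlas two_Z2) X \<O> \<Theta>"
      "induced_by_rigid_cyclic_action two_Z2 \<Theta>" "\<Theta> \<circ> torus_proj two_Z2 = h \<circ> wp"
  shows "pillow X (h \<circ> wp)"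
proof
  let ?P = "h \<circ> wp"
  show H: "Hausdorff_space X"
    by (rule oriented_sphere_topology[OF X])
  show cont: "continuous_map euclidean X ?P"
    unfolding \<Theta>(3)[symmetric] using quotient_imp_continuous_map[OF quotient_map_torus] \<Theta>(1)
    by (intro continuous_map_compose[of _ "torus two_Z2"]) (auto simp: branched_covering_def)
  show op: "open_map euclidean X ?P"
    unfolding \<Theta>(3)[symmetric]
    by (rule open_map_compose[OF open_map_torus_proj branched_covering_open_map[OF \<Theta>(1)]])
  have "topspace riemann_sphere = UNIV"
    unfolding riemann_sphere_def by (simp add: UNIV_option_conv)
  then have "inj h"
    using homeomorphic_imp_injective_map[OF h] by simp
  then show eq: "?P x = ?P y \<longleftrightarrow> x - y \<in> two_Z2 \<or> x + y \<in> two_Z2" for x y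
    using wp_eq_iff[OF _ \<Theta>(3,2)] by (simp add: inj_eq)
  show "range ?P = topspace X"
  proof -
    have "range ?P \<subseteq> ?P ` cbox 0 (\<chi> i. 2)"
    proof clarify
      fix x :: "real ^ 2"
      define l :: "real ^ 2" where "l = (\<chi> i. 2 * of_int \<lfloor>x $ i / 2\<rfloor>)"
      have "l \<in> two_Z2"
        by (auto simp: two_Z2_def l_def)
      then have "?P x = ?P (x - l)"
        by (simp only: eq) simp
      moreover have "x - l \<in> cbox 0 (\<chi> i. 2)"
        unfolding mem_box_cart
      proof
        fix i
        have "0 \<le> x $ i - 2 * of_int \<lfloor>x $ i / 2\<rfloor>" "x $ i - 2 * of_int \<lfloor>x $ i / 2\<rfloor> \<le> 2"
          by linarith+
        then show "0 $ i \<le> (x - l) $ i \<and> (x - l) $ i \<le> (\<chi> i. 2) $ i"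
          by (simp add: l_def)
      qed
      ultimately show "?P x \<in> ?P ` cbox 0 (\<chi> i. 2)"
        by blast
    qed
    then have "range ?P = ?P ` cbox 0 (\<chi> i. 2)"
      by blast
    moreover have "compactin X (?P ` cbox 0 (\<chi> i. 2))"
      by (rule image_compactin[OF _ cont]) simp
    ultimately have "closedin X (range ?P)"
      using H by (simp add: compactin_imp_closedin)
    moreover have "openin X (range ?P)"
      using op unfolding open_map_def by (metis open_UNIV open_openin)
    ultimately show ?thesis
      using oriented_sphere_topology(3)[OF X] unfolding connected_space_clopen_in by blast
  qed
qed

text \<open>Points x and -x have the same image, so -Ax + v and Ax + v do too, where A is the
  integer matrix. For generic x their difference -2Ax is not in the lattice, since A is nonzero;
  hence their sum 2v is, and v is integral.\<close>

lemma (in pillow) semiconjugate_translation_integral: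
  assumes sym: "\<And>x. f (P x) = P (int_linear a b c d x + v)" and det: "a * d - b * c \<noteq> 0"
  shows "v \<in> Z2"
proof -
  let ?A = "int_linear a b c d"
  obtain \<xi> where \<xi>: "generic_vector \<xi>"
    by (rule generic_vector_exists)
  have "P (- \<xi>) = P \<xi>"
    by (simp add: P_eq_iff two_Z2_0)
  then have "P (?A (- \<xi>) + v) = P (?A \<xi> + v)"
    using sym by metis
  moreover have "(?A (- \<xi>) + v) - (?A \<xi> + v) = int_linear (- 2 * a) (- 2 * b) (- 2 * c) (- 2 * d) \<xi> - int_linear 0 0 0 0 \<xi>"
    "(?A (- \<xi>) + v) + (?A \<xi> + v) = v + v"
    by (simp_all add: vec2_eq_iff)
  ultimately have "int_linear (- 2 * a) (- 2 * b) (- 2 * c) (- 2 * d) \<xi> - int_linear 0 0 0 0 \<xi> \<in> two_Z2 \<or> v + v \<in> two_Z2"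
    by (simp add: P_eq_iff)
  then show ?thesis
  proof
    assume "int_linear (- 2 * a) (- 2 * b) (- 2 * c) (- 2 * d) \<xi> - int_linear 0 0 0 0 \<xi> \<in> two_Z2"
    from generic_vector_cong[OF \<xi> this] show ?thesis
      using det by simp
  next
    assume "v + v \<in> two_Z2"
    then show ?thesis
      by (simp add: two_Z2_component Z2_def)
  qed
qed

lemma int_linear_Z2: "x \<in> Z2 \<Longrightarrow> int_linear a b c d x \<in> Z2"
  by (simp add: Z2_def forall_2)

theorem proposition2p2:
  fixes X :: "'a topology" and \<O> :: "'a chart set" and f :: "'a \<Rightarrow> 'a"
    and h :: "complex option \<Rightarrow> 'a" and \<Theta> :: "(real ^ 2) set \<Rightarrow> 'a"
    and \<A> A :: "real ^ 2 \<Rightarrow> real ^ 2" and \<P> :: "real ^ 2 \<Rightarrow> 'a" and C :: "'a set"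
  assumes "oriented_sphere X \<O>"
    and "lattes_type_map X \<O> f"
    and "has_orbifold_type X \<O> f [2, 2, 2, 2]"
    and "homeomorphic_map riemann_sphere X h"
    and "\<P> = h \<circ> wp"
    and "lattes_presentation X \<O> f two_Z2 \<A> \<Theta>"
    and "\<Theta> \<circ> torus_proj two_Z2 = \<P>"
    and "f \<circ> \<P> = \<P> \<circ> \<A>"
    and "A = linear_part \<A>"
    and "C = \<P> ` frontier (cbox 0 1)"
  shows "\<forall>n>0. 1 / infnorm_op (inv_into UNIV A ^^ n) \<le> real (D_num X \<O> f C n) \<and>
               real (D_num X \<O> f C n) \<le> 1 / infnorm_op (inv_into UNIV A ^^ n) + 1"
proof -
  obtain g where \<Theta>: "branched_covering (torus two_Z2) (torus_atlas two_Z2) X \<O> \<Theta>"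
      "induced_by_rigid_cyclic_action two_Z2 \<Theta>" and g: "torus_endomorphism_lift two_Z2 \<A> g"
    using assms(6) unfolding lattes_presentation_def by blast
  interpret pillow X \<P>
    unfolding assms(5) using pillow_of_presentation[OF assms(1,4) \<Theta>] assms(5,7) by simp
  have lin: "linear A" "det (matrix A) > 0" and L: "\<And>x y. x - y \<in> two_Z2 \<Longrightarrow> \<A> x - \<A> y \<in> two_Z2"
    using g by (auto simp: torus_endomorphism_lift_def orientation_preserving_affine_def assms(9))
  have "A x \<in> two_Z2" if "x \<in> two_Z2" for x
    using L[of x 0] that by (simp add: assms(9) linear_part_def)
  then obtain a b c d where A: "A = int_linear a b c d" "det (matrix A) = of_int (a * d - b * c)"
    by (rule linear_two_Z2_imp_int_linear[OF lin(1)])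
  have "inj A"
    using lin det_nz_iff_inj[OF lin(1)] by simp
  then have "surj A"
    using linear_injective_imp_surjective[OF lin(1)] by simp
  have inv: "linear (inv_into UNIV A)" "A (inv_into UNIV A x) = x" "inv_into UNIV A (A x) = x" for x
    using lin(1) \<open>inj A\<close> \<open>surj A\<close> by (auto simp: inj_linear_imp_inv_linear surj_f_inv_f)
  have f: "f (\<P> x) = \<P> (A x + \<A> 0)" for x
    using fun_cong[OF assms(8), of x] by (simp add: assms(9) linear_part_def)
  have "\<A> 0 \<in> Z2"
  proof (rule semiconjugate_translation_integral)
    show "f (\<P> x) = \<P> (int_linear a b c d x + \<A> 0)" for x
      using f A(1) by simp
    show "a * d - b * c \<noteq> 0"
      using lin(2) unfolding A(2) of_int_0_less_iff by simp
  qed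
  then interpret tiling: pillow_tiling X \<P> f A "inv_into UNIV A" "\<A> 0"
    by (intro pillow_tiling.intro pillow_tiling_axioms.intro pillow_axioms lin(1) inv f)
  have A_Z2: "A x \<in> Z2" if "x \<in> Z2" for x
    using that unfolding A(1) by (rule int_linear_Z2)
  have post: "post X \<O> f = \<P> ` Z2"
    using assms(1,3) oriented_sphere_topology(2)[OF assms(1)]
    by (intro tiling.post_eq A_Z2) (auto simp: oriented_sphere_def)
  show ?thesis
  proof (intro allI impI)
    fix n :: nat
    interpret iterate: pillow_tiling X \<P> "f ^^ n" "A ^^ n" "inv_into UNIV A ^^ n" "(tiling.T ^^ n) 0"
      by (rule tiling.iterate_tiling[OF A_Z2])
    show "1 / infnorm_op (inv_into UNIV A ^^ n) \<le> real (D_num X \<O> f C n) \<and>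
        real (D_num X \<O> f C n) \<le> 1 / infnorm_op (inv_into UNIV A ^^ n) + 1"
      unfolding assms(10) using iterate.D_num_bounds[OF post refl] by simp
  qed
qed

end
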